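(* Let $n\in\mathbb N$, let $X=X_1\oplus\dots\oplus X_n$ be a complex Banach space decomposed into a direct sum of closed nonzero subspaces, let $A=\{A_{ij}\}\in\mathbf M^+=\mathbf M^+(X_1,\dots,X_n)$ be a lower triangular operator matrix, and let $n\ge i_1>i_2>\dots>i_m\ge1$ with $m\ge2$. Then for $t>0$, $$\exp_{+,t}^{[m-1]}(A;i_1,\dots,i_m)=\int_0^t\int_0^{s_{m-1}}\!\!\cdots\int_0^{s_2}\exp_{+,s_1}(A_{i_1,i_1})A_{i_1,i_2}\exp_{+,s_2-s_1}(A_{i_2,i_2})A_{i_2,i_3}\cdots\exp_{+,s_{m-1}-s_{m-2}}(A_{i_{m-1},i_{m-1}})A_{i_{m-1},i_m}\exp_{+,t-s_{m-1}}(A_{i_m,i_m})\,ds_1\cdots ds_{m-1};$$ for $t<0$, $$\exp_{-,t}^{[m-1]}(A;i_1,\dots,i_m)=\int_t^0\int_{s_{m-1}}^0\!\!\cdots\int_{s_2}^0\exp_{-,s_1}(A_{i_1,i_1})A_{i_1,i_2}\exp_{-,s_2-s_1}(A_{i_2,i_2})A_{i_2,i_3}\cdots\exp_{-,s_{m-1}-s_{m-2}}(A_{i_{m-1},i_{m-1}})A_{i_{m-1},i_m}\exp_{-,t-s_{m-1}}(A_{i_m,i_m})\,ds_1\cdots ds_{m-1};$$ and, if the spectrum $\sigma(A)$ is disjoint from the imaginary axis, for $t\ne0$, $$g_t^{[m-1]}(A;i_1,\dots,i_m)=\int_{-\infty}^{\infty}\!\!\cdots\int_{-\infty}^{\infty}g_{s_1}(A_{i_1,i_1})A_{i_1,i_2}\,g_{s_2-s_1}(A_{i_2,i_2})A_{i_2,i_3}\cdots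 g_{s_{m-1}-s_{m-2}}(A_{i_{m-1},i_{m-1}})A_{i_{m-1},i_m}\,g_{t-s_{m-1}}(A_{i_m,i_m})\,ds_1\cdots ds_{m-1}.$$ (For $m=2$ the integrands are $\exp_{\pm,s_1}(A_{i_1,i_1})A_{i_1,i_2}\exp_{\pm,t-s_1}(A_{i_2,i_2})$ and $g_{s_1}(A_{i_1,i_1})A_{i_1,i_2}g_{t-s_1}(A_{i_2,i_2})$, with a single integration over $s_1$ from $0$ to $t$, from $t$ to $0$, and over $\mathbb R$, respectively.)
   Context: $\mathbf M=\mathbf M(X_1,\dots,X_n)$ is the unital Banach algebra of all operator matrices $\{T_{ij}\}_{i,j=1}^n$ with $T_{ij}$ a bounded linear operator $X_j\to X_i$, with norm $\max_j\sum_i\|T_{ij}\|$; it is isomorphic to the algebra of bounded operators on $X$. $\mathbf M^+$ is the closed unital subalgebra of lower triangular matrices ($T_{ij}=0$ for $i<j$). For $A\in\mathbf M^+$, $\sigma(A)$ is the spectrum of $A$ in $\mathbf M$, and the causal spectrum $\sigma^+(A)$ is the spectrum of $A$ in the algebra $\mathbf M^+$. One has $\sigma(A)\subseteq\sigma^+(A)$, and $\sigma^+(A)=\bigcup_i\sigma(A_{ii})$. $\mathbf 1$ denotes the identity. Contours: for a compact set $K$ and a function $f$ analytic on an open set $D\supseteq K$ ($D$ need not be connected), "$\Gamma$ surrounds $K$" means that $\Gamma\subset D\setminus K$ is a finite union of closed curves having winding number $1$ about each point of $K$ and $0$ about each point outside $D$. For a bounded operator $B$, $f(B)=\frac1{2\pi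 i}\int_\Gamma f(\lambda)(\lambda\mathbf 1-B)^{-1}d\lambda$ with $\Gamma$ surrounding $\sigma(B)$. Functions (for $t\ne0$): $\exp_{+,t}(\lambda)=e^{\lambda t}$ if $t>0$ and $0$ if $t<0$; $\exp_{-,t}(\lambda)=0$ if $t>0$ and $-e^{\lambda t}$ if $t<0$ ($\lambda\in\mathbb C$); $g_t(\lambda)=\exp_{-,t}(\lambda)$ if $\operatorname{Re}\lambda>0$ and $g_t(\lambda)=\exp_{+,t}(\lambda)$ if $\operatorname{Re}\lambda<0$ ($g_t$ is undefined on the imaginary axis). The functions are undefined for $t=0$, which affects only a null set of integration points. For $f$ analytic in a neighborhood of $\sigma^+(A)$ and $n\ge i_1>\dots>i_m\ge1$, $$f^{[m-1]}(A;i_1,\dots,i_m)=\frac1{2\pi i}\int_\Gamma f(\lambda)(\lambda\mathbf1-A_{i_1,i_1})^{-1}A_{i_1,i_2}(\lambda\mathbf1-A_{i_2,i_2})^{-1}A_{i_2,i_3}\cdots A_{i_{m-1},i_m}(\lambda\mathbf1-A_{i_m,i_m})^{-1}\,d\lambda,$$ where $\Gamma$ surrounds $\sigma^+(A)$. (If $\sigma(A)$ does not meet the imaginary axis, then neither does $\sigma^+(A)$, so this applies to $f=g_t$.) *)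

theory Defs
  imports "HOL-Complex_Analysis.Complex_Analysis" "HOL-Algebra.Group"
begin

class complex_normed_vector = real_normed_vector +
  fixes scaleC :: "complex \<Rightarrow> 'a \<Rightarrow> 'a"  (infixr \<open>*\<^sub>C\<close> 75)
  assumes scaleC_add_right: "z *\<^sub>C (x + y) = z *\<^sub>C x + z *\<^sub>C y"
    and scaleC_add_left: "(z + w) *\<^sub>C x = z *\<^sub>C x + w *\<^sub>C x"
    and scaleC_scaleC: "z *\<^sub>C w *\<^sub>C x = (z * w) *\<^sub>C x"
    and scaleR_scaleC: "r *\<^sub>R x = complex_of_real r *\<^sub>C x"
    and norm_scaleC: "norm (z *\<^sub>C x) = cmod z * norm x"

class complex_banach = complex_normed_vector + complete_space
begin
subclass banach ..
end

lemma scaleC_zero_left: "0 *\<^sub>C (x :: 'a::complex_normed_vector) = 0"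
  using scaleR_scaleC[of 0 x] by simp

lemma scaleC_one: "1 *\<^sub>C (x :: 'a::complex_normed_vector) = x"
  using scaleR_scaleC[of 1 x] by simp

lemma bounded_linear_scaleC: "bounded_linear (\<lambda>x. z *\<^sub>C (x :: 'a::complex_normed_vector))"
  by (rule bounded_linear_intro[where K = "cmod z"])
    (simp_all add: scaleC_add_right scaleR_scaleC scaleC_scaleC norm_scaleC mult.commute)

text \<open>The library type of bounded \<^emph>\<open>real\<close>-linear maps into a complex normed space is itself a
  complex normed space; complex linearity of operators is imposed in \<open>block_ops\<close>.\<close>

instantiation blinfun :: (real_normed_vector, complex_normed_vector) complex_normed_vector
begin

lift_definition scaleC_blinfun :: "complex \<Rightarrow> 'a \<Rightarrow>\<^sub>L 'b \<Rightarrow> 'a \<Rightarrow>\<^sub>L 'b"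
  is "\<lambda>z T x. z *\<^sub>C T x"
  by (rule bounded_linear_compose[OF bounded_linear_scaleC])

instance
proof
  fix z w :: complex and r :: real and S T :: "'a \<Rightarrow>\<^sub>L 'b"
  show "z *\<^sub>C (S + T) = z *\<^sub>C S + z *\<^sub>C T"
    by transfer (simp add: scaleC_add_right)
  show "(z + w) *\<^sub>C T = z *\<^sub>C T + w *\<^sub>C T"
    by transfer (simp add: scaleC_add_left)
  show "z *\<^sub>C w *\<^sub>C T = (z * w) *\<^sub>C T"
    by transfer (simp add: scaleC_scaleC)
  show "r *\<^sub>R T = complex_of_real r *\<^sub>C T"
    by transfer (simp add: scaleR_scaleC)
  show "norm (z *\<^sub>C T) = cmod z * norm T"
  proof (cases "z = 0")
    case True
    then have "z *\<^sub>C T = 0"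
      by transfer (simp add: scaleC_zero_left)
    with True show ?thesis by simp
  next
    case False
    have le: "norm (u *\<^sub>C R) \<le> cmod u * norm R" for u and R :: "'a \<Rightarrow>\<^sub>L 'b"
      by (rule norm_blinfun_bound)
        (auto simp: scaleC_blinfun.rep_eq norm_scaleC mult.assoc intro!: mult_left_mono norm_blinfun)
    have "inverse z *\<^sub>C z *\<^sub>C T = T"
      using False
      by transfer (simp add: scaleC_scaleC scaleC_one)
    then have "norm T \<le> cmod (inverse z) * norm (z *\<^sub>C T)"
      using le[of "inverse z" "z *\<^sub>C T"] by simp
    then have "cmod z * norm T \<le> norm (z *\<^sub>C T)"
      using False by (simp add: norm_divide field_simps)
    with le[of z T] show ?thesis by simp
  qed
qed

end

instance blinfun :: (real_normed_vector, complex_banach) complex_banach ..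


definition csubspace :: "'a::complex_normed_vector set \<Rightarrow> bool" where
  "csubspace S \<longleftrightarrow> 0 \<in> S \<and> (\<forall>x\<in>S. \<forall>y\<in>S. x + y \<in> S) \<and> (\<forall>z. \<forall>x\<in>S. z *\<^sub>C x \<in> S)"

definition direct_sum_decomp :: "nat \<Rightarrow> (nat \<Rightarrow> 'a::complex_banach set) \<Rightarrow> bool" where
  "direct_sum_decomp n X \<longleftrightarrow>
     (\<forall>i\<in>{1..n}. csubspace (X i) \<and> closed (X i) \<and> X i \<noteq> {0}) \<and>
     (\<forall>x. \<exists>!c. c \<in> Pi\<^sub>E {1..n} X \<and> x = (\<Sum>i=1..n. c i))"

text \<open>A bounded operator from \<open>X j\<close> to \<open>X i\<close> is represented by its extension by zero to the
  other summands. This extension is bounded because the coordinate projections of a direct sum of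
  finitely many closed subspaces of a Banach space are bounded (open mapping theorem).\<close>

definition block_ops ::
  "nat \<Rightarrow> (nat \<Rightarrow> 'a::complex_banach set) \<Rightarrow> nat \<Rightarrow> nat \<Rightarrow> ('a \<Rightarrow>\<^sub>L 'a) set" where
  "block_ops n X i j =
     {T. (\<forall>z x. blinfun_apply T (z *\<^sub>C x) = z *\<^sub>C T x) \<and> range (blinfun_apply T) \<subseteq> X i \<and>
         (\<forall>k\<in>{1..n} - {j}. \<forall>x\<in>X k. T x = 0)}"

text \<open>With this representation the identity operator of \<open>X i\<close> is the coordinate projection.\<close>

definition block_id :: "nat \<Rightarrow> (nat \<Rightarrow> 'a::complex_banach set) \<Rightarrow> nat \<Rightarrow> 'a \<Rightarrow>\<^sub>L 'a" where
  "block_id n X i = (THE P. P \<in> block_ops n X i i \<and> (\<forall>x\<in>X i. P x = x))"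

definition block_alg ::
  "nat \<Rightarrow> (nat \<Rightarrow> 'a::complex_banach set) \<Rightarrow> nat \<Rightarrow> ('a \<Rightarrow>\<^sub>L 'a) monoid" where
  "block_alg n X i =
     \<lparr>carrier = block_ops n X i i, monoid.mult = (o\<^sub>L), one = block_id n X i\<rparr>"

type_synonym 'a op_matrix = "nat \<Rightarrow> nat \<Rightarrow> 'a \<Rightarrow>\<^sub>L 'a"

text \<open>Matrices are indexed by \<open>{1..n}\<close> and set to zero elsewhere. Only the multiplicative monoids of
  the algebras are recorded, since a spectrum is determined by the invertible elements.\<close>

definition matrix_alg :: "nat \<Rightarrow> (nat \<Rightarrow> 'a::complex_banach set) \<Rightarrow> 'a op_matrix monoid" where
  "matrix_alg n X =
     \<lparr>carrier = {T. \<forall>i j. if i \<in> {1..n} \<and> j \<in> {1..n} then T i j \<in> block_ops n X i j else T i j = 0},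
      monoid.mult = (\<lambda>S T i j. \<Sum>k=1..n. S i k o\<^sub>L T k j),
      one = (\<lambda>i j. if i = j \<and> i \<in> {1..n} then block_id n X i else 0)\<rparr>"

definition lower_matrix_alg ::
  "nat \<Rightarrow> (nat \<Rightarrow> 'a::complex_banach set) \<Rightarrow> 'a op_matrix monoid" where
  "lower_matrix_alg n X =
     (matrix_alg n X)\<lparr>carrier := {T \<in> carrier (matrix_alg n X). \<forall>i j. i < j \<longrightarrow> T i j = 0}\<rparr>"

definition spectrum_op :: "('a \<Rightarrow>\<^sub>L 'a) monoid \<Rightarrow> 'a::complex_banach \<Rightarrow>\<^sub>L 'a \<Rightarrow> complex set" where
  "spectrum_op M B = {z. z *\<^sub>C \<one>\<^bsub>M\<^esub> - B \<notin> Units M}"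

definition spectrum_mat :: "'a::complex_banach op_matrix monoid \<Rightarrow> 'a op_matrix \<Rightarrow> complex set" where
  "spectrum_mat M A = {z. (\<lambda>i j. z *\<^sub>C \<one>\<^bsub>M\<^esub> i j - A i j) \<notin> Units M}"

abbreviation spectrum ::
  "nat \<Rightarrow> (nat \<Rightarrow> 'a::complex_banach set) \<Rightarrow> 'a op_matrix \<Rightarrow> complex set" where
  "spectrum n X A \<equiv> spectrum_mat (matrix_alg n X) A"

abbreviation causal_spectrum ::
  "nat \<Rightarrow> (nat \<Rightarrow> 'a::complex_banach set) \<Rightarrow> 'a op_matrix \<Rightarrow> complex set" where
  "causal_spectrum n X A \<equiv> spectrum_mat (lower_matrix_alg n X) A"

definition resolvent :: "('a \<Rightarrow>\<^sub>L 'a) monoid \<Rightarrow> 'a::complex_banach \<Rightarrow>\<^sub>L 'a \<Rightarrow> complex \<Rightarrow> 'a \<Rightarrow>\<^sub>L 'a" where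
  "resolvent M B z = inv\<^bsub>M\<^esub> (z *\<^sub>C \<one>\<^bsub>M\<^esub> - B)"


text \<open>A contour is a finite list of closed paths.\<close>

definition surrounds :: "(real \<Rightarrow> complex) list \<Rightarrow> complex set \<Rightarrow> complex set \<Rightarrow> bool" where
  "surrounds \<Gamma> D K \<longleftrightarrow>
     (\<forall>\<gamma>\<in>set \<Gamma>. valid_path \<gamma> \<and> pathfinish \<gamma> = pathstart \<gamma> \<and> path_image \<gamma> \<subseteq> D - K) \<and>
     (\<forall>z\<in>K. (\<Sum>\<gamma>\<leftarrow>\<Gamma>. winding_number \<gamma> z) = 1) \<and>
     (\<forall>z. z \<notin> D \<longrightarrow> (\<Sum>\<gamma>\<leftarrow>\<Gamma>. winding_number \<gamma> z) = 0)"

text \<open>The vector-valued analogue of the library's \<open>contour_integral\<close>, summed over the curves.\<close>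

definition cycle_integral ::
  "(real \<Rightarrow> complex) list \<Rightarrow> (complex \<Rightarrow> 'b::complex_banach) \<Rightarrow> 'b" where
  "cycle_integral \<Gamma> F =
     (\<Sum>\<gamma>\<leftarrow>\<Gamma>. integral {0..1} (\<lambda>s. vector_derivative \<gamma> (at s within {0..1}) *\<^sub>C F (\<gamma> s)))"

text \<open>The common value of the Cauchy-type integral of \<open>F\<close> over all contours in \<open>D\<close>
  surrounding \<open>K\<close>.\<close>

definition cauchy_value :: "complex set \<Rightarrow> complex set \<Rightarrow> (complex \<Rightarrow> 'b::complex_banach) \<Rightarrow> 'b" where
  "cauchy_value D K F =
     (THE v. \<forall>\<Gamma>. surrounds \<Gamma> D K \<longrightarrow> v = (1 / (2 * of_real pi * \<i>)) *\<^sub>C cycle_integral \<Gamma> F)"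

text \<open>\<open>f(B)\<close> for \<open>f\<close> analytic on the open set \<open>D\<close>, computed in the algebra \<open>M\<close>.\<close>

definition fun_calc ::
  "complex set \<Rightarrow> (complex \<Rightarrow> complex) \<Rightarrow> ('a \<Rightarrow>\<^sub>L 'a) monoid \<Rightarrow> 'a::complex_banach \<Rightarrow>\<^sub>L 'a \<Rightarrow> 'a \<Rightarrow>\<^sub>L 'a" where
  "fun_calc D f M B = cauchy_value D (spectrum_op M B) (\<lambda>z. f z *\<^sub>C resolvent M B z)"

text \<open>The product \<open>B\<^sub>1 A(\<iota>\<^sub>1,\<iota>\<^sub>2) B\<^sub>2 A(\<iota>\<^sub>2,\<iota>\<^sub>3) \<cdots> A(\<iota>\<^sub>p,\<iota>\<^sub>p\<^sub>+\<^sub>1) B\<^sub>p\<^sub>+\<^sub>1\<close>.\<close>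

primrec alt_prod ::
  "'a::complex_banach op_matrix \<Rightarrow> (nat \<Rightarrow> nat) \<Rightarrow> (nat \<Rightarrow> 'a \<Rightarrow>\<^sub>L 'a) \<Rightarrow> nat \<Rightarrow> 'a \<Rightarrow>\<^sub>L 'a" where
  "alt_prod A \<iota> B 0 = B 1"
| "alt_prod A \<iota> B (Suc p) = alt_prod A \<iota> B p o\<^sub>L A (\<iota> (p + 1)) (\<iota> (p + 2)) o\<^sub>L B (p + 2)"

text \<open>\<open>f\<^sup>[\<^sup>p\<^sup>](A; \<iota>\<^sub>1, \<dots>, \<iota>\<^sub>p\<^sub>+\<^sub>1)\<close> for \<open>f\<close> analytic on the open set \<open>D\<close>.\<close>

definition div_diff ::
  "nat \<Rightarrow> (nat \<Rightarrow> 'a::complex_banach set) \<Rightarrow> complex set \<Rightarrow> (complex \<Rightarrow> complex) \<Rightarrow> nat \<Rightarrow>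
   'a op_matrix \<Rightarrow> (nat \<Rightarrow> nat) \<Rightarrow> 'a \<Rightarrow>\<^sub>L 'a" where
  "div_diff n X D f p A \<iota> =
     cauchy_value D (causal_spectrum n X A)
       (\<lambda>z. f z *\<^sub>C
         alt_prod A \<iota> (\<lambda>k. resolvent (block_alg n X (\<iota> k)) (A (\<iota> k) (\<iota> k)) z) p)"


text \<open>The value \<open>0\<close> at \<open>t = 0\<close>, and on the imaginary axis for \<open>g_fun\<close>, is a dummy: the functions are
  undefined there.\<close>

definition exp_plus :: "real \<Rightarrow> complex \<Rightarrow> complex" where
  "exp_plus t z = (if t > 0 then exp (z * of_real t) else 0)"

definition exp_minus :: "real \<Rightarrow> complex \<Rightarrow> complex" where
  "exp_minus t z = (if t < 0 then - exp (z * of_real t) else 0)"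

definition g_fun :: "real \<Rightarrow> complex \<Rightarrow> complex" where
  "g_fun t z = (if Re z > 0 then exp_minus t z else if Re z < 0 then exp_plus t z else 0)"

definition g_dom :: "complex set" where
  "g_dom = {z. Re z \<noteq> 0}"


text \<open>The integrand \<open>h\<^sub>s\<^sub>1(A\<^sub>1\<^sub>1) A\<^sub>1\<^sub>2 h\<^sub>s\<^sub>2\<^sub>-\<^sub>s\<^sub>1(A\<^sub>2\<^sub>2) \<cdots>\<close> (at the indices \<open>\<iota>\<close>), read with \<open>s\<^sub>0 = 0\<close> and
  \<open>s\<^sub>p\<^sub>+\<^sub>1 = t\<close> as provided by \<open>simplex_point\<close> and its updates.\<close>

definition integrand ::
  "nat \<Rightarrow> (nat \<Rightarrow> 'a::complex_banach set) \<Rightarrow> complex set \<Rightarrow> (real \<Rightarrow> complex \<Rightarrow> complex) \<Rightarrow> nat \<Rightarrow>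
   'a op_matrix \<Rightarrow> (nat \<Rightarrow> nat) \<Rightarrow> (nat \<Rightarrow> real) \<Rightarrow> 'a \<Rightarrow>\<^sub>L 'a" where
  "integrand n X D h p A \<iota> s =
     alt_prod A \<iota>
       (\<lambda>k. fun_calc D (h (s k - s (k - 1))) (block_alg n X (\<iota> k)) (A (\<iota> k) (\<iota> k))) p"

definition simplex_point :: "nat \<Rightarrow> real \<Rightarrow> nat \<Rightarrow> real" where
  "simplex_point p t = (\<lambda>_. 0)(p + 1 := t)"

text \<open>\<open>has_iterated_integral L F r s v\<close>: the iterated integral of \<open>F\<close> over the coordinates
  \<open>s\<^sub>1, \<dots>, s\<^sub>r\<close> (innermost \<open>s\<^sub>1\<close>, outermost \<open>s\<^sub>r\<close>) exists and equals \<open>v\<close>, where \<open>s\<^sub>k\<close> runs over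
  \<open>L k s\<close>, a set that may depend on the outer coordinates, and the coordinates beyond \<open>r\<close> are those
  of \<open>s\<close>.\<close>

primrec has_iterated_integral ::
  "(nat \<Rightarrow> (nat \<Rightarrow> real) \<Rightarrow> real set) \<Rightarrow> ((nat \<Rightarrow> real) \<Rightarrow> 'b::real_normed_vector) \<Rightarrow>
   nat \<Rightarrow> (nat \<Rightarrow> real) \<Rightarrow> 'b \<Rightarrow> bool" where
  "has_iterated_integral L F 0 s v \<longleftrightarrow> v = F s"
| "has_iterated_integral L F (Suc r) s v \<longleftrightarrow>
     (\<exists>G. (\<forall>u \<in> L (Suc r) s. has_iterated_integral L F r (s(Suc r := u)) (G u)) \<and>
          (G has_integral v) (L (Suc r) s))"

end

theory Submission
  imports Defs
begin

text \<open>Write \<open>R\<^sub>k\<close> for the resolvent of the \<open>k\<close>-th diagonal block \<open>B\<^sub>k\<close>, \<open>A\<^sub>k\<close> for the off-diagonal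
  factors and \<open>\<Phi>\<^sub>p = R\<^sub>1 A\<^sub>1 R\<^sub>2 \<cdots> A\<^sub>p R\<^sub>p\<^sub>+\<^sub>1\<close>. Since \<open>z R\<^sub>k = 1 + R\<^sub>k B\<^sub>k\<close>, the functions
  \<open>E\<^sub>p(t) = (2\<pi>i)\<inverse> \<integral> e\<^sup>t\<^sup>z \<Phi>\<^sub>p(z) dz\<close> satisfy \<open>E\<^sub>p\<^sub>+\<^sub>1' = E\<^sub>p A\<^sub>p\<^sub>+\<^sub>1 + E\<^sub>p\<^sub>+\<^sub>1 B\<^sub>p\<^sub>+\<^sub>2\<close>, while
  \<open>H\<^sub>k(t) = (2\<pi>i)\<inverse> \<integral> e\<^sup>t\<^sup>z R\<^sub>k(z) dz\<close> satisfies \<open>H\<^sub>k' = B\<^sub>k H\<^sub>k\<close>. Hence \<open>E\<^sub>p\<^sub>+\<^sub>1(s) H\<^sub>p\<^sub>+\<^sub>2(t - s)\<close> is an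
  antiderivative of \<open>E\<^sub>p(s) A\<^sub>p\<^sub>+\<^sub>1 H\<^sub>p\<^sub>+\<^sub>2(t - s)\<close>, and the fundamental theorem of calculus shows that each
  divided difference is the convolution of the previous one with \<open>A\<^sub>p\<^sub>+\<^sub>1 H\<^sub>p\<^sub>+\<^sub>2\<close>. All three formulas
  are instances with two cycles \<open>\<Gamma>p\<close>, \<open>\<Gamma>n\<close> carrying the parts of the integrand active for \<open>t < 0\<close>
  and for \<open>t > 0\<close>; their sum surrounds the causal spectrum, so that the values of \<open>E\<^sub>p\<^sub>+\<^sub>1\<close> at \<open>0\<close>
  cancel and those of \<open>H\<^sub>k\<close> add up to the identity.

  Independence of the contour is proved without scalarization: right multiplication by
  \<open>z - B\<close> makes the Cauchy transform of \<open>\<Phi>\<^sub>p\<close> constant near the spectrum of \<open>B\<close>, and the resulting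
  entire function vanishes by Liouville's theorem.\<close>

text \<open>\<open>cauchy_value\<close> is a definite description over all surrounding contours, so
  each use of it needs one contour that exists and the agreement of all of them; hence the explicit
  circles and the weight given to independence of the contour. The two differential equations are
  deliberately taken on opposite sides: the diagonal block multiplies \<open>E\<close> on the right
  and \<open>H\<close> on the left, so in the derivative of E(s) H(t - s) its two occurrences
  cancel. In the equation for \<open>H\<close> the identity term drops out because the exponential
  is entire and the curves are closed. The functions jump at s = 0 and s = t, but the antiderivative
  is continuous there. For the integral over the whole line the limits at both ends exist because
  the two cycles lie in opposite open half-planes. Diagonal blocks, all complex-linear operators and
  triangular operators have different units; one theory of closed operator algebras with a unit of
  their own covers the three. For the blocks this unit is a coordinate projection, whose boundedness
  is where completeness enters through Baire's theorem.\<close>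

section \<open>Vector-valued complex analysis\<close>

interpretation scaleC: bounded_bilinear "(*\<^sub>C) :: complex \<Rightarrow> 'a::complex_normed_vector \<Rightarrow> 'a"
proof
  fix a a' :: complex and b b' :: 'a and r :: real
  show "(r *\<^sub>R a) *\<^sub>C b = r *\<^sub>R a *\<^sub>C b"
    by (simp add: scaleR_scaleC scaleC_scaleC scaleR_conv_of_real)
  show "a *\<^sub>C r *\<^sub>R b = r *\<^sub>R a *\<^sub>C b"
    by (simp add: scaleR_scaleC scaleC_scaleC mult.commute)
  show "\<exists>K. \<forall>a (b::'a). norm (a *\<^sub>C b) \<le> norm a * norm b * K"
    by (rule exI[of _ 1]) (simp add: norm_scaleC)
qed (simp_all add: scaleC_add_left scaleC_add_right)

lemmas [continuous_intros] = scaleC.continuous_on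
lemmas [tendsto_intros] = scaleC.tendsto

text \<open>Continuity of the derivative is built in because radial primitives and circle means are
  differentiated under the integral sign; it takes the place of Goursat's argument. That the
  derivative multiplies one vector \<open>F' z\<close> by \<open>h\<close> encodes its complex
  linearity.\<close>

definition C1_holo :: "(complex \<Rightarrow> 'b::complex_banach) \<Rightarrow> complex set \<Rightarrow> bool" where
  "C1_holo F S \<longleftrightarrow>
     (\<exists>F'. (\<forall>z\<in>S. (F has_derivative (\<lambda>h. h *\<^sub>C F' z)) (at z)) \<and> continuous_on S F')"

lemma has_derivative_compose_scaleC:
  fixes F :: "complex \<Rightarrow> 'b::complex_banach"
  assumes "(F has_derivative (\<lambda>h. h *\<^sub>C d)) (at (g x))" "(g has_derivative g') (at x within s)"
  shows "((\<lambda>x. F (g x)) has_derivative (\<lambda>h. g' h *\<^sub>C d)) (at x within s)"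
  by (rule has_derivative_compose[OF assms(2,1)])

lemma C1_holo_continuous_on: "C1_holo F S \<Longrightarrow> continuous_on S F"
  unfolding C1_holo_def
  by (meson continuous_at_imp_continuous_on has_derivative_continuous)

lemma C1_holo_subset: "C1_holo F S \<Longrightarrow> T \<subseteq> S \<Longrightarrow> C1_holo F T"
  unfolding C1_holo_def using continuous_on_subset by blast

lemma C1_holo_add:
  assumes "C1_holo F S" "C1_holo G S"
  shows "C1_holo (\<lambda>z. F z + G z) S"
proof -
  obtain F' G' where "\<forall>z\<in>S. (F has_derivative (\<lambda>h. h *\<^sub>C F' z)) (at z)" "continuous_on S F'"
     "\<forall>z\<in>S. (G has_derivative (\<lambda>h. h *\<^sub>C G' z)) (at z)" "continuous_on S G'"
    using assms unfolding C1_holo_def by blast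
  then show ?thesis unfolding C1_holo_def
    by (intro exI[of _ "\<lambda>z. F' z + G' z"])
      (auto intro!: derivative_eq_intros continuous_intros simp: scaleC_add_right)
qed

lemma C1_holo_linear:
  assumes "C1_holo F S" "bounded_linear T" "\<And>c x. T (c *\<^sub>C x) = c *\<^sub>C T x"
  shows "C1_holo (\<lambda>z. T (F z)) S"
proof -
  obtain F' where F: "\<And>z. z \<in> S \<Longrightarrow> (F has_derivative (\<lambda>h. h *\<^sub>C F' z)) (at z)"
     "continuous_on S F'"
    using assms unfolding C1_holo_def by blast
  then show ?thesis unfolding C1_holo_def
    by (intro exI[of _ "\<lambda>z. T (F' z)"])
      (auto intro!: bounded_linear.has_derivative[OF assms(2), THEN has_derivative_eq_rhs]
         bounded_linear.continuous_on[OF assms(2)] simp: assms(3))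
qed

lemma C1_holo_const: "C1_holo (\<lambda>_. c) S"
  unfolding C1_holo_def
  by (intro exI[of _ "\<lambda>_. 0"]) (auto simp: scaleC.zero_right)

lemma C1_holo_scale:
  assumes "open S" "f holomorphic_on S" "C1_holo F S"
  shows "C1_holo (\<lambda>z. f z *\<^sub>C F z) S"
proof -
  obtain F' where F: "\<And>z. z \<in> S \<Longrightarrow> (F has_derivative (\<lambda>h. h *\<^sub>C F' z)) (at z)"
     "continuous_on S F'"
    using assms unfolding C1_holo_def by blast
  have f: "(f has_derivative (\<lambda>h. deriv f z * h)) (at z)" if "z \<in> S" for z
    using holomorphic_derivI[OF assms(2,1) that] by (simp add: has_field_derivative_def)
  show ?thesis unfolding C1_holo_def
  proof (intro exI[of _ "\<lambda>z. f z *\<^sub>C F' z + deriv f z *\<^sub>C F z"] conjI ballI)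
    fix z assume "z \<in> S"
    then show "((\<lambda>z. f z *\<^sub>C F z) has_derivative (\<lambda>h. h *\<^sub>C (f z *\<^sub>C F' z + deriv f z *\<^sub>C F z))) (at z)"
      by (intro scaleC.FDERIV[OF f F(1), THEN has_derivative_eq_rhs])
        (auto simp: fun_eq_iff scaleC_add_right scaleC_scaleC mult.commute)
  next
    show "continuous_on S (\<lambda>z. f z *\<^sub>C F' z + deriv f z *\<^sub>C F z)"
      by (intro continuous_intros F(2) C1_holo_continuous_on[OF assms(3)]
          holomorphic_on_imp_continuous_on[OF assms(2)]
          holomorphic_on_imp_continuous_on[OF holomorphic_deriv[OF assms(2,1)]])
  qed
qed

text \<open>The general Leibniz rule wants the derivative as a \<open>blinfun\<close>. The map
  \<open>\<lambda>h. h *\<^sub>C d\<close> is \<open>scaleC.prod_left d\<close>, and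
  \<open>prod_left\<close> is itself bounded linear in \<open>d\<close>, so the integral moves
  inside it.\<close>

lemma leibniz_scaleC:
  fixes g g' :: "complex \<Rightarrow> real \<Rightarrow> 'b::complex_banach"
  assumes "\<And>x t. x \<in> U \<Longrightarrow> t \<in> {a..b} \<Longrightarrow>
      ((\<lambda>x. g x t) has_derivative (\<lambda>h. h *\<^sub>C g' x t)) (at x within U)"
    and "\<And>x. x \<in> U \<Longrightarrow> continuous_on {a..b} (g x)"
    and cont: "continuous_on (U \<times> {a..b}) (\<lambda>(x, t). g' x t)"
    and x0: "x0 \<in> U" "convex U"
  shows "((\<lambda>x. integral {a..b} (g x)) has_derivative (\<lambda>h. h *\<^sub>C integral {a..b} (g' x0)))
           (at x0 within U)"
proof -
  have cont': "continuous_on {a..b} (g' x0)"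
    using continuous_on_compose2[OF cont, of "{a..b}" "\<lambda>t. (x0, t)"] x0
    by (auto intro!: continuous_intros simp: continuous_on_Pair)
  have "((\<lambda>x. integral (cbox a b) (g x)) has_derivative
      blinfun_apply (integral (cbox a b) (\<lambda>t. scaleC.prod_left (g' x0 t)))) (at x0 within U)"
  proof (rule leibniz_rule[where U = U and fx = "\<lambda>x t. scaleC.prod_left (g' x t)"])
    show "continuous_on (U \<times> cbox a b) (\<lambda>(x, t). scaleC.prod_left (g' x t))"
      using bounded_linear.continuous_on[OF scaleC.bounded_linear_prod_left cont]
      by (simp add: split_beta)
  qed (use assms in \<open>auto simp: scaleC.prod_left.rep_eq intro: integrable_continuous_real\<close>)
  also have "integral (cbox a b) (\<lambda>t. scaleC.prod_left (g' x0 t)) =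
      scaleC.prod_left (integral {a..b} (g' x0))"
    using integral_linear[OF integrable_continuous_real[OF cont'] scaleC.bounded_linear_prod_left]
    by (simp add: o_def)
  finally show ?thesis by (simp add: scaleC.prod_left.rep_eq)
qed

text \<open>The primitive is the integral along the segment from the centre. Differentiating under
  the integral sign gives the integrand d/ds (s F(z0 + s (z - z0))), whose integral over [0, 1] is
  F(z).\<close>

lemma C1_holo_primitive:
  fixes F :: "complex \<Rightarrow> 'b::complex_banach"
  assumes "C1_holo F (ball z0 r)"
  shows "\<exists>G. \<forall>z\<in>ball z0 r. (G has_derivative (\<lambda>h. h *\<^sub>C F z)) (at z)"
proof -
  obtain F' where F: "\<And>z. z \<in> ball z0 r \<Longrightarrow> (F has_derivative (\<lambda>h. h *\<^sub>C F' z)) (at z)"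
     and F': "continuous_on (ball z0 r) F'"
    using assms unfolding C1_holo_def by blast
  note Fc = C1_holo_continuous_on[OF assms]
  have inb: "z0 + of_real s * (z - z0) \<in> ball z0 r" if "z \<in> ball z0 r" "s \<in> {0..1}" for z s
  proof -
    have "s * dist z0 z \<le> 1 * dist z0 z"
      using that by (intro mult_right_mono) auto
    then show ?thesis using that
      by (auto simp: dist_norm norm_mult norm_minus_commute)
  qed
  define g where "g = (\<lambda>z s. (z - z0) *\<^sub>C F (z0 + of_real s * (z - z0)))"
  define g' where "g' = (\<lambda>z s. F (z0 + of_real s * (z - z0)) +
      (of_real s * (z - z0)) *\<^sub>C F' (z0 + of_real s * (z - z0)))"
  have Fd: "((\<lambda>x. F (z0 + of_real s * (x - z0))) has_derivative
      (\<lambda>h. (of_real s * h) *\<^sub>C F' (z0 + of_real s * (z - z0)))) (at z)"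
    if "z \<in> ball z0 r" "s \<in> {0..1}" for z s
    by (rule has_derivative_compose_scaleC[where g = "\<lambda>x. z0 + of_real s * (x - z0)",
          OF F[OF inb[OF that]]])
      (auto intro!: derivative_eq_intros)
  have der: "((\<lambda>x. g x s) has_derivative (\<lambda>h. h *\<^sub>C g' z s)) (at z within ball z0 r)"
    if "z \<in> ball z0 r" "s \<in> {0..1}" for z s
    unfolding g_def g'_def
    by (rule has_derivative_at_withinI,
        rule scaleC.FDERIV[OF _ Fd[OF that], of "\<lambda>x. x - z0" "\<lambda>h. h", THEN has_derivative_eq_rhs])
      (auto intro!: derivative_eq_intros simp: scaleC_add_right scaleC_scaleC mult_ac)
  have cc: "continuous_on (ball z0 r \<times> {0..1}) (\<lambda>(z, s). z0 + complex_of_real s * (z - z0))"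
    unfolding split_beta by (intro continuous_intros)
  have im: "(\<lambda>(z, s). z0 + complex_of_real s * (z - z0)) ` (ball z0 r \<times> {0..1}) \<subseteq> ball z0 r"
    using inb by auto
  have cont: "continuous_on (ball z0 r \<times> {0..1}) (\<lambda>(z, s). g' z s)"
    unfolding g'_def split_beta
    using continuous_on_compose2[OF Fc cc im] continuous_on_compose2[OF F' cc im]
    by (intro continuous_intros) (auto simp: split_beta)
  have contg: "continuous_on {0..1} (g z)" if "z \<in> ball z0 r" for z
    unfolding g_def using inb[OF that]
    by (intro continuous_intros continuous_on_compose2[OF Fc]) auto
  have "((\<lambda>x. integral {0..1} (g x)) has_derivative (\<lambda>h. h *\<^sub>C F z)) (at z)"
    if z: "z \<in> ball z0 r" for z
  proof -
    have "(g' z has_integral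
        (1 *\<^sub>R F (z0 + of_real 1 * (z - z0)) - 0 *\<^sub>R F (z0 + of_real 0 * (z - z0)))) {0..1}"
    proof (rule fundamental_theorem_of_calculus)
      fix s :: real assume s: "s \<in> {0..1}"
      have 1: "((\<lambda>s. F (z0 + of_real s * (z - z0))) has_derivative
          (\<lambda>h. (of_real h * (z - z0)) *\<^sub>C F' (z0 + of_real s * (z - z0)))) (at s within {0..1})"
        by (rule has_derivative_compose_scaleC[where g = "\<lambda>s. z0 + of_real s * (z - z0)",
              OF F[OF inb[OF z s]]])
          (auto intro!: derivative_eq_intros)
      show "((\<lambda>s. s *\<^sub>R F (z0 + of_real s * (z - z0))) has_vector_derivative g' z s)
          (at s within {0..1})"
        unfolding has_vector_derivative_def g'_def
        by (rule has_derivative_scaleR[OF _ 1, of "\<lambda>s. s" "\<lambda>h. h", THEN has_derivative_eq_rhs])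
          (auto simp: scaleR_scaleC scaleC_add_right scaleC_scaleC mult_ac)
    qed auto
    then have "integral {0..1} (g' z) = F z"
      by (auto intro: integral_unique)
    moreover have "((\<lambda>x. integral {0..1} (g x)) has_derivative
        (\<lambda>h. h *\<^sub>C integral {0..1} (g' z))) (at z within ball z0 r)"
      by (rule leibniz_scaleC[OF der contg cont z]) auto
    ultimately show ?thesis
      using z at_within_open[OF z open_ball] by simp
  qed
  then show ?thesis by blast
qed

text \<open>The integral of F over the angle on the circle of radius r about z0 does not depend on
  r: its r-derivative has the integrand cis(theta) F', which up to the factor i r is the
  theta-derivative of a periodic function. At r = 0 it is 2 pi F(z0); for large r it is arbitrarily
  small.\<close>

lemma C1_holo_Liouville:
  fixes F :: "complex \<Rightarrow> 'b::complex_banach"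
  assumes "C1_holo F UNIV" and lim: "(F \<longlongrightarrow> 0) at_infinity"
  shows "F z0 = 0"
proof -
  obtain F' where F: "\<And>z. (F has_derivative (\<lambda>h. h *\<^sub>C F' z)) (at z)"
     and F': "continuous_on UNIV F'"
    using assms unfolding C1_holo_def by blast
  note Fc = C1_holo_continuous_on[OF assms(1)]
  define \<phi> where "\<phi> = (\<lambda>r. integral {0..2*pi} (\<lambda>\<theta>. F (z0 + of_real r * cis \<theta>)))"
  have cc: "continuous_on A (\<lambda>(r, \<theta>). z0 + complex_of_real r * cis \<theta>)" for A
    unfolding split_beta by (intro continuous_intros)
  have c1: "continuous_on {0..2*pi} (\<lambda>\<theta>. F (z0 + of_real r * cis \<theta>))" for r
    by (intro continuous_on_compose2[OF Fc] continuous_intros) auto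
  have \<phi>d: "(\<phi> has_vector_derivative
      integral {0..2*pi} (\<lambda>\<theta>. cis \<theta> *\<^sub>C F' (z0 + of_real r * cis \<theta>))) (at r)" for r
  proof -
    have "((\<lambda>r. integral (cbox 0 (2*pi)) (\<lambda>\<theta>. F (z0 + of_real r * cis \<theta>))) has_vector_derivative
      integral (cbox 0 (2*pi)) (\<lambda>\<theta>. cis \<theta> *\<^sub>C F' (z0 + of_real r * cis \<theta>))) (at r within UNIV)"
    proof (rule leibniz_rule_vector_derivative)
      fix x t :: real
      show "((\<lambda>x. F (z0 + complex_of_real x * cis t)) has_vector_derivative
          cis t *\<^sub>C F' (z0 + complex_of_real x * cis t)) (at x)"
        unfolding has_vector_derivative_def
        by (rule has_derivative_compose_scaleC[where g = "\<lambda>x. z0 + complex_of_real x * cis t",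
              OF F, THEN has_derivative_eq_rhs])
          (auto intro!: derivative_eq_intros simp: scaleR_scaleC scaleC_scaleC)
      show "(\<lambda>t. F (z0 + complex_of_real x * cis t)) integrable_on cbox 0 (2 * pi)"
        using c1 by (intro integrable_continuous) auto
    next
      have "continuous_on (UNIV \<times> cbox 0 (2*pi)) (\<lambda>x. F' (z0 + complex_of_real (fst x) * cis (snd x)))"
        using continuous_on_compose2[OF F' cc] by (simp add: split_beta)
      then show "continuous_on (UNIV \<times> cbox 0 (2*pi))
          (\<lambda>(x, t). cis t *\<^sub>C F' (z0 + complex_of_real x * cis t))"
        unfolding split_beta by (intro continuous_intros) auto
    qed auto
    then show ?thesis by (simp add: \<phi>_def)
  qed
  have \<phi>0: "integral {0..2*pi} (\<lambda>\<theta>. cis \<theta> *\<^sub>C F' (z0 + of_real r * cis \<theta>)) = 0"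
    if "r > 0" for r
  proof -
    have "((\<lambda>\<theta>. (of_real r * \<i> * cis \<theta>) *\<^sub>C F' (z0 + of_real r * cis \<theta>)) has_integral
       (F (z0 + of_real r * cis (2*pi)) - F (z0 + of_real r * cis 0))) {0..2*pi}"
    proof (rule fundamental_theorem_of_calculus)
      fix x :: real
      show "((\<lambda>\<theta>. F (z0 + of_real r * cis \<theta>)) has_vector_derivative
         (of_real r * \<i> * cis x) *\<^sub>C F' (z0 + of_real r * cis x)) (at x within {0..2*pi})"
        unfolding has_vector_derivative_def
        by (rule has_derivative_compose_scaleC[where g = "\<lambda>x. z0 + of_real r * cis x", OF F,
              THEN has_derivative_eq_rhs])
          (auto intro!: derivative_eq_intros simp: scaleR_scaleC scaleC_scaleC mult_ac cis_mult
            scaleR_conv_of_real)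
    qed auto
    then have "((\<lambda>\<theta>. (of_real r * \<i> * cis \<theta>) *\<^sub>C F' (z0 + of_real r * cis \<theta>))
        has_integral 0) {0..2*pi}"
      by simp
    from has_integral_linear[OF this scaleC.bounded_linear_right, of "inverse (of_real r * \<i>)"]
    moreover have "inverse (of_real r * \<i>) *\<^sub>C (of_real r * \<i> * cis \<theta>) *\<^sub>C G = cis \<theta> *\<^sub>C G"
      for \<theta> and G :: 'b
      unfolding scaleC_scaleC using that by (intro arg_cong2[where f = scaleC]) (auto simp: field_simps)
    ultimately have "((\<lambda>\<theta>. cis \<theta> *\<^sub>C F' (z0 + of_real r * cis \<theta>)) has_integral 0) {0..2*pi}"
      by (simp add: o_def scaleC.zero_right)
    then show ?thesis by (rule integral_unique)
  qed
  \<comment> \<open>The derivative is shown to vanish only for r > 0, since i r was divided out;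
    hence the exceptional point 0 together with continuity of \<open>\<phi>\<close> there.\<close>
  have const: "\<phi> r = \<phi> 0" if "r > 0" for r
  proof (rule has_derivative_zero_unique_strong_interval[of "{0}" 0 r])
    show "continuous_on {0..r} \<phi>"
      using \<phi>d by (meson has_vector_derivative_continuous continuous_at_imp_continuous_on)
    fix x assume "x \<in> {0..r} - {0}"
    then show "(\<phi> has_derivative (\<lambda>h. 0)) (at x within {0..r})"
      using \<phi>d[of x] \<phi>0[of x] by (auto simp: has_vector_derivative_def intro: has_derivative_at_withinI)
  qed (use that in auto)
  have small: "norm (\<phi> 0) \<le> 2 * pi * e" if "e > 0" for e
  proof -
    have "\<exists>B. \<forall>z. norm z \<ge> B \<longrightarrow> norm (F z) < e"
      using lim that unfolding tendsto_iff eventually_at_infinity dist_norm diff_zero by blast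
    then obtain B where B: "\<And>z. norm z \<ge> B \<Longrightarrow> norm (F z) < e" by blast
    define r where "r = max 1 (B + norm z0)"
    have "norm (\<phi> r) \<le> integral {0..2*pi} (\<lambda>_. e)"
      unfolding \<phi>_def
    proof (rule integral_norm_bound_integral)
      fix x :: real
      have "r - norm z0 \<le> norm (z0 + of_real r * cis x)"
        using norm_diff_ineq[of "of_real r * cis x" z0]
        by (simp add: norm_mult r_def add.commute)
      then have "B \<le> norm (z0 + of_real r * cis x)"
        unfolding r_def by linarith
      then show "norm (F (z0 + of_real r * cis x)) \<le> e"
        using B less_imp_le by blast
    qed (auto intro: integrable_continuous_real c1)
    then show ?thesis using const[of r] by (simp add: r_def)
  qed
  have "\<phi> 0 = 0"
  proof (rule ccontr)
    assume "\<phi> 0 \<noteq> 0"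
    \<comment> \<open>For this value of e the bound makes the norm at most half of itself.\<close>
    then show False using small[of "norm (\<phi> 0) / (4 * pi)"]
      by (simp add: zero_less_divide_iff)
  qed
  then show ?thesis by (simp add: \<phi>_def)
qed

section \<open>Path integrals as integrals over polygons\<close>

lemma has_integral_localized_vector_derivative_scaleC:
  "((\<lambda>x. vector_derivative \<gamma> (at x within {a..b}) *\<^sub>C F x) has_integral i) {a..b} \<longleftrightarrow>
   ((\<lambda>x. vector_derivative \<gamma> (at x) *\<^sub>C F x) has_integral i) {a..b}"
proof -
  have "{a..b} - {a, b} = {a<..<b}" by auto
  then show ?thesis
    by (intro has_integral_spike_eq[of "{a, b}"])
       (auto simp: at_within_interior[of _ "{a..b}"])
qed

text \<open>A valid path of the library need not be rectifiable, so integrals along it cannot be estimated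
  directly. Local primitives turn them into integrals over segments.\<close>

definition poly_int :: "(complex \<times> complex) list \<Rightarrow> (complex \<Rightarrow> 'b::complex_banach) \<Rightarrow> 'b" where
  "poly_int L F = (\<Sum>(a, b)\<leftarrow>L. integral {0..1} (\<lambda>s. (b - a) *\<^sub>C F (linepath a b s)))"

definition segs_in :: "(complex \<times> complex) list \<Rightarrow> complex set \<Rightarrow> bool" where
  "segs_in L S \<longleftrightarrow> (\<forall>(a, b)\<in>set L. closed_segment a b \<subseteq> S)"

lemma segs_in_simps [simp]:
  "segs_in [] S" "segs_in (ab # L) S \<longleftrightarrow> closed_segment (fst ab) (snd ab) \<subseteq> S \<and> segs_in L S"
  "segs_in (L @ L') S \<longleftrightarrow> segs_in L S \<and> segs_in L' S"
  by (auto simp: segs_in_def split_beta)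

lemma poly_int_simps [simp]:
  "poly_int [] F = 0"
  "poly_int (ab # L) F =
     integral {0..1} (\<lambda>s. (snd ab - fst ab) *\<^sub>C F (linepath (fst ab) (snd ab) s)) + poly_int L F"
  "poly_int (L @ L') F = poly_int L F + poly_int L' F"
  by (auto simp: poly_int_def split_beta)

lemma integral_primitive_segment:
  fixes F :: "complex \<Rightarrow> 'b::complex_banach"
  assumes "\<And>z. z \<in> closed_segment a b \<Longrightarrow> (G has_derivative (\<lambda>h. h *\<^sub>C F z)) (at z)"
  shows "integral {0..1} (\<lambda>s. (b - a) *\<^sub>C F (linepath a b s)) = G b - G a"
proof -
  have "((\<lambda>s. (b - a) *\<^sub>C F (linepath a b s)) has_integral
      G (linepath a b 1) - G (linepath a b 0)) {0..1}"
  proof (rule fundamental_theorem_of_calculus)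
    fix x :: real assume x: "x \<in> {0..1}"
    then have "linepath a b x \<in> closed_segment a b"
      using linepath_in_path by auto
    from has_derivative_compose_scaleC[OF assms[OF this]
        has_vector_derivative_linepath_within[of a b x "{0..1}", unfolded has_vector_derivative_def]]
    show "((\<lambda>s. G (linepath a b s)) has_vector_derivative (b - a) *\<^sub>C F (linepath a b x))
        (at x within {0..1})"
      by (simp add: has_vector_derivative_def scaleR_scaleC scaleC_scaleC scaleR_conv_of_real)
  qed auto
  then show ?thesis
    by (simp add: linepath_0' linepath_1' integral_unique)
qed

text \<open>The integrand may be unbounded near the finitely many exceptional points of a valid
  path, so even the existence of the integral comes from the fundamental theorem:
  \<open>G (\<gamma> s)\<close> is continuous throughout and differentiable off a finite
  set.\<close>

lemma has_integral_path_primitive: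
  fixes F :: "complex \<Rightarrow> 'b::complex_banach"
  assumes "\<And>z. z \<in> B \<Longrightarrow> (G has_derivative (\<lambda>h. h *\<^sub>C F z)) (at z)"
    and "valid_path \<gamma>" "0 \<le> a" "a \<le> b" "b \<le> 1" and im: "\<gamma> ` {a..b} \<subseteq> B"
  shows "((\<lambda>s. vector_derivative \<gamma> (at s) *\<^sub>C F (\<gamma> s)) has_integral G (\<gamma> b) - G (\<gamma> a)) {a..b}"
proof -
  obtain K where K: "finite K" "\<gamma> C1_differentiable_on {0..1} - K" and c\<gamma>: "continuous_on {0..1} \<gamma>"
    using assms(2) unfolding valid_path_def piecewise_C1_differentiable_on_def by blast
  have sub: "{a..b} \<subseteq> {0..1}" using assms by auto
  show ?thesis
  proof (rule fundamental_theorem_of_calculus_interior_strong[OF K(1) \<open>a \<le> b\<close>])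
    have "continuous_on B G"
      using assms(1) by (meson continuous_at_imp_continuous_on has_derivative_continuous)
    from continuous_on_compose2[OF this continuous_on_subset[OF c\<gamma> sub] im]
    show "continuous_on {a..b} (\<lambda>s. G (\<gamma> s))" .
    fix x assume x: "x \<in> {a<..<b} - K"
    then have "\<gamma> differentiable (at x)"
      using C1_diff_imp_diff[OF K(2)] sub K(2) unfolding C1_differentiable_on_eq by auto
    then have d: "(\<gamma> has_derivative (\<lambda>h. h *\<^sub>R vector_derivative \<gamma> (at x))) (at x)"
      using vector_derivative_works has_vector_derivative_def by blast
    have "\<gamma> x \<in> B" using x im by auto
    from has_derivative_compose_scaleC[OF assms(1)[OF this] d]
    show "((\<lambda>s. G (\<gamma> s)) has_vector_derivative vector_derivative \<gamma> (at x) *\<^sub>C F (\<gamma> x)) (at x)"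
      by (simp add: has_vector_derivative_def scaleR_scaleC scaleC_scaleC scaleR_conv_of_real)
  qed
qed

text \<open>A short piece of the path and its chord lie in one ball inside \<open>S\<close>, on
  which \<open>F\<close> has a primitive; both integrals equal the same increment of it. The list
  \<open>L\<close> is quantified before \<open>F\<close>, because one polygon must serve a function,
  its images under linear maps and its products with kernels alike.\<close>

lemma integral_path_eq_poly_int:
  assumes S: "open S" and \<gamma>: "valid_path \<gamma>" "path_image \<gamma> \<subseteq> S"
  shows "\<exists>L. segs_in L S \<and> (\<forall>F::complex \<Rightarrow> 'b::complex_banach. C1_holo F S \<longrightarrow>
    integral {0..1} (\<lambda>s. vector_derivative \<gamma> (at s within {0..1}) *\<^sub>C F (\<gamma> s)) = poly_int L F)"
proof -
  have "path \<gamma>" using \<gamma> valid_path_imp_path by blast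
  \<comment> \<open>Heine-Borel for the cover by the single set \<open>S\<close> yields one radius
    for all points of the path.\<close>
  obtain d where d: "d > 0" "\<And>x. x \<in> path_image \<gamma> \<Longrightarrow> ball x d \<subseteq> S"
    using Heine_Borel_lemma[OF compact_path_image[OF \<open>path \<gamma>\<close>], of "{S}"] S \<gamma> by auto
  have "uniformly_continuous_on {0..1} \<gamma>"
    using \<open>path \<gamma>\<close> by (simp add: compact_uniformly_continuous path_def)
  then obtain e where e: "e > 0"
    "\<And>s t. s \<in> {0..1} \<Longrightarrow> t \<in> {0..1} \<Longrightarrow> dist t s < e \<Longrightarrow> dist (\<gamma> t) (\<gamma> s) < d"
    unfolding uniformly_continuous_on_def using d(1) by metis
  obtain N where N: "N > 0" "1 / real N < e"
    using e(1) by (metis nat_approx_posE of_nat_0_less_iff zero_less_Suc)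
  define q where "q i = real i / real N" for i
  define L where "L k = map (\<lambda>i. (\<gamma> (q i), \<gamma> (q (Suc i)))) [0..<k]" for k
  have q: "q i \<in> {0..1}" if "i \<le> N" for i using that N by (auto simp: q_def)
  have qq: "q i \<le> q (Suc i)" "q (Suc i) - q i = 1 / real N" for i
    using N by (auto simp: q_def field_simps)
  have ball: "\<gamma> ` {q i..q (Suc i)} \<subseteq> ball (\<gamma> (q i)) d" if "i < N" for i
  proof
    fix w assume "w \<in> \<gamma> ` {q i..q (Suc i)}"
    then obtain s where s: "w = \<gamma> s" "s \<in> {q i..q (Suc i)}" by auto
    have "q (Suc i) \<in> {0..1}" "q i \<in> {0..1}" using q that by auto
    with s qq[of i] N show "w \<in> ball (\<gamma> (q i)) d"
      by (auto intro!: e(2) simp: dist_real_def)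
  qed
  have ballS: "ball (\<gamma> (q i)) d \<subseteq> S" if "i < N" for i
    using d(2) q[of i] that by (auto simp: path_image_def)
  have seg: "closed_segment (\<gamma> (q i)) (\<gamma> (q (Suc i))) \<subseteq> ball (\<gamma> (q i)) d" if "i < N" for i
    using ball[OF that] qq(1)[of i] d(1)
    by (intro closed_segment_subset) (auto dest: subsetD[OF _ imageI])
  have main: "((\<lambda>s. vector_derivative \<gamma> (at s) *\<^sub>C F (\<gamma> s)) has_integral poly_int (L k) F) {0..q k}"
    if FS: "C1_holo F S" and "k \<le> N" for F :: "complex \<Rightarrow> 'b" and k
    using that(2)
  proof (induction k)
    case 0
    then show ?case by (simp add: L_def q_def has_integral_refl(2) flip: interval_cbox)
  next
    case (Suc k)
    then have k: "k < N" by simp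
    obtain G where G: "\<And>z. z \<in> ball (\<gamma> (q k)) d \<Longrightarrow> (G has_derivative (\<lambda>h. h *\<^sub>C F z)) (at z)"
      using C1_holo_primitive[OF C1_holo_subset[OF FS ballS[OF k]]] by blast
    have "poly_int (L (Suc k)) F = poly_int (L k) F + (G (\<gamma> (q (Suc k))) - G (\<gamma> (q k)))"
      using integral_primitive_segment[of "\<gamma> (q k)" "\<gamma> (q (Suc k))" G F, OF G] seg[OF k]
      by (simp add: L_def subset_eq)
    moreover have "((\<lambda>s. vector_derivative \<gamma> (at s) *\<^sub>C F (\<gamma> s)) has_integral
        G (\<gamma> (q (Suc k))) - G (\<gamma> (q k))) {q k..q (Suc k)}"
      using q[of k] q[of "Suc k"] k qq[of k]
      by (intro has_integral_path_primitive[OF G \<gamma>(1) _ _ _ ball[OF k]]) auto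
    moreover have "((\<lambda>s. vector_derivative \<gamma> (at s) *\<^sub>C F (\<gamma> s)) has_integral poly_int (L k) F) {0..q k}"
      using Suc k by auto
    ultimately show ?case
      using has_integral_combine[of 0 "q k" "q (Suc k)"] q[of k] qq[of k] k by auto
  qed
  have "segs_in (L N) S"
    unfolding segs_in_def L_def using seg ballS by fastforce
  moreover have "q N = 1" using N by (simp add: q_def)
  ultimately show ?thesis
    using main[of _ N]
    by (intro exI[of _ "L N"])
      (auto simp: has_integral_localized_vector_derivative_scaleC[symmetric] intro!: integral_unique)
qed

lemma cycle_integral_eq_poly_int:
  assumes S: "open S" and "\<forall>\<gamma>\<in>set \<Gamma>. valid_path \<gamma> \<and> path_image \<gamma> \<subseteq> S"
  shows "\<exists>L. segs_in L S \<and> (\<forall>F::complex \<Rightarrow> 'b::complex_banach. C1_holo F S \<longrightarrow>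
    cycle_integral \<Gamma> F = poly_int L F)"
  using assms(2)
proof (induction \<Gamma>)
  case Nil
  then show ?case by (intro exI[of _ "[]"]) (simp add: cycle_integral_def)
next
  case (Cons \<gamma> \<Gamma>)
  obtain L where L: "segs_in L S" "\<And>F::complex \<Rightarrow> 'b. C1_holo F S \<Longrightarrow> cycle_integral \<Gamma> F = poly_int L F"
    using Cons by auto
  obtain M where M: "segs_in M S" "\<And>F::complex \<Rightarrow> 'b. C1_holo F S \<Longrightarrow>
      integral {0..1} (\<lambda>s. vector_derivative \<gamma> (at s within {0..1}) *\<^sub>C F (\<gamma> s)) = poly_int M F"
    using integral_path_eq_poly_int[OF S, of \<gamma>, where 'b = 'b] Cons.prems by auto
  show ?case
    by (rule exI[of _ "M @ L"]) (use L M in \<open>simp add: cycle_integral_def\<close>)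
qed

section \<open>Linearity, bounds and parameters for polygonal integrals\<close>

lemma continuous_on_segment_integrand:
  assumes "continuous_on S F" "closed_segment a b \<subseteq> S"
  shows "continuous_on {0..1} (\<lambda>s. (b - a) *\<^sub>C F (linepath a b s))"
proof -
  have "linepath a b ` {0..1} \<subseteq> S"
    using assms(2) linepath_in_path by blast
  then show ?thesis
    by (intro continuous_intros continuous_on_compose2[OF assms(1)]) auto
qed

lemma poly_int_linear:
  fixes F :: "complex \<Rightarrow> 'b::complex_banach" and T :: "'b \<Rightarrow> 'c::complex_banach"
  assumes "segs_in L S" "continuous_on S F" and T: "bounded_linear T" "\<And>c x. T (c *\<^sub>C x) = c *\<^sub>C T x"
  shows "poly_int L (\<lambda>z. T (F z)) = T (poly_int L F)"
  using assms(1)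
proof (induction L)
  case Nil
  then show ?case using T by (simp add: linear_simps)
next
  case (Cons ab L)
  have "integral {0..1} (T \<circ> (\<lambda>s. (snd ab - fst ab) *\<^sub>C F (linepath (fst ab) (snd ab) s)))
      = T (integral {0..1} (\<lambda>s. (snd ab - fst ab) *\<^sub>C F (linepath (fst ab) (snd ab) s)))"
    using Cons.prems
    by (intro integral_linear[OF _ T(1)] integrable_continuous_real
        continuous_on_segment_integrand[OF assms(2)]) auto
  then show ?case using Cons T by (simp add: linear_simps o_def)
qed

lemma poly_int_add:
  assumes "segs_in L S" "continuous_on S F" "continuous_on S G"
  shows "poly_int L (\<lambda>z. F z + G z) = poly_int L F + poly_int L G"
  using assms(1)
proof (induction L)
  case (Cons ab L)
  then show ?case
    by (simp add: scaleC_add_right algebra_simps)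
      (intro integral_add integrable_continuous_real continuous_on_segment_integrand[OF assms(2)]
        continuous_on_segment_integrand[OF assms(3)]; simp)
qed auto

lemma poly_int_diff:
  assumes "segs_in L S" "continuous_on S F" "continuous_on S G"
  shows "poly_int L (\<lambda>z. F z - G z) = poly_int L F - poly_int L G"
proof -
  have "poly_int L (\<lambda>z. F z - G z) + poly_int L G = poly_int L F"
    using poly_int_add[OF assms(1) continuous_on_diff[OF assms(2,3)] assms(3)] by simp
  then show ?thesis by (simp add: algebra_simps)
qed

lemma poly_int_cong:
  assumes "segs_in L S" "\<And>z. z \<in> S \<Longrightarrow> F z = G z"
  shows "poly_int L F = poly_int L G"
  using assms(1)
proof (induction L)
  case (Cons ab L)
  then have "F (linepath (fst ab) (snd ab) s) = G (linepath (fst ab) (snd ab) s)"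
    if "s \<in> {0..1}" for s
    using linepath_in_path[OF that, of "fst ab" "snd ab"] by (intro assms(2)) auto
  then have "integral {0..1} (\<lambda>s. (snd ab - fst ab) *\<^sub>C F (linepath (fst ab) (snd ab) s)) =
     integral {0..1} (\<lambda>s. (snd ab - fst ab) *\<^sub>C G (linepath (fst ab) (snd ab) s))"
    by (intro integral_cong) simp
  with Cons show ?case by simp
qed simp

lemma norm_poly_int_le:
  assumes "segs_in L S" "continuous_on S F" "\<And>z. z \<in> S \<Longrightarrow> norm (F z) \<le> B"
  shows "norm (poly_int L F) \<le> (\<Sum>(a, b)\<leftarrow>L. norm (b - a)) * B"
  using assms(1)
proof (induction L)
  case (Cons ab L)
  let ?f = "\<lambda>s. (snd ab - fst ab) *\<^sub>C F (linepath (fst ab) (snd ab) s)"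
  have "norm (integral {0..1} ?f) \<le> integral {0..1} (\<lambda>s::real. norm (snd ab - fst ab) * B)"
  proof (rule integral_norm_bound_integral)
    show "?f integrable_on {0..1}" using Cons.prems
      by (intro integrable_continuous_real continuous_on_segment_integrand[OF assms(2)]) auto
    fix x :: real assume "x \<in> {0..1}"
    then have "linepath (fst ab) (snd ab) x \<in> S"
      using Cons.prems linepath_in_path by auto
    then show "norm (?f x) \<le> norm (snd ab - fst ab) * B"
      by (auto simp: norm_scaleC intro!: mult_left_mono assms(3))
  qed auto
  moreover have "norm (poly_int L F) \<le> (\<Sum>ab\<leftarrow>L. norm (snd ab - fst ab)) * B"
    using Cons by (simp add: split_beta)
  ultimately show ?case
    using norm_triangle_ineq[of "integral {0..1} ?f" "poly_int L F"]
    by (simp add: split_beta distrib_right del: norm_triangle_ineq)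
qed auto

lemma poly_int_continuous_param:
  fixes F :: "complex \<Rightarrow> 'b::complex_banach"
  assumes "segs_in L S" and k: "continuous_on (U \<times> S) (\<lambda>(z, w). k z w)" and F: "continuous_on S F"
  shows "continuous_on U (\<lambda>z. poly_int L (\<lambda>w. k z w *\<^sub>C F w))"
  using assms(1)
proof (induction L)
  case (Cons ab L)
  let ?l = "linepath (fst ab) (snd ab)"
  have lS: "?l ` {0..1} \<subseteq> S"
    using Cons.prems linepath_in_path[of _ "fst ab" "snd ab"] by (auto simp del: atLeastAtMost_iff)
  have "continuous_on (U \<times> cbox 0 1) (\<lambda>(z, s). (snd ab - fst ab) *\<^sub>C k z (?l s) *\<^sub>C F (?l s))"
  proof -
    have l: "continuous_on (U \<times> {0..1}) (\<lambda>x. ?l (snd x))"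
      by (intro continuous_on_compose2[OF continuous_on_linepath[of UNIV]] continuous_intros) auto
    have "continuous_on (U \<times> {0..1}) (\<lambda>x. (fst x, ?l (snd x)))"
      by (intro continuous_intros l)
    moreover have "(\<lambda>x. (fst x, ?l (snd x))) ` (U \<times> {0..1}) \<subseteq> U \<times> S" using lS by auto
    ultimately have "continuous_on (U \<times> {0..1}) (\<lambda>x. k (fst x) (?l (snd x)))"
      using continuous_on_compose2[OF k] by fastforce
    moreover have "continuous_on (U \<times> {0..1}) (\<lambda>x. F (?l (snd x)))"
      using lS by (intro continuous_on_compose2[OF F l]) auto
    ultimately show ?thesis unfolding split_beta by (auto intro!: continuous_intros)
  qed
  from integral_continuous_on_param[OF this] Cons show ?case
    by (auto intro!: continuous_intros)
qed auto

text \<open>A scalar kernel \<open>k\<close> is left general because two are needed: 1 / (w - z),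
  differentiated in the pole, and exp (w z), differentiated in a complexified time.\<close>

lemma poly_int_leibniz:
  fixes F :: "complex \<Rightarrow> 'b::complex_banach"
  assumes "segs_in L S" and F: "continuous_on S F"
    and k: "\<And>z. z \<in> U \<Longrightarrow> continuous_on S (k z)"
    and k': "continuous_on (U \<times> S) (\<lambda>(z, w). k' z w)"
    and d: "\<And>z w. z \<in> U \<Longrightarrow> w \<in> S \<Longrightarrow> ((\<lambda>z. k z w) has_field_derivative k' z w) (at z)"
    and U: "open U" "z \<in> U"
  shows "((\<lambda>z. poly_int L (\<lambda>w. k z w *\<^sub>C F w)) has_derivative
      (\<lambda>h. h *\<^sub>C poly_int L (\<lambda>w. k' z w *\<^sub>C F w))) (at z)"
  using assms(1)
proof (induction L)
  case Nil
  then show ?case by (simp add: scaleC.zero_right)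
next
  case (Cons ab L)
  let ?l = "linepath (fst ab) (snd ab)" and ?c = "snd ab - fst ab"
  have lS: "?l ` {0..1} \<subseteq> S"
    using Cons.prems linepath_in_path[of _ "fst ab" "snd ab"] by (auto simp del: atLeastAtMost_iff)
  \<comment> \<open>\<open>leibniz_scaleC\<close> asks for a convex parameter set, hence a
    ball.\<close>
  obtain r where r: "r > 0" "ball z r \<subseteq> U" using U openE by blast
  have "((\<lambda>z. integral {0..1} (\<lambda>s. ?c *\<^sub>C k z (?l s) *\<^sub>C F (?l s))) has_derivative
      (\<lambda>h. h *\<^sub>C integral {0..1} (\<lambda>s. ?c *\<^sub>C k' z (?l s) *\<^sub>C F (?l s)))) (at z within ball z r)"
  proof (rule leibniz_scaleC)
    fix x and t :: real assume x: "x \<in> ball z r" "t \<in> {0..1}"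
    then have "?l t \<in> S" "x \<in> U" using r lS by auto
    then have "((\<lambda>z. k z (?l t)) has_derivative (\<lambda>h. k' x (?l t) * h)) (at x within ball z r)"
      using d[of x "?l t"] by (auto simp: has_field_derivative_def intro: has_derivative_at_withinI)
    then have "((\<lambda>x. ?c *\<^sub>C k x (?l t) *\<^sub>C F (?l t)) has_derivative
        (\<lambda>h. ?c *\<^sub>C (k' x (?l t) * h) *\<^sub>C F (?l t))) (at x within ball z r)"
      by (intro bounded_linear.has_derivative[OF scaleC.bounded_linear_right]
          bounded_linear.has_derivative[OF scaleC.bounded_linear_left])
    then show "((\<lambda>x. ?c *\<^sub>C k x (?l t) *\<^sub>C F (?l t)) has_derivative
        (\<lambda>h. h *\<^sub>C ?c *\<^sub>C k' x (?l t) *\<^sub>C F (?l t))) (at x within ball z r)"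
      by (simp add: scaleC_scaleC mult_ac)
  next
    fix x assume "x \<in> ball z r"
    then have "continuous_on S (k x)" using k r by auto
    then show "continuous_on {0..1} (\<lambda>s. ?c *\<^sub>C k x (?l s) *\<^sub>C F (?l s))"
      using continuous_on_compose2[OF F _ lS] continuous_on_compose2[of S "k x" "{0..1}" ?l, OF _ _ lS]
      by (intro scaleC.continuous_on continuous_on_const) auto
  next
    have l: "continuous_on (ball z r \<times> {0..1}) (\<lambda>x. ?l (snd x))"
      by (intro continuous_on_compose2[OF continuous_on_linepath[of UNIV]] continuous_intros) auto
    have "continuous_on (ball z r \<times> {0..1}) (\<lambda>x. (fst x, ?l (snd x)))"
      by (intro continuous_intros l)
    moreover have "(\<lambda>x. (fst x, ?l (snd x))) ` (ball z r \<times> {0..1}) \<subseteq> U \<times> S" using lS r by auto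
    ultimately have "continuous_on (ball z r \<times> {0..1}) (\<lambda>x. k' (fst x) (?l (snd x)))"
      using continuous_on_compose2[OF k'] by fastforce
    moreover have "continuous_on (ball z r \<times> {0..1}) (\<lambda>x. F (?l (snd x)))"
      using lS by (intro continuous_on_compose2[OF F l]) auto
    ultimately show "continuous_on (ball z r \<times> {0..1}) (\<lambda>(x, s). ?c *\<^sub>C k' x (?l s) *\<^sub>C F (?l s))"
      unfolding split_beta by (auto intro!: continuous_intros)
  qed (use r in auto)
  then have "((\<lambda>z. integral {0..1} (\<lambda>s. ?c *\<^sub>C k z (?l s) *\<^sub>C F (?l s))) has_derivative
      (\<lambda>h. h *\<^sub>C integral {0..1} (\<lambda>s. ?c *\<^sub>C k' z (?l s) *\<^sub>C F (?l s)))) (at z)"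
    using r at_within_open[of z "ball z r"] by auto
  from has_derivative_add[OF this Cons.IH] Cons.prems show ?case
    by (simp add: scaleC_add_right)
qed

lemma C1_holo_cauchy_transform:
  fixes F :: "complex \<Rightarrow> 'b::complex_banach"
  assumes "segs_in L S" "continuous_on S F" "open N" "N \<inter> S = {}"
  shows "C1_holo (\<lambda>z. poly_int L (\<lambda>w. (1 / (w - z)) *\<^sub>C F w)) N"
  unfolding C1_holo_def
proof (intro exI conjI ballI)
  have ne: "w \<noteq> z" if "z \<in> N" "w \<in> S" for w z using that assms(4) by auto
  have c: "continuous_on (N \<times> S) (\<lambda>(z, w). 1 / (w - z)^2)"
    unfolding split_beta using ne by (auto intro!: continuous_intros)
  show "((\<lambda>z. poly_int L (\<lambda>w. (1 / (w - z)) *\<^sub>C F w)) has_derivative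
      (\<lambda>h. h *\<^sub>C poly_int L (\<lambda>w. (1 / (w - z)^2) *\<^sub>C F w))) (at z)" if "z \<in> N" for z
  proof (rule poly_int_leibniz[where k = "\<lambda>z w. 1 / (w - z)", OF assms(1,2) _ c _ assms(3) that])
    fix z w assume zw: "z \<in> N" "w \<in> S"
    show "((\<lambda>z. 1 / (w - z)) has_field_derivative 1 / (w - z)\<^sup>2) (at z)"
      by (rule derivative_eq_intros refl)+ (use ne[OF zw] in \<open>auto simp: power2_eq_square\<close>)
  qed (use ne in \<open>auto intro!: continuous_intros\<close>)
  show "continuous_on N (\<lambda>z. poly_int L (\<lambda>w. (1 / (w - z)^2) *\<^sub>C F w))"
    by (rule poly_int_continuous_param[where k = "\<lambda>z w. 1 / (w - z)^2", OF assms(1) c assms(2)])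
qed

text \<open>Scalar contour theorems reach vector-valued cycle integrals through integrands that are
  a scalar function times a fixed vector.\<close>

lemma cycle_integral_scalar:
  fixes P :: "'b::complex_banach"
  assumes "\<And>\<gamma>. \<gamma> \<in> set \<Gamma> \<Longrightarrow> (c has_contour_integral i \<gamma>) \<gamma>"
  shows "cycle_integral \<Gamma> (\<lambda>w. c w *\<^sub>C P) = (\<Sum>\<gamma>\<leftarrow>\<Gamma>. i \<gamma>) *\<^sub>C P"
  using assms
proof (induction \<Gamma>)
  case Nil
  then show ?case by (simp add: cycle_integral_def scaleC_zero_left)
next
  case (Cons \<gamma> \<Gamma>)
  have "(c has_contour_integral i \<gamma>) \<gamma>" using Cons by auto
  then have "((\<lambda>s. c (\<gamma> s) * vector_derivative \<gamma> (at s within {0..1})) has_integral i \<gamma>) {0..1}"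
    by (simp add: has_contour_integral_def)
  from has_integral_linear[OF this scaleC.bounded_linear_left[of P]]
  have "integral {0..1} (\<lambda>s. vector_derivative \<gamma> (at s within {0..1}) *\<^sub>C c (\<gamma> s) *\<^sub>C P) = i \<gamma> *\<^sub>C P"
    by (intro integral_unique) (simp add: o_def scaleC_scaleC mult.commute)
  with Cons show ?case by (simp add: cycle_integral_def scaleC_add_left)
qed

section \<open>Resolvents in corner algebras\<close>

interpretation blinfun_comp: bounded_bilinear
  "(o\<^sub>L) :: ('b::real_normed_vector \<Rightarrow>\<^sub>L 'c::real_normed_vector) \<Rightarrow> ('a::real_normed_vector \<Rightarrow>\<^sub>L 'b) \<Rightarrow> _"
  by (rule bounded_bilinear_blinfun_compose)

lemma blinfun_comp_assoc: "(S o\<^sub>L T) o\<^sub>L U = S o\<^sub>L (T o\<^sub>L U)"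
  by (rule blinfun_eqI) simp

text \<open>The operator type contains all bounded real-linear maps. A complex scalar on the left
  factor of a composition comes out freely, but one on the right factor must pass through the left
  factor, which requires that factor to be complex-linear.\<close>

definition clin :: "('a::complex_normed_vector \<Rightarrow>\<^sub>L 'b::complex_normed_vector) \<Rightarrow> bool" where
  "clin T \<longleftrightarrow> (\<forall>z x. T (z *\<^sub>C x) = z *\<^sub>C T x)"

lemma scaleC_comp_left [simp]: "(z *\<^sub>C S) o\<^sub>L T = z *\<^sub>C (S o\<^sub>L T)"
  by (rule blinfun_eqI) (simp add: scaleC_blinfun.rep_eq)

lemma scaleC_comp_right: "clin S \<Longrightarrow> S o\<^sub>L (z *\<^sub>C T) = z *\<^sub>C (S o\<^sub>L T)"
  by (rule blinfun_eqI) (simp add: scaleC_blinfun.rep_eq clin_def)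

lemma clin_comp: "clin S \<Longrightarrow> clin T \<Longrightarrow> clin (S o\<^sub>L T)"
  by (simp add: clin_def)

lemma clin_scaleC: "clin S \<Longrightarrow> clin (z *\<^sub>C S)"
  by (simp add: clin_def scaleC_blinfun.rep_eq scaleC_scaleC mult.commute)

lemma clin_add: "clin S \<Longrightarrow> clin T \<Longrightarrow> clin (S + T)"
  by (simp add: clin_def blinfun.bilinear_simps scaleC_add_right)

lemma clin_diff: "clin S \<Longrightarrow> clin T \<Longrightarrow> clin (S - T)"
  by (simp add: clin_def blinfun.bilinear_simps scaleC.diff_right)

lemma clin_0: "clin 0"
  by (simp add: clin_def scaleC.zero_right)

lemma closed_clin: "closed {T. clin T}"
proof -
  have "{T. clin T} = (\<Inter>z x. {T. blinfun_apply T (z *\<^sub>C x) = z *\<^sub>C T x})"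
    by (auto simp: clin_def)
  also have "closed \<dots>"
    by (intro closed_INT ballI closed_Collect_eq continuous_intros)
  finally show ?thesis .
qed

lemma bounded_linear_comp_left: "bounded_linear (\<lambda>S. S o\<^sub>L T)"
  and bounded_linear_comp_right: "bounded_linear (\<lambda>S. T o\<^sub>L S)"
  by (rule blinfun_comp.bounded_linear_left blinfun_comp.bounded_linear_right)+

text \<open>The unit \<open>P\<close> is part of the data. The instances are the operators of one
  block with the coordinate projection as unit, and all complex-linear operators and the triangular
  ones with the identity. The norm of \<open>P\<close> may exceed 1, which is why it appears in the
  bounds below.\<close>

locale corner_algebra =
  fixes V :: "('a::complex_banach \<Rightarrow>\<^sub>L 'a) set" and P :: "'a \<Rightarrow>\<^sub>L 'a"
  assumes closed: "closed V" and P: "P \<in> V"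
    and add: "S \<in> V \<Longrightarrow> T \<in> V \<Longrightarrow> S + T \<in> V"
    and scale: "T \<in> V \<Longrightarrow> z *\<^sub>C T \<in> V"
    and comp: "S \<in> V \<Longrightarrow> T \<in> V \<Longrightarrow> S o\<^sub>L T \<in> V"
    and P_left: "T \<in> V \<Longrightarrow> P o\<^sub>L T = T"
    and P_right: "T \<in> V \<Longrightarrow> T o\<^sub>L P = T"
    and clin: "T \<in> V \<Longrightarrow> clin T"
begin

definition is_inv :: "('a \<Rightarrow>\<^sub>L 'a) \<Rightarrow> ('a \<Rightarrow>\<^sub>L 'a) \<Rightarrow> bool" where
  "is_inv T R \<longleftrightarrow> R \<in> V \<and> T o\<^sub>L R = P \<and> R o\<^sub>L T = P"

definition spec :: "('a \<Rightarrow>\<^sub>L 'a) \<Rightarrow> complex set" where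
  "spec B = {z. \<not> (\<exists>R. is_inv (z *\<^sub>C P - B) R)}"

definition res :: "('a \<Rightarrow>\<^sub>L 'a) \<Rightarrow> complex \<Rightarrow> 'a \<Rightarrow>\<^sub>L 'a" where
  "res B z = (THE R. is_inv (z *\<^sub>C P - B) R)"

lemma is_inv_unique: "is_inv T R \<Longrightarrow> is_inv T R' \<Longrightarrow> R = R'"
  unfolding is_inv_def by (metis P_left P_right blinfun_comp_assoc)

lemma res_eqI: "is_inv (z *\<^sub>C P - B) R \<Longrightarrow> res B z = R"
  unfolding res_def using is_inv_unique by blast

lemma is_inv_res: "z \<notin> spec B \<Longrightarrow> is_inv (z *\<^sub>C P - B) (res B z)"
  unfolding spec_def using res_eqI by auto

lemma zero: "0 \<in> V"
  using scale[OF P, of 0] by (simp add: scaleC_zero_left)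

lemma diff: "S \<in> V \<Longrightarrow> T \<in> V \<Longrightarrow> S - T \<in> V"
  using add[of S "(-1) *\<^sub>C T"] scale[of T "-1"]
  by (metis diff_conv_add_uminus scaleC.minus_left scaleC_one)

lemma sum: "(\<And>i. i \<in> I \<Longrightarrow> f i \<in> V) \<Longrightarrow> (\<Sum>i\<in>I. f i) \<in> V"
  by (induction I rule: infinite_finite_induct) (auto intro: zero add)

text \<open>The Neumann series with zeroth power \<open>P\<close>: all partial sums lie in the
  closed set \<open>V\<close>, and the geometric majorant starts with the norm of
  \<open>P\<close>.\<close>

lemma neumann:
  assumes T: "T \<in> V" "norm T < 1"
  shows "\<exists>S. is_inv (P - T) S \<and> norm S \<le> norm P / (1 - norm T)"
proof -
  define pw where "pw = rec_nat P (\<lambda>_ X. T o\<^sub>L X)"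
  have pw: "pw 0 = P" "\<And>k. pw (Suc k) = T o\<^sub>L pw k" by (simp_all add: pw_def)
  have pwV: "pw k \<in> V" for k by (induction k) (auto simp: pw P T comp)
  have pwn: "norm (pw k) \<le> norm P * norm T ^ k" for k
  proof (induction k)
    case (Suc k)
    then have "norm T * norm (pw k) \<le> norm T * (norm P * norm T ^ k)"
      by (intro mult_left_mono) auto
    then show ?case using norm_blinfun_compose[of T "pw k"] by (simp add: pw mult_ac)
  qed (simp add: pw)
  have pwc: "pw k o\<^sub>L T = pw (Suc k)" for k
  proof (induction k)
    case 0
    then show ?case by (simp add: pw P_left P_right T)
  next
    case (Suc k)
    then show ?case by (metis pw(2) blinfun_comp_assoc)
  qed
  have gs: "summable (\<lambda>k. norm P * norm T ^ k)" "(\<Sum>k. norm P * norm T ^ k) = norm P / (1 - norm T)"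
    using T by (auto simp: suminf_mult suminf_geometric summable_mult summable_geometric)
  have s: "summable pw"
    by (rule summable_comparison_test'[OF gs(1)]) (use pwn in auto)
  define S where "S = suminf pw"
  have "(\<lambda>n. sum pw {..<n}) \<longlonglongrightarrow> S"
    unfolding S_def by (rule summable_LIMSEQ[OF s])
  then have SV: "S \<in> V"
    by (rule closed_sequentially[OF closed, rotated]) (rule sum[OF pwV])
  have tail: "(\<Sum>k. pw (Suc k)) = S - P"
    using suminf_split_head[OF s] by (simp add: S_def pw)
  have "T o\<^sub>L S = S - P"
    using bounded_linear.suminf[OF bounded_linear_comp_right s, of T] tail by (simp add: S_def pw)
  moreover have "S o\<^sub>L T = S - P"
    using bounded_linear.suminf[OF bounded_linear_comp_left s, of T] tail by (simp add: S_def pwc)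
  moreover have "norm S \<le> (\<Sum>k. norm P * norm T ^ k)"
    unfolding S_def
    by (rule order_trans[OF summable_norm suminf_le])
      (use pwn gs in \<open>auto intro: summable_comparison_test'[OF gs(1)]\<close>)
  ultimately show ?thesis using SV
    by (intro exI[of _ S])
      (auto simp: is_inv_def blinfun_comp.diff_left blinfun_comp.diff_right P_left P_right gs(2))
qed

context
  fixes B :: "'a \<Rightarrow>\<^sub>L 'a"
  assumes B: "B \<in> V"
begin

lemma res_in: "z \<notin> spec B \<Longrightarrow> res B z \<in> V"
  and res_right: "z \<notin> spec B \<Longrightarrow> (z *\<^sub>C P - B) o\<^sub>L res B z = P"
  and res_left: "z \<notin> spec B \<Longrightarrow> res B z o\<^sub>L (z *\<^sub>C P - B) = P"
  using is_inv_res unfolding is_inv_def by auto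

lemma res_mult:
  assumes "z \<notin> spec B"
  shows "z *\<^sub>C res B z = P + (B o\<^sub>L res B z)" "z *\<^sub>C res B z = P + (res B z o\<^sub>L B)"
  using res_right[OF assms] res_left[OF assms] res_in[OF assms]
  by (simp_all add: blinfun_comp.diff_left blinfun_comp.diff_right P_left P_right clin
      scaleC_comp_right algebra_simps)

text \<open>Factor w P - B = (P - T)(z P - B) with T = (z - w) \<open>res B z\<close>. As T has norm
  at most 1/2, P - T has an inverse of norm at most twice that of P. The resolvents near z are thus
  uniformly bounded, which the proof of continuity uses.\<close>

lemma res_perturb:
  assumes z: "z \<notin> spec B" and w: "norm (w - z) * norm (res B z) \<le> 1 / 2"
  shows "w \<notin> spec B" "norm (res B w) \<le> 2 * norm P * norm (res B z)"
proof -
  define T where "T = (z - w) *\<^sub>C res B z"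
  have T: "T \<in> V" "norm T \<le> 1 / 2"
    using w res_in[OF z] by (auto simp: T_def norm_scaleC norm_minus_commute intro: scale)
  obtain S where S: "is_inv (P - T) S" "norm S \<le> norm P / (1 - norm T)"
    using neumann[of T] T by auto
  have "norm P / (1 - norm T) \<le> norm P / (1 / 2)"
    using T by (intro divide_left_mono) auto
  then have nS: "norm S \<le> 2 * norm P" using S by simp
  have eq: "w *\<^sub>C P - B = (P - T) o\<^sub>L (z *\<^sub>C P - B)"
    using res_left[OF z] scale[OF P, of z] diff[OF scale[OF P, of z] B]
    by (simp add: T_def blinfun_comp.diff_left P_left scaleC.diff_left)
  have SV: "S \<in> V" and S1: "(P - T) o\<^sub>L S = P" and S2: "S o\<^sub>L (P - T) = P"
    using S unfolding is_inv_def by auto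
  have "is_inv (w *\<^sub>C P - B) (res B z o\<^sub>L S)"
    unfolding is_inv_def
  proof (intro conjI)
    show "res B z o\<^sub>L S \<in> V" using comp res_in[OF z] SV by auto
    have "(w *\<^sub>C P - B) o\<^sub>L (res B z o\<^sub>L S) = (P - T) o\<^sub>L (((z *\<^sub>C P - B) o\<^sub>L res B z) o\<^sub>L S)"
      unfolding eq by (simp only: blinfun_comp_assoc)
    then show "(w *\<^sub>C P - B) o\<^sub>L (res B z o\<^sub>L S) = P"
      by (simp only: res_right[OF z] P_left[OF SV] S1)
    have "(res B z o\<^sub>L S) o\<^sub>L (w *\<^sub>C P - B) = res B z o\<^sub>L ((S o\<^sub>L (P - T)) o\<^sub>L (z *\<^sub>C P - B))"
      unfolding eq by (simp only: blinfun_comp_assoc)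
    then show "(res B z o\<^sub>L S) o\<^sub>L (w *\<^sub>C P - B) = P"
      by (simp only: S2 P_left[OF diff[OF scale[OF P] B]] res_left[OF z])
  qed
  moreover have "norm (res B z o\<^sub>L S) \<le> norm (res B z) * (2 * norm P)"
    by (rule order_trans[OF norm_blinfun_compose mult_left_mono[OF nS norm_ge_zero]])
  ultimately show "w \<notin> spec B" "norm (res B w) \<le> 2 * norm P * norm (res B z)"
    using res_eqI[of w B] by (auto simp: spec_def mult_ac)
qed

text \<open>Write z P - B = z (P - B / z) and apply the Neumann series. This yields bounded spectra,
  points off the spectrum, and the decay at infinity required by Liouville's theorem.\<close>

lemma res_large:
  assumes "norm z > norm B"
  shows "z \<notin> spec B" "norm (res B z) \<le> norm P / (norm z - norm B)"
proof -
  have z0: "z \<noteq> 0" "norm z > 0" using assms norm_ge_zero[of B] by (auto simp del: norm_ge_zero)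
  define T where "T = inverse z *\<^sub>C B"
  have nT: "norm T = norm B / norm z"
    by (simp add: T_def norm_scaleC norm_inverse divide_inverse mult.commute del: inverse_eq_divide)
  have T: "T \<in> V" "norm T < 1"
    using assms z0 unfolding nT by (auto simp: T_def intro: scale B)
  obtain S where S: "is_inv (P - T) S" "norm S \<le> norm P / (1 - norm T)"
    using neumann T by blast
  have SV: "S \<in> V" and S1: "(P - T) o\<^sub>L S = P" and S2: "S o\<^sub>L (P - T) = P"
    using S unfolding is_inv_def by auto
  have eq: "z *\<^sub>C P - B = z *\<^sub>C (P - T)"
    using z0 by (simp add: T_def scaleC.diff_right scaleC_scaleC scaleC_one)
  have "is_inv (z *\<^sub>C P - B) (inverse z *\<^sub>C S)"
    unfolding is_inv_def eq
    using SV S1 S2 z0 diff[OF P T(1)]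
    by (auto simp: scale clin scaleC_comp_right scaleC_scaleC scaleC_one)
  moreover have "norm (inverse z *\<^sub>C S) \<le> norm P / (norm z - norm B)"
  proof -
    have "norm (inverse z *\<^sub>C S) \<le> inverse (norm z) * (norm P / (1 - norm T))"
      unfolding norm_scaleC norm_inverse by (intro mult_left_mono S) auto
    also have "\<dots> = norm P / (norm z - norm B)"
      using z0 assms by (simp add: nT field_simps)
    finally show ?thesis .
  qed
  ultimately show "z \<notin> spec B" "norm (res B z) \<le> norm P / (norm z - norm B)"
    using res_eqI[of z B] by (auto simp: spec_def)
qed

lemma open_resolvent_set: "open (- spec B)"
proof (rule openI)
  fix z assume z: "z \<in> - spec B"
  \<comment> \<open>The added 1 keeps the radius positive even if the resolvent is 0.\<close>
  have "ball z (1 / (2 * (norm (res B z) + 1))) \<subseteq> - spec B"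
  proof
    fix w assume "w \<in> ball z (1 / (2 * (norm (res B z) + 1)))"
    then have "norm (w - z) * (2 * (norm (res B z) + 1)) < 1"
      by (simp add: dist_norm norm_minus_commute pos_less_divide_eq add_nonneg_pos)
    moreover have "norm (w - z) * (2 * (norm (res B z) + 1)) =
        2 * (norm (w - z) * norm (res B z)) + 2 * norm (w - z)"
      by (simp add: algebra_simps)
    moreover have "0 \<le> norm (w - z)" by simp
    ultimately have "norm (w - z) * norm (res B z) \<le> 1 / 2" by linarith
    then show "w \<in> - spec B" using res_perturb z by auto
  qed
  then show "\<exists>e>0. ball z e \<subseteq> - spec B"
    by (intro exI[of _ "1 / (2 * (norm (res B z) + 1))"]) (auto simp: add_nonneg_pos)
qed

lemma compact_spec: "compact (spec B)"
proof -
  have "spec B \<subseteq> cball 0 (norm B)"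
    using res_large(1) by (force simp: not_le)
  then show ?thesis
    using open_resolvent_set bounded_subset bounded_cball
    by (auto simp: compact_eq_bounded_closed closed_def)
qed

lemma res_identity:
  assumes "z \<notin> spec B" "w \<notin> spec B"
  shows "res B w - res B z = (z - w) *\<^sub>C (res B w o\<^sub>L res B z)"
proof -
  have "(z - w) *\<^sub>C (res B w o\<^sub>L res B z) = res B w o\<^sub>L (((z - w) *\<^sub>C P) o\<^sub>L res B z)"
    using res_in assms by (simp add: P_left scaleC_comp_right clin)
  also have "(z - w) *\<^sub>C P = (z *\<^sub>C P - B) - (w *\<^sub>C P - B)"
    by (simp add: scaleC.diff_left)
  also have "res B w o\<^sub>L (((z *\<^sub>C P - B) - (w *\<^sub>C P - B)) o\<^sub>L res B z) =
      (res B w o\<^sub>L ((z *\<^sub>C P - B) o\<^sub>L res B z)) - ((res B w o\<^sub>L (w *\<^sub>C P - B)) o\<^sub>L res B z)"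
    by (simp only: blinfun_comp.diff_left blinfun_comp.diff_right blinfun_comp_assoc)
  also have "\<dots> = res B w - res B z"
    using assms by (simp add: res_left res_right P_left P_right res_in)
  finally show ?thesis by simp
qed

lemma continuous_on_res: "continuous_on (- spec B) (res B)"
  unfolding continuous_on_eq_continuous_at[OF open_resolvent_set]
proof
  fix z assume z: "z \<in> - spec B"
  let ?C = "2 * norm P * norm (res B z) * norm (res B z)"
  have "\<forall>\<^sub>F w in at z. norm (w - z) * norm (res B z) < 1 / 2"
  proof (rule order_tendstoD)
    show "((\<lambda>w. norm (w - z) * norm (res B z)) \<longlongrightarrow> norm (z - z) * norm (res B z)) (at z)"
      by (intro tendsto_intros)
  qed simp
  then have "\<forall>\<^sub>F w in at z. norm (res B w - res B z) \<le> norm (w - z) * ?C"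
  proof eventually_elim
    case (elim w)
    then have w: "w \<notin> spec B" "norm (res B w) \<le> 2 * norm P * norm (res B z)"
      using res_perturb[of z w] z by auto
    have "norm (res B w o\<^sub>L res B z) \<le> ?C"
      by (rule order_trans[OF norm_blinfun_compose]) (intro mult_right_mono w, simp)
    then show ?case using res_identity[of z w] z w
      by (simp add: norm_scaleC norm_minus_commute mult_left_mono)
  qed
  moreover have "((\<lambda>w. norm (w - z) * ?C) \<longlongrightarrow> norm (z - z) * ?C) (at z)"
    by (intro tendsto_intros)
  ultimately have "((\<lambda>w. res B w - res B z) \<longlongrightarrow> 0) (at z)"
    using Lim_null_comparison by fastforce
  then show "isCont (res B) z"
    by (simp add: isCont_def LIM_zero_iff)
qed

lemma C1_holo_res: "C1_holo (res B) (- spec B)"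
  unfolding C1_holo_def
proof (intro exI[of _ "\<lambda>z. - (res B z o\<^sub>L res B z)"] conjI ballI)
  fix z assume z: "z \<in> - spec B"
  let ?D = "\<lambda>h. h *\<^sub>C (- (res B z o\<^sub>L res B z))"
  have "((\<lambda>w. norm ((res B z - res B w) o\<^sub>L res B z)) \<longlongrightarrow> norm ((res B z - res B z) o\<^sub>L res B z)) (at z)"
    using continuous_on_res z open_resolvent_set
    by (intro tendsto_intros blinfun_comp.tendsto) (auto simp: continuous_on_eq_continuous_at isCont_def)
  then have lim: "((\<lambda>w. norm ((res B z - res B w) o\<^sub>L res B z)) \<longlongrightarrow> 0) (at z)"
    by (simp add: blinfun_comp.zero_left)
  have "\<forall>\<^sub>F w in at z. norm (((res B w - res B z) - ?D (w - z)) /\<^sub>R norm (w - z)) \<le>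
      norm ((res B z - res B w) o\<^sub>L res B z)"
  proof -
    have "\<forall>\<^sub>F w in at z. w \<in> - spec B"
      using open_resolvent_set z by (metis eventually_at_topological)
    moreover have "\<forall>\<^sub>F w in at z. w \<noteq> z" by (simp add: eventually_at_filter)
    ultimately show ?thesis
    proof eventually_elim
      case (elim w)
      \<comment> \<open>By the resolvent identity the error of the linear approximation is w - z
        times a product whose first factor tends to 0 by continuity.\<close>
      have "(res B w - res B z) - ?D (w - z) = (w - z) *\<^sub>C ((res B z - res B w) o\<^sub>L res B z)"
        using res_identity[of z w] z elim
        by (simp add: blinfun_comp.diff_left scaleC.diff_right scaleC.minus_right scaleC.diff_left)
      then show ?case using elim by (simp add: norm_scaleC mult.assoc[symmetric])
    qed
  qed
  then have "((\<lambda>w. ((res B w - res B z) - ?D (w - z)) /\<^sub>R norm (w - z)) \<longlongrightarrow> 0) (at z)"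
    using lim by (rule Lim_null_comparison)
  then show "(res B has_derivative ?D) (at z)"
    unfolding has_derivative_at_within
    by (auto simp: scaleC.bounded_linear_left diff_diff_eq[symmetric] scaleR_conv_of_real
        intro: tendsto_eq_rhs)
next
  show "continuous_on (- spec B) (\<lambda>z. - (res B z o\<^sub>L res B z))"
    by (intro continuous_on_minus blinfun_comp.continuous_on continuous_on_res)
qed

lemma res_tendsto_0: "(res B \<longlongrightarrow> 0) at_infinity"
proof (rule Lim_null_comparison)
  show "\<forall>\<^sub>F z in at_infinity. norm (res B z) \<le> norm P / (norm z - norm B)"
    unfolding eventually_at_infinity
    by (rule exI[of _ "norm B + 1"]) (auto intro!: res_large(2))
  have "filterlim (\<lambda>z::complex. - norm B + norm z) at_top at_infinity"
    by (rule filterlim_tendsto_add_at_top[OF tendsto_const filterlim_norm_at_top])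
  then show "((\<lambda>z::complex. norm P / (norm z - norm B)) \<longlongrightarrow> 0) at_infinity"
    by (intro real_tendsto_divide_at_top[OF tendsto_const]) (simp add: add.commute)
qed

end

end

section \<open>Cauchy integrals of chains of resolvents\<close>

text \<open>On the overlap the two derivatives agree by uniqueness, so the derivative chosen by
  cases is continuous on both open sets. This is how a function is continued across a
  spectrum.\<close>

lemma C1_holo_glue:
  assumes S: "open S" "C1_holo F S" "\<And>z. z \<in> S \<Longrightarrow> U z = F z"
    and T: "open T" "C1_holo G T" "\<And>z. z \<in> T \<Longrightarrow> U z = G z"
  shows "C1_holo U (S \<union> T)"
proof -
  obtain F' where F: "\<And>z. z \<in> S \<Longrightarrow> (F has_derivative (\<lambda>h. h *\<^sub>C F' z)) (at z)" "continuous_on S F'"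
    using S(2) unfolding C1_holo_def by blast
  obtain G' where G: "\<And>z. z \<in> T \<Longrightarrow> (G has_derivative (\<lambda>h. h *\<^sub>C G' z)) (at z)" "continuous_on T G'"
    using T(2) unfolding C1_holo_def by blast
  have UF: "(U has_derivative (\<lambda>h. h *\<^sub>C F' z)) (at z)" if "z \<in> S" for z
    using has_derivative_transform_within_open[OF F(1)[OF that] S(1) that] S(3) by auto
  have UG: "(U has_derivative (\<lambda>h. h *\<^sub>C G' z)) (at z)" if "z \<in> T" for z
    using has_derivative_transform_within_open[OF G(1)[OF that] T(1) that] T(3) by auto
  define D where "D z = (if z \<in> S then F' z else G' z)" for z
  have DG: "D z = G' z" if "z \<in> T" for z
  proof (cases "z \<in> S")
    case True
    have "(\<lambda>h. h *\<^sub>C F' z) = (\<lambda>h. h *\<^sub>C G' z)"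
      using has_derivative_unique UF[OF True] UG[OF that] by blast
    then have "1 *\<^sub>C F' z = 1 *\<^sub>C G' z" by meson
    with True show ?thesis by (simp add: D_def scaleC_one)
  qed (simp add: D_def)
  have "continuous_on (S \<union> T) D"
    using F(2) G(2) DG
    by (intro continuous_on_open_Un S T)
      (auto simp: D_def cong: continuous_on_cong)
  moreover have "(U has_derivative (\<lambda>h. h *\<^sub>C D z)) (at z)" if "z \<in> S \<union> T" for z
    using UF[of z] UG[of z] that by (auto simp: D_def)
  ultimately show ?thesis unfolding C1_holo_def by blast
qed

lemma poly_int_comp:
  fixes F :: "complex \<Rightarrow> 'a::complex_banach \<Rightarrow>\<^sub>L 'a"
  assumes "segs_in L S" "continuous_on S F"
  shows "poly_int L (\<lambda>z. F z o\<^sub>L Y) = poly_int L F o\<^sub>L Y"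
  by (rule poly_int_linear[OF assms bounded_linear_comp_left]) simp

text \<open>Evaluation at a vector is bounded linear and so commutes with the integral. The result
  is used for the constant \<open>Q\<close> of \<open>cauchy_transform_step\<close>: composing the
  resolvent with it from the left preserves complex differentiability only if it is
  complex-linear.\<close>

lemma clin_poly_int:
  fixes F :: "complex \<Rightarrow> 'a::complex_banach \<Rightarrow>\<^sub>L 'a"
  assumes "segs_in L S" "continuous_on S F" "\<And>w. w \<in> S \<Longrightarrow> clin (F w)"
  shows "clin (poly_int L F)"
  unfolding clin_def
proof (intro allI)
  fix z x
  have app: "poly_int L (\<lambda>w. F w y) = poly_int L F y" for y
    by (rule poly_int_linear[OF assms(1,2)]) (auto simp: scaleC_blinfun.rep_eq)
  have "continuous_on S (\<lambda>w. F w x)"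
    by (intro continuous_intros assms(2))
  then have "poly_int L (\<lambda>w. z *\<^sub>C F w x) = z *\<^sub>C poly_int L (\<lambda>w. F w x)"
    by (rule poly_int_linear[OF assms(1) _ scaleC.bounded_linear_right])
      (simp add: scaleC_scaleC mult.commute)
  moreover have "poly_int L (\<lambda>w. F w (z *\<^sub>C x)) = poly_int L (\<lambda>w. z *\<^sub>C F w x)"
    using assms(3) by (intro poly_int_cong[OF assms(1)]) (auto simp: clin_def)
  ultimately show "poly_int L F (z *\<^sub>C x) = z *\<^sub>C poly_int L F x"
    by (simp add: app)
qed

text \<open>Right multiplication by \<open>z P - B\<close> turns the Cauchy transform of
  \<open>F C R\<^sub>B\<close> into a constant operator on a neighbourhood \<open>N\<close> of the spectrum of \<open>B\<close>; hence this
  constant times \<open>R\<^sub>B\<close> extends to an entire function, which vanishes at infinity.\<close>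

lemma (in corner_algebra) cauchy_transform_step:
  fixes F :: "complex \<Rightarrow> 'a \<Rightarrow>\<^sub>L 'a"
  defines "I \<equiv> \<lambda>L1 L2 (H :: complex \<Rightarrow> 'a \<Rightarrow>\<^sub>L 'a). poly_int L1 H - poly_int L2 H"
  assumes B: "B \<in> V" and L: "segs_in L1 S" "segs_in L2 S" and N: "open N" "N \<inter> S = {}" "spec B \<subseteq> N"
    and F: "continuous_on S F" "\<And>w. w \<in> S \<Longrightarrow> clin (F w)" and C: "clin C" "C o\<^sub>L P = C"
    and Gc: "clin G" and G: "\<And>z. z \<in> N \<Longrightarrow> I L1 L2 (\<lambda>w. (1 / (w - z)) *\<^sub>C F w) = G"
  shows "I L1 L2 (\<lambda>w. (F w o\<^sub>L C) o\<^sub>L res B w) = G o\<^sub>L C"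
    and "z \<in> N \<Longrightarrow> I L1 L2 (\<lambda>w. (1 / (w - z)) *\<^sub>C ((F w o\<^sub>L C) o\<^sub>L res B w)) = 0"
proof -
  define H where "H w = (F w o\<^sub>L C) o\<^sub>L res B w" for w
  define V' where "V' z = I L1 L2 (\<lambda>w. (1 / (w - z)) *\<^sub>C H w)" for z
  define Q where "Q = (G o\<^sub>L C) - I L1 L2 H"
  have Sspec: "w \<notin> spec B" if "w \<in> S" for w using that N by auto
  have ne: "w \<noteq> z" if "w \<in> S" "z \<in> N" for w z using that N by auto
  have Hc: "continuous_on S H" unfolding H_def
    using Sspec
    by (intro blinfun_comp.continuous_on F continuous_on_const
        continuous_on_subset[OF continuous_on_res[OF B]]) auto
  have kc: "continuous_on S (\<lambda>w. (1 / (w - z)) *\<^sub>C X w)" if "z \<in> N" "continuous_on S X" for z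
    and X :: "complex \<Rightarrow> 'a \<Rightarrow>\<^sub>L 'a"
    using ne that by (intro continuous_intros) auto
  have I_comp: "I L1 L2 (\<lambda>w. X w o\<^sub>L Y) = I L1 L2 X o\<^sub>L Y" if "continuous_on S X" for X Y
    using L that by (simp add: I_def poly_int_comp blinfun_comp.diff_left)
  have I_diff: "I L1 L2 (\<lambda>w. X w - Y w) = I L1 L2 X - I L1 L2 Y"
    if "continuous_on S X" "continuous_on S Y" for X Y
    using poly_int_diff[OF L(1) that] poly_int_diff[OF L(2) that] by (simp add: I_def)
  have I_cong: "I L1 L2 X = I L1 L2 Y" if "\<And>w. w \<in> S \<Longrightarrow> X w = Y w" for X Y
    using poly_int_cong[OF L(1) that] poly_int_cong[OF L(2) that] by (simp add: I_def)
  have HP: "H w o\<^sub>L P = H w" if "w \<in> S" for w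
    using res_in[OF B Sspec[OF that]] by (simp add: H_def blinfun_comp_assoc P_right)
  have clin_H: "clin (H w)" if "w \<in> S" for w
    using F(2)[OF that] C(1) clin[OF res_in[OF B Sspec[OF that]]] by (auto simp: H_def intro!: clin_comp)
  have VP: "V' z o\<^sub>L P = V' z" if "z \<in> N" for z
    using I_comp[OF kc[OF that Hc], of P] HP
    by (simp add: V'_def cong: I_cong)
  have VB: "V' z o\<^sub>L (z *\<^sub>C P - B) = Q" if z: "z \<in> N" for z
  proof -
    \<comment> \<open>Split z P - B = (w P - B) - (w - z) P: the first part cancels the resolvent,
      the second the Cauchy kernel.\<close>
    have eq: "((1 / (w - z)) *\<^sub>C H w) o\<^sub>L (z *\<^sub>C P - B) = (((1 / (w - z)) *\<^sub>C F w) o\<^sub>L C) - H w"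
      if w: "w \<in> S" for w
    proof -
      note Rw = res_in[OF B Sspec[OF w]] res_left[OF B Sspec[OF w]]
      have FC: "clin (F w o\<^sub>L C)" using F(2)[OF w] C(1) clin_comp by blast
      have "z *\<^sub>C P - B = (w *\<^sub>C P - B) - (w - z) *\<^sub>C P"
        by (simp add: scaleC.diff_left)
      then have "res B w o\<^sub>L (z *\<^sub>C P - B) = P - (w - z) *\<^sub>C res B w"
        using Rw P by (simp add: blinfun_comp.diff_right scaleC_comp_right clin P_right)
      then have "H w o\<^sub>L (z *\<^sub>C P - B) = (F w o\<^sub>L C) o\<^sub>L (P - (w - z) *\<^sub>C res B w)"
        by (simp add: H_def blinfun_comp_assoc)
      also have "\<dots> = (F w o\<^sub>L C) - (w - z) *\<^sub>C H w"
        using C(2) scaleC_comp_right[OF FC]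
        by (simp add: blinfun_comp.diff_right H_def) (simp add: blinfun_comp_assoc)
      finally show ?thesis
        using ne[OF w z] by (simp add: scaleC.diff_right scaleC_scaleC scaleC_one)
    qed
    have "V' z o\<^sub>L (z *\<^sub>C P - B) = I L1 L2 (\<lambda>w. ((1 / (w - z)) *\<^sub>C H w) o\<^sub>L (z *\<^sub>C P - B))"
      unfolding V'_def by (rule I_comp[OF kc[OF z Hc], symmetric])
    also have "\<dots> = I L1 L2 (\<lambda>w. (((1 / (w - z)) *\<^sub>C F w) o\<^sub>L C) - H w)"
      by (rule I_cong[OF eq])
    also have "\<dots> = (I L1 L2 (\<lambda>w. (1 / (w - z)) *\<^sub>C F w) o\<^sub>L C) - I L1 L2 H"
    proof -
      have "continuous_on S (\<lambda>w. ((1 / (w - z)) *\<^sub>C F w) o\<^sub>L C)"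
        by (intro blinfun_comp.continuous_on kc[OF z F(1)] continuous_on_const)
      from I_diff[OF this Hc] I_comp[OF kc[OF z F(1)], of C] show ?thesis
        by (simp only:)
    qed
    finally show ?thesis using G[OF z] by (simp add: Q_def)
  qed
  \<comment> \<open>The integral describes \<open>U\<close> on \<open>N\<close>, the resolvent
    formula describes it off the spectrum; \<open>UR\<close> shows that the two agree on the
    overlap.\<close>
  define U where "U z = (if z \<in> N then V' z else Q o\<^sub>L res B z)" for z
  have UR: "U z = Q o\<^sub>L res B z" if "z \<notin> spec B" for z
  proof (cases "z \<in> N")
    case True
    have "V' z = V' z o\<^sub>L ((z *\<^sub>C P - B) o\<^sub>L res B z)"
      using VP[OF True] res_right[OF B that] by simp
    also have "\<dots> = Q o\<^sub>L res B z"
      using VB[OF True] by (simp add: blinfun_comp_assoc[symmetric])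
    finally show ?thesis using True by (simp add: U_def)
  qed (simp add: U_def)
  have "C1_holo V' N"
    unfolding V'_def I_def
    using C1_holo_add[OF C1_holo_cauchy_transform[OF L(1) Hc N(1,2)]
        C1_holo_linear[OF C1_holo_cauchy_transform[OF L(2) Hc N(1,2)], of uminus]]
    by (simp add: bounded_linear_minus[OF bounded_linear_ident] scaleC.minus_right)
  moreover have "clin Q"
    using Hc L
    by (auto simp: Q_def I_def intro!: clin_diff clin_comp Gc C clin_poly_int[OF _ Hc] clin_H)
  then have "C1_holo (\<lambda>z. Q o\<^sub>L res B z) (- spec B)"
    by (intro C1_holo_linear[OF C1_holo_res[OF B] bounded_linear_comp_right] scaleC_comp_right)
  ultimately have "C1_holo U (N \<union> - spec B)"
    using open_resolvent_set[OF B] N(1) UR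
    by (intro C1_holo_glue[of N V' U "- spec B" "\<lambda>z. Q o\<^sub>L res B z"]) (auto simp: U_def)
  moreover have "N \<union> - spec B = UNIV" using N by auto
  moreover have "(U \<longlongrightarrow> 0) at_infinity"
  proof -
    have "((\<lambda>z. Q o\<^sub>L res B z) \<longlongrightarrow> 0) at_infinity"
      using bounded_linear.tendsto_zero[OF bounded_linear_comp_right res_tendsto_0[OF B]] .
    moreover have "\<forall>\<^sub>F z in at_infinity. U z = Q o\<^sub>L res B z"
      unfolding eventually_at_infinity
      by (rule exI[of _ "norm B + 1"]) (auto intro!: UR res_large(1)[OF B])
    ultimately show ?thesis by (simp cong: tendsto_cong)
  qed
  ultimately have U0: "U z = 0" for z
    using C1_holo_Liouville[of U z] by simp
  show "I L1 L2 (\<lambda>w. (1 / (w - z)) *\<^sub>C ((F w o\<^sub>L C) o\<^sub>L res B w)) = 0" if "z \<in> N"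
    using U0[of z] that by (simp add: U_def V'_def H_def)
  \<comment> \<open>A point beyond the norm of \<open>B\<close> is off the spectrum. There the
    composition of \<open>Q\<close> with the resolvent is 0, and multiplication by z0 P - B gives
    back \<open>Q\<close>.\<close>
  define z0 where "z0 = complex_of_real (norm B + 1)"
  have z0: "z0 \<notin> spec B" by (rule res_large(1)[OF B]) (simp add: z0_def del: of_real_add)
  have "Q o\<^sub>L P = (Q o\<^sub>L res B z0) o\<^sub>L (z0 *\<^sub>C P - B)"
    by (simp add: blinfun_comp_assoc res_left[OF B z0])
  also have "\<dots> = 0"
    using U0[of z0] UR[OF z0] by (simp add: blinfun_comp.zero_left)
  also have "Q o\<^sub>L P = Q"
    using I_comp[OF Hc, of P] HP C(2)
    by (simp add: Q_def blinfun_comp.diff_left blinfun_comp_assoc cong: I_cong)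
  finally show "I L1 L2 (\<lambda>w. (F w o\<^sub>L C) o\<^sub>L res B w) = G o\<^sub>L C"
    by (simp add: Q_def H_def[abs_def])
qed

text \<open>Cauchy's formula is demanded of every closed curve by itself, with its own winding
  number, so that for a list of curves it follows by adding up. The point \<open>z\<close> may lie
  in another component than the curve.\<close>

definition cauchy_domain :: "complex set \<Rightarrow> bool" where
  "cauchy_domain D \<longleftrightarrow> open D \<and>
     (\<forall>f \<gamma> z. f holomorphic_on D \<longrightarrow> valid_path \<gamma> \<longrightarrow> pathfinish \<gamma> = pathstart \<gamma> \<longrightarrow>
        path_image \<gamma> \<subseteq> D - {z} \<longrightarrow> z \<in> D \<longrightarrow>
        ((\<lambda>w. f w / (w - z)) has_contour_integral (2 * pi * \<i> * winding_number \<gamma> z * f z)) \<gamma>)"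

lemma cauchy_domain_UNIV: "cauchy_domain UNIV"
  unfolding cauchy_domain_def
  by (intro conjI allI impI Cauchy_integral_formula_convex_simple[OF convex_UNIV]) auto

text \<open>A curve is connected and hence stays in one half-plane, which is convex. If
  \<open>z\<close> is on the same side, the convex case applies; otherwise the integrand is
  holomorphic on that half-plane and both the integral and the winding number are 0.\<close>

lemma cauchy_domain_g_dom: "cauchy_domain g_dom"
  unfolding cauchy_domain_def
proof (intro conjI allI impI)
  have "g_dom = {z. Re z < 0} \<union> {z. Re z > 0}" by (auto simp: g_dom_def)
  then show "open g_dom"
    by (metis open_Un open_halfspace_Re_lt open_halfspace_Re_gt)
  fix f :: "complex \<Rightarrow> complex" and \<gamma> :: "real \<Rightarrow> complex" and z
  assume f: "f holomorphic_on g_dom" and \<gamma>: "valid_path \<gamma>" "pathfinish \<gamma> = pathstart \<gamma>"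
    and im: "path_image \<gamma> \<subseteq> g_dom - {z}" and "z \<in> g_dom"
  have conn: "connected (path_image \<gamma>)"
    using \<gamma> valid_path_imp_path connected_path_image by blast
  have "path_image \<gamma> \<subseteq> {z. Re z < 0} \<or> path_image \<gamma> \<subseteq> {z. Re z > 0}"
  proof (rule ccontr)
    assume "\<not> ?thesis"
    then have "{z. Re z < 0} \<inter> path_image \<gamma> \<noteq> {}" "{z. Re z > 0} \<inter> path_image \<gamma> \<noteq> {}"
      using im by (force simp: g_dom_def)+
    moreover have "path_image \<gamma> \<subseteq> {z. Re z < 0} \<union> {z. Re z > 0}"
      using im by (auto simp: g_dom_def)
    moreover have "{z. Re z < 0} \<inter> {z. Re z > 0} \<inter> path_image \<gamma> = {}" by auto
    ultimately show False
      using connectedD[OF conn open_halfspace_Re_lt[of 0] open_halfspace_Re_gt[of 0]] by blast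
  qed
  moreover have "convex {z. Re z < 0}" "open {z. Re z < 0}" "{z. Re z < 0} \<subseteq> g_dom"
      "convex {z. Re z > 0}" "open {z. Re z > 0}" "{z. Re z > 0} \<subseteq> g_dom"
    using convex_halfspace_Re_lt open_halfspace_Re_lt convex_halfspace_Re_gt open_halfspace_Re_gt
    by (auto simp: g_dom_def)
  ultimately obtain C where C: "path_image \<gamma> \<subseteq> C" "convex C" "open C" "C \<subseteq> g_dom"
    by metis
  have fC: "f holomorphic_on C" using f C(4) holomorphic_on_subset by blast
  show "((\<lambda>w. f w / (w - z)) has_contour_integral (2 * pi * \<i> * winding_number \<gamma> z * f z)) \<gamma>"
  proof (cases "z \<in> C")
    case True
    then show ?thesis
      using C im \<gamma> by (intro Cauchy_integral_formula_convex_simple[OF C(2) fC])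
        (auto simp: interior_open)
  next
    case False
    have "((\<lambda>w. f w / (w - z)) has_contour_integral 0) \<gamma>"
      using False C \<gamma> by (intro Cauchy_theorem_convex_simple[of _ C] holomorphic_intros fC) auto
    moreover have "winding_number \<gamma> z = 0"
      using winding_number_zero_outside[OF valid_path_imp_path C(2)] \<gamma> C(1) False by auto
    ultimately show ?thesis by simp
  qed
qed

definition cycle_image :: "(real \<Rightarrow> complex) list \<Rightarrow> complex set" where
  "cycle_image \<Gamma> = (\<Union>\<gamma>\<in>set \<Gamma>. path_image \<gamma>)"

lemma compact_cycle_image: "\<forall>\<gamma>\<in>set \<Gamma>. valid_path \<gamma> \<Longrightarrow> compact (cycle_image \<Gamma>)"
  unfolding cycle_image_def
  by (intro compact_UN) (auto intro: valid_path_imp_path)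

lemma cycle_integral_cauchy_formula:
  fixes P :: "'b::complex_banach"
  assumes D: "cauchy_domain D" and \<Gamma>: "surrounds \<Gamma> D K" and f: "f holomorphic_on D"
    and z: "z \<in> D" "z \<notin> cycle_image \<Gamma>"
  shows "cycle_integral \<Gamma> (\<lambda>w. (1 / (w - z)) *\<^sub>C f w *\<^sub>C P) =
    (2 * pi * \<i> * f z * (\<Sum>\<gamma>\<leftarrow>\<Gamma>. winding_number \<gamma> z)) *\<^sub>C P"
proof -
  have "cycle_integral \<Gamma> (\<lambda>w. (f w / (w - z)) *\<^sub>C P) =
      (\<Sum>\<gamma>\<leftarrow>\<Gamma>. 2 * pi * \<i> * winding_number \<gamma> z * f z) *\<^sub>C P"
  proof (rule cycle_integral_scalar)
    fix \<gamma> assume "\<gamma> \<in> set \<Gamma>"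
    then have "valid_path \<gamma>" "pathfinish \<gamma> = pathstart \<gamma>" "path_image \<gamma> \<subseteq> D - {z}"
      using \<Gamma> z unfolding surrounds_def cycle_image_def by auto
    then show "((\<lambda>w. f w / (w - z)) has_contour_integral 2 * pi * \<i> * winding_number \<gamma> z * f z) \<gamma>"
      using D f z unfolding cauchy_domain_def by blast
  qed
  also have "(\<Sum>\<gamma>\<leftarrow>\<Gamma>. 2 * pi * \<i> * winding_number \<gamma> z * f z) =
      2 * pi * \<i> * f z * (\<Sum>\<gamma>\<leftarrow>\<Gamma>. winding_number \<gamma> z)"
    by (simp add: sum_list_const_mult mult_ac)
  finally show ?thesis by (simp add: scaleC_scaleC)
qed

text \<open>\<open>cauchy_transform_step\<close> wants its identity on an open neighbourhood, while
  \<open>surrounds\<close> speaks of points of \<open>K\<close>. Balls about points of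
  \<open>K\<close> that miss the curves are connected, so winding numbers are constant on
  them.\<close>

lemma surrounds_nhd:
  assumes \<Gamma>: "surrounds \<Gamma> D K" and K: "compact K"
  shows "\<exists>N. open N \<and> K \<subseteq> N \<and> N \<inter> cycle_image \<Gamma> = {} \<and>
    (\<forall>z\<in>N. (\<Sum>\<gamma>\<leftarrow>\<Gamma>. winding_number \<gamma> z) = 1)"
proof -
  have vp: "\<forall>\<gamma>\<in>set \<Gamma>. valid_path \<gamma>" and disj: "K \<inter> cycle_image \<Gamma> = {}"
    and loop: "\<forall>\<gamma>\<in>set \<Gamma>. pathfinish \<gamma> = pathstart \<gamma>"
    and wind: "\<forall>z\<in>K. (\<Sum>\<gamma>\<leftarrow>\<Gamma>. winding_number \<gamma> z) = 1"
    using \<Gamma> unfolding surrounds_def cycle_image_def by auto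
  obtain d where d: "d > 0" "\<forall>x\<in>K. \<forall>y\<in>cycle_image \<Gamma>. d \<le> dist x y"
    using separate_compact_closed[OF K compact_imp_closed[OF compact_cycle_image[OF vp]] disj] by blast
  have img: "ball k d \<inter> cycle_image \<Gamma> = {}" if "k \<in> K" for k
    using d that by fastforce
  have "(\<Sum>\<gamma>\<leftarrow>\<Gamma>. winding_number \<gamma> z) = 1" if "k \<in> K" "z \<in> ball k d" for k z
  proof -
    have "winding_number \<gamma> z = winding_number \<gamma> k" if "\<gamma> \<in> set \<Gamma>" for \<gamma>
    proof -
      have "ball k d \<inter> path_image \<gamma> = {}"
        using img[OF \<open>k \<in> K\<close>] that by (auto simp: cycle_image_def)
      then have "winding_number \<gamma> constant_on ball k d"
        using vp loop that by (intro winding_number_constant) (auto intro: valid_path_imp_path)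
      then show ?thesis
        using \<open>z \<in> ball k d\<close> d(1) unfolding constant_on_def by (metis centre_in_ball)
    qed
    then have "(\<Sum>\<gamma>\<leftarrow>\<Gamma>. winding_number \<gamma> z) = (\<Sum>\<gamma>\<leftarrow>\<Gamma>. winding_number \<gamma> k)"
      by (intro arg_cong[of _ _ sum_list] map_cong) auto
    then show ?thesis using wind that by simp
  qed
  then show ?thesis
    using img d(1) by (intro exI[of _ "\<Union>k\<in>K. ball k d"]) (auto intro: bexI)
qed

section \<open>Chains of resolvents and independence of the contour\<close>

lemma C1_holo_comp:
  fixes F G :: "complex \<Rightarrow> 'a::complex_banach \<Rightarrow>\<^sub>L 'a"
  assumes "C1_holo F S" "C1_holo G S" "\<And>z. z \<in> S \<Longrightarrow> clin (F z)"
  shows "C1_holo (\<lambda>z. F z o\<^sub>L G z) S"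
proof -
  obtain F' where F: "\<And>z. z \<in> S \<Longrightarrow> (F has_derivative (\<lambda>h. h *\<^sub>C F' z)) (at z)" "continuous_on S F'"
    using assms(1) unfolding C1_holo_def by blast
  obtain G' where G: "\<And>z. z \<in> S \<Longrightarrow> (G has_derivative (\<lambda>h. h *\<^sub>C G' z)) (at z)" "continuous_on S G'"
    using assms(2) unfolding C1_holo_def by blast
  show ?thesis unfolding C1_holo_def
  proof (intro exI[of _ "\<lambda>z. (F z o\<^sub>L G' z) + (F' z o\<^sub>L G z)"] conjI ballI)
    fix z assume z: "z \<in> S"
    show "((\<lambda>z. F z o\<^sub>L G z) has_derivative (\<lambda>h. h *\<^sub>C ((F z o\<^sub>L G' z) + (F' z o\<^sub>L G z)))) (at z)"
      \<comment> \<open>One summand is \<open>F z o\<^sub>L (h *\<^sub>C G' z)\<close>; moving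
        \<open>h\<close> to the front uses complex linearity of \<open>F z\<close>.\<close>
      by (rule blinfun_comp.FDERIV[OF F(1)[OF z] G(1)[OF z], THEN has_derivative_eq_rhs])
        (simp add: scaleC_comp_right[OF assms(3)[OF z]] scaleC_add_right)
  next
    show "continuous_on S (\<lambda>z. (F z o\<^sub>L G' z) + (F' z o\<^sub>L G z))"
      by (intro continuous_intros blinfun_comp.continuous_on F G
          C1_holo_continuous_on[OF assms(1)] C1_holo_continuous_on[OF assms(2)])
  qed
qed

text \<open>\<open>K\<close> is any compact set containing the spectra of the diagonal blocks. With
  the causal spectrum as \<open>K\<close> the locale describes the divided differences; with m = 1,
  a constant index and the spectrum of one block as \<open>K\<close>, it describes the functional
  calculus of that block.\<close>

locale resolvent_chain =
  fixes A :: "'a::complex_banach op_matrix" and \<iota> :: "nat \<Rightarrow> nat" and m :: nat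
    and V :: "nat \<Rightarrow> ('a \<Rightarrow>\<^sub>L 'a) set" and P :: "nat \<Rightarrow> 'a \<Rightarrow>\<^sub>L 'a" and K :: "complex set"
  assumes corner: "k \<in> {1..m} \<Longrightarrow> corner_algebra (V k) (P k)"
    and diag: "k \<in> {1..m} \<Longrightarrow> A (\<iota> k) (\<iota> k) \<in> V k"
    and off_clin: "k \<in> {1..<m} \<Longrightarrow> clin (A (\<iota> k) (\<iota> (k + 1)))"
    and off_P: "k \<in> {1..<m} \<Longrightarrow> A (\<iota> k) (\<iota> (k + 1)) o\<^sub>L P (k + 1) = A (\<iota> k) (\<iota> (k + 1))"
    and spec: "k \<in> {1..m} \<Longrightarrow> corner_algebra.spec (V k) (P k) (A (\<iota> k) (\<iota> k)) \<subseteq> K"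
    and K: "compact K"
    and m: "m \<ge> 1"
begin

definition R :: "nat \<Rightarrow> complex \<Rightarrow> 'a \<Rightarrow>\<^sub>L 'a" where
  "R k = corner_algebra.res (V k) (P k) (A (\<iota> k) (\<iota> k))"

definition \<Phi> :: "nat \<Rightarrow> complex \<Rightarrow> 'a \<Rightarrow>\<^sub>L 'a" where
  "\<Phi> p z = alt_prod A \<iota> (\<lambda>k. R k z) p"

lemma \<Phi>_0: "\<Phi> 0 = R 1"
  by (simp add: \<Phi>_def fun_eq_iff)

lemma \<Phi>_Suc: "\<Phi> (Suc p) z = (\<Phi> p z o\<^sub>L A (\<iota> (p + 1)) (\<iota> (p + 2))) o\<^sub>L R (p + 2) z"
  by (simp add: \<Phi>_def)

lemma off:
  assumes "Suc p < m"
  shows "clin (A (\<iota> (p + 1)) (\<iota> (p + 2)))"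
    and "A (\<iota> (p + 1)) (\<iota> (p + 2)) o\<^sub>L P (p + 2) = A (\<iota> (p + 1)) (\<iota> (p + 2))"
  using off_clin[of "p + 1"] off_P[of "p + 1"] assms by (auto simp: numeral_2_eq_2)

lemma open_K: "open (- K)"
  using K compact_imp_closed by auto

context
  fixes k assumes k: "k \<in> {1..m}"
begin

interpretation corner_algebra "V k" "P k" by (rule corner[OF k])

lemma P_props: "P k o\<^sub>L P k = P k" "clin (P k)"
  using P_left P clin by auto

lemma C1_holo_R: "C1_holo (R k) (- K)"
  unfolding R_def using C1_holo_subset[OF C1_holo_res[OF diag[OF k]]] spec[OF k] by auto

lemma R_props:
  assumes "z \<notin> K"
  shows "clin (R k z)" "R k z o\<^sub>L P k = R k z" "P k o\<^sub>L R k z = R k z"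
    "z *\<^sub>C R k z = P k + (A (\<iota> k) (\<iota> k) o\<^sub>L R k z)"
    "z *\<^sub>C R k z = P k + (R k z o\<^sub>L A (\<iota> k) (\<iota> k))"
proof -
  have z: "z \<notin> corner_algebra.spec (V k) (P k) (A (\<iota> k) (\<iota> k))" using assms spec[OF k] by auto
  show "clin (R k z)" "R k z o\<^sub>L P k = R k z" "P k o\<^sub>L R k z = R k z"
    using res_in[OF diag[OF k] z] clin P_right P_left by (auto simp: R_def)
  show "z *\<^sub>C R k z = P k + (A (\<iota> k) (\<iota> k) o\<^sub>L R k z)"
    "z *\<^sub>C R k z = P k + (R k z o\<^sub>L A (\<iota> k) (\<iota> k))"
    using res_mult[OF diag[OF k] z] by (simp_all add: R_def)
qed

lemma clin_diag: "clin (A (\<iota> k) (\<iota> k))"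
  using diag[OF k] clin by auto

end

lemma clin_\<Phi>: "p < m \<Longrightarrow> z \<notin> K \<Longrightarrow> clin (\<Phi> p z)"
proof (induction p)
  case 0
  then show ?case using R_props(1)[of 1 z] m by (simp add: \<Phi>_0)
next
  case (Suc p)
  then show ?case using R_props(1)[of "p + 2" z] off(1)[of p]
    by (simp add: \<Phi>_Suc clin_comp)
qed

lemma \<Phi>_P: "p < m \<Longrightarrow> z \<notin> K \<Longrightarrow> \<Phi> p z o\<^sub>L P (p + 1) = \<Phi> p z"
  by (cases p) (simp_all add: \<Phi>_0 \<Phi>_Suc R_props blinfun_comp_assoc)

lemma C1_holo_\<Phi>: "p < m \<Longrightarrow> C1_holo (\<Phi> p) (- K)"
proof (induction p)
  case 0
  then show ?case using C1_holo_R[of 1] m by (simp add: \<Phi>_0)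
next
  case (Suc p)
  have "C1_holo (\<lambda>z. (\<Phi> p z o\<^sub>L A (\<iota> (p + 1)) (\<iota> (p + 2))) o\<^sub>L R (p + 2) z) (- K)"
    using Suc
    by (intro C1_holo_comp C1_holo_R clin_comp clin_\<Phi> off C1_holo_linear[OF Suc.IH bounded_linear_comp_left])
      auto
  then show ?case by (simp add: \<Phi>_Suc[abs_def])
qed

text \<open>Attaching the first resolvent turns the constant Cauchy transform of f P into the
  integral c P and leaves a Cauchy transform that vanishes near \<open>K\<close>. Every later
  resolvent starts from this zero, so all higher integrals vanish. Two cycles are compared by taking
  c = 0; a single one is evaluated by taking the second to be empty.\<close>

lemma cycle_integral_chain:
  assumes D: "open D" and f: "f holomorphic_on D"
    and \<Gamma>: "\<forall>\<gamma>\<in>set \<Gamma>1 \<union> set \<Gamma>2. valid_path \<gamma> \<and> path_image \<gamma> \<subseteq> D - K"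
    and N: "open N" "K \<subseteq> N"
    and base: "\<And>z. z \<in> N \<Longrightarrow>
      cycle_integral \<Gamma>1 (\<lambda>w. (1 / (w - z)) *\<^sub>C f w *\<^sub>C P 1) -
      cycle_integral \<Gamma>2 (\<lambda>w. (1 / (w - z)) *\<^sub>C f w *\<^sub>C P 1) = c *\<^sub>C P 1"
    and p: "p < m"
  shows "cycle_integral \<Gamma>1 (\<lambda>w. f w *\<^sub>C \<Phi> p w) - cycle_integral \<Gamma>2 (\<lambda>w. f w *\<^sub>C \<Phi> p w) =
    (if p = 0 then c *\<^sub>C P 1 else 0)"
proof -
  define J where "J = cycle_image (\<Gamma>1 @ \<Gamma>2)"
  have "compact J" unfolding J_def using \<Gamma> by (intro compact_cycle_image) auto
  moreover have JDK: "J \<subseteq> D - K" unfolding J_def cycle_image_def using \<Gamma> by auto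
  ultimately obtain d where d: "d > 0" "\<forall>x\<in>J. \<forall>y\<in>K. d \<le> dist x y"
    using separate_compact_closed[of J K] K compact_imp_closed by blast
  \<comment> \<open>With half the distance between curves and \<open>K\<close> as radius,
    \<open>S\<close> and \<open>N'\<close> are disjoint. Polygons run in \<open>S\<close>, so Cauchy
    kernels with poles in \<open>N'\<close> are regular on them.\<close>
  define S where "S = D \<inter> (\<Union>x\<in>J. ball x (d / 2))"
  define N' where "N' = N \<inter> (\<Union>y\<in>K. ball y (d / 2))"
  have S: "open S" "S \<subseteq> D" "J \<subseteq> S" using D JDK d(1) by (auto simp: S_def)
  have N': "open N'" "K \<subseteq> N'" "N' \<subseteq> N" using N d(1) by (auto simp: N'_def)
  have disj: "N' \<inter> S = {}"
  proof (rule ccontr)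
    assume "N' \<inter> S \<noteq> {}"
    then obtain x y z where "x \<in> J" "y \<in> K" "dist x z < d / 2" "dist y z < d / 2"
      by (auto simp: N'_def S_def)
    then have "dist x y < d" "d \<le> dist x y" using d(2) dist_triangle_half_l by blast+
    then show False by simp
  qed
  have SK: "S \<subseteq> - K" using disj N'(2) by auto
  have im: "\<forall>\<gamma>\<in>set \<Gamma>1. valid_path \<gamma> \<and> path_image \<gamma> \<subseteq> S" "\<forall>\<gamma>\<in>set \<Gamma>2. valid_path \<gamma> \<and> path_image \<gamma> \<subseteq> S"
    using \<Gamma> S(3) by (auto simp: J_def cycle_image_def)
  obtain L1 where L1: "segs_in L1 S"
    "\<And>F::complex \<Rightarrow> 'a \<Rightarrow>\<^sub>L 'a. C1_holo F S \<Longrightarrow> cycle_integral \<Gamma>1 F = poly_int L1 F"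
    using cycle_integral_eq_poly_int[OF S(1) im(1)] by blast
  obtain L2 where L2: "segs_in L2 S"
    "\<And>F::complex \<Rightarrow> 'a \<Rightarrow>\<^sub>L 'a. C1_holo F S \<Longrightarrow> cycle_integral \<Gamma>2 F = poly_int L2 F"
    using cycle_integral_eq_poly_int[OF S(1) im(2)] by blast
  have fS: "f holomorphic_on S" using f S(2) holomorphic_on_subset by blast
  have fF: "C1_holo (\<lambda>w. f w *\<^sub>C F w) S" if "C1_holo F (- K)" for F :: "complex \<Rightarrow> 'a \<Rightarrow>\<^sub>L 'a"
    by (intro C1_holo_scale S fS C1_holo_subset[OF that SK])
  have fP: "C1_holo (\<lambda>w. (1 / (w - z)) *\<^sub>C f w *\<^sub>C P 1) S" if "z \<in> N'" for z
    using that disj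
    by (intro C1_holo_scale S fS C1_holo_const holomorphic_intros) auto
  \<comment> \<open>The vanishing of the Cauchy transform is carried along because it is the
    hypothesis of the next application of \<open>cauchy_transform_step\<close>.\<close>
  have "poly_int L1 (\<lambda>w. f w *\<^sub>C \<Phi> p w) - poly_int L2 (\<lambda>w. f w *\<^sub>C \<Phi> p w) =
      (if p = 0 then c *\<^sub>C P 1 else 0) \<and>
    (\<forall>z\<in>N'. poly_int L1 (\<lambda>w. (1 / (w - z)) *\<^sub>C f w *\<^sub>C \<Phi> p w) -
      poly_int L2 (\<lambda>w. (1 / (w - z)) *\<^sub>C f w *\<^sub>C \<Phi> p w) = 0)"
    using p
  proof (induction p)
    case 0
    have 1: "1 \<in> {1..m}" using m by auto
    interpret corner_algebra "V 1" "P 1" by (rule corner[OF 1])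
    \<comment> \<open>\<open>P 1\<close> stands in for an off-diagonal factor, so that the first
      resolvent is attached by the same lemma as the others.\<close>
    have eq: "((f w *\<^sub>C P 1) o\<^sub>L P 1) o\<^sub>L res (A (\<iota> 1) (\<iota> 1)) w = f w *\<^sub>C \<Phi> 0 w" if "w \<in> S" for w
    proof -
      have "w \<notin> K" using that SK by auto
      then show ?thesis using P_props[OF 1] R_props(3)[OF 1] by (simp add: \<Phi>_0 R_def)
    qed
    have base': "poly_int L1 (\<lambda>w. (1 / (w - z)) *\<^sub>C f w *\<^sub>C P 1) -
        poly_int L2 (\<lambda>w. (1 / (w - z)) *\<^sub>C f w *\<^sub>C P 1) = c *\<^sub>C P 1" if "z \<in> N'" for z
      using base[of z] L1(2)[OF fP[OF that]] L2(2)[OF fP[OF that]] that N'(3) by auto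
    have cP: "continuous_on S (\<lambda>w. f w *\<^sub>C P 1)"
      by (intro continuous_intros holomorphic_on_imp_continuous_on[OF fS])
    have sp: "corner_algebra.spec (V 1) (P 1) (A (\<iota> 1) (\<iota> 1)) \<subseteq> N'"
      using spec[OF 1] N'(2) by auto
    note st = cauchy_transform_step[of "A (\<iota> 1) (\<iota> 1)" L1 S L2 N' "\<lambda>w. f w *\<^sub>C P 1" "P 1" "c *\<^sub>C P 1",
        OF diag[OF 1] L1(1) L2(1) N'(1) disj sp cP clin_scaleC[OF P_props(2)[OF 1]] P_props(2,1)[OF 1]
        clin_scaleC[OF P_props(2)[OF 1]] base']
    have "poly_int L1 (\<lambda>w. f w *\<^sub>C \<Phi> 0 w) - poly_int L2 (\<lambda>w. f w *\<^sub>C \<Phi> 0 w) = c *\<^sub>C P 1"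
      using st(1) poly_int_cong[OF L1(1) eq] poly_int_cong[OF L2(1) eq] P_props(1)[OF 1] by simp
    moreover have "poly_int L1 (\<lambda>w. (1 / (w - z)) *\<^sub>C f w *\<^sub>C \<Phi> 0 w) -
      poly_int L2 (\<lambda>w. (1 / (w - z)) *\<^sub>C f w *\<^sub>C \<Phi> 0 w) = 0" if "z \<in> N'" for z
    proof -
      have "(1 / (w - z)) *\<^sub>C (((f w *\<^sub>C P 1) o\<^sub>L P 1) o\<^sub>L res (A (\<iota> 1) (\<iota> 1)) w) =
          (1 / (w - z)) *\<^sub>C f w *\<^sub>C \<Phi> 0 w" if "w \<in> S" for w
        using eq[OF that] by (rule arg_cong)
      from poly_int_cong[OF L1(1) this] poly_int_cong[OF L2(1) this] st(2)[OF _ that]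
      show ?thesis by simp
    qed
    ultimately show ?case by simp
  next
    case (Suc p)
    then have k: "p + 2 \<in> {1..m}" and p: "p < m" by auto
    interpret corner_algebra "V (p + 2)" "P (p + 2)" by (rule corner[OF k])
    have eq: "((f w *\<^sub>C \<Phi> p w) o\<^sub>L A (\<iota> (p + 1)) (\<iota> (p + 2))) o\<^sub>L res (A (\<iota> (p + 2)) (\<iota> (p + 2))) w
        = f w *\<^sub>C \<Phi> (Suc p) w" for w
      by (simp add: \<Phi>_Suc R_def)
    have cF: "continuous_on S (\<lambda>w. f w *\<^sub>C \<Phi> p w)"
      using C1_holo_continuous_on[OF fF[OF C1_holo_\<Phi>[OF p]]] .
    have clF: "clin (f w *\<^sub>C \<Phi> p w)" if "w \<in> S" for w
      using clin_\<Phi>[OF p] that SK by (intro clin_scaleC) auto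
    have sp: "corner_algebra.spec (V (p + 2)) (P (p + 2)) (A (\<iota> (p + 2)) (\<iota> (p + 2))) \<subseteq> N'"
      using spec[OF k] N'(2) by auto
    have IH: "poly_int L1 (\<lambda>w. (1 / (w - z)) *\<^sub>C f w *\<^sub>C \<Phi> p w) -
      poly_int L2 (\<lambda>w. (1 / (w - z)) *\<^sub>C f w *\<^sub>C \<Phi> p w) = 0" if "z \<in> N'" for z
      using Suc.IH[OF p] that by blast
    note st = cauchy_transform_step[OF diag[OF k] L1(1) L2(1) N'(1) disj sp cF clF
        off[OF Suc.prems] clin_0 IH, unfolded eq]
    show ?case using st by (simp add: blinfun_comp.zero_left)
  qed
  then show ?thesis
    using L1(2)[OF fF[OF C1_holo_\<Phi>[OF p]]] L2(2)[OF fF[OF C1_holo_\<Phi>[OF p]]] by simp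
qed

text \<open>Near \<open>K\<close> the winding sums of any two surrounding cycles are both 1, so
  their Cauchy integrals of f P agree there and \<open>cycle_integral_chain\<close> applies with c =
  0. The given cycle ensures that the condition inside the description is not vacuous.\<close>

lemma cauchy_value_chain:
  assumes D: "cauchy_domain D" and f: "f holomorphic_on D" and \<Gamma>: "surrounds \<Gamma> D K"
    and "K \<subseteq> D" and p: "p < m"
  shows "cauchy_value D K (\<lambda>z. f z *\<^sub>C \<Phi> p z) =
    (1 / (2 * of_real pi * \<i>)) *\<^sub>C cycle_integral \<Gamma> (\<lambda>z. f z *\<^sub>C \<Phi> p z)"
  unfolding cauchy_value_def
proof (rule the_equality)
  have "open D" using D by (simp add: cauchy_domain_def)
  show "\<forall>\<Gamma>'. surrounds \<Gamma>' D K \<longrightarrow>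
      (1 / (2 * of_real pi * \<i>)) *\<^sub>C cycle_integral \<Gamma> (\<lambda>z. f z *\<^sub>C \<Phi> p z) =
      (1 / (2 * of_real pi * \<i>)) *\<^sub>C cycle_integral \<Gamma>' (\<lambda>z. f z *\<^sub>C \<Phi> p z)"
  proof (intro allI impI)
    fix \<Gamma>' assume \<Gamma>': "surrounds \<Gamma>' D K"
    obtain N where N: "open N" "K \<subseteq> N" "N \<inter> cycle_image \<Gamma> = {}"
      "\<forall>z\<in>N. (\<Sum>\<gamma>\<leftarrow>\<Gamma>. winding_number \<gamma> z) = 1"
      using surrounds_nhd[OF \<Gamma> K] by blast
    obtain N' where N': "open N'" "K \<subseteq> N'" "N' \<inter> cycle_image \<Gamma>' = {}"
      "\<forall>z\<in>N'. (\<Sum>\<gamma>\<leftarrow>\<Gamma>'. winding_number \<gamma> z) = 1"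
      using surrounds_nhd[OF \<Gamma>' K] by blast
    have "cycle_integral \<Gamma> (\<lambda>w. f w *\<^sub>C \<Phi> p w) - cycle_integral \<Gamma>' (\<lambda>w. f w *\<^sub>C \<Phi> p w) =
        (if p = 0 then 0 *\<^sub>C P 1 else 0)"
    proof (rule cycle_integral_chain[OF \<open>open D\<close> f _ _ _ _ p, of \<Gamma> \<Gamma>' "N \<inter> N' \<inter> D"])
      show "\<forall>\<gamma>\<in>set \<Gamma> \<union> set \<Gamma>'. valid_path \<gamma> \<and> path_image \<gamma> \<subseteq> D - K"
        using \<Gamma> \<Gamma>' unfolding surrounds_def by blast
      show "open (N \<inter> N' \<inter> D)" "K \<subseteq> N \<inter> N' \<inter> D"
        using N N' \<open>open D\<close> \<open>K \<subseteq> D\<close> by auto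
      fix z assume z: "z \<in> N \<inter> N' \<inter> D"
      then have "z \<notin> cycle_image \<Gamma>" "z \<notin> cycle_image \<Gamma>'" "z \<in> D"
        using N(3) N'(3) by auto
      then show "cycle_integral \<Gamma> (\<lambda>w. (1 / (w - z)) *\<^sub>C f w *\<^sub>C P 1) -
          cycle_integral \<Gamma>' (\<lambda>w. (1 / (w - z)) *\<^sub>C f w *\<^sub>C P 1) = 0 *\<^sub>C P 1"
        using cycle_integral_cauchy_formula[OF D \<Gamma> f, of z "P 1"]
          cycle_integral_cauchy_formula[OF D \<Gamma>' f, of z "P 1"] N(4) N'(4) z
        by (auto simp: scaleC_zero_left)
    qed
    then show "(1 / (2 * of_real pi * \<i>)) *\<^sub>C cycle_integral \<Gamma> (\<lambda>z. f z *\<^sub>C \<Phi> p z) =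
      (1 / (2 * of_real pi * \<i>)) *\<^sub>C cycle_integral \<Gamma>' (\<lambda>z. f z *\<^sub>C \<Phi> p z)"
      by (simp add: scaleC_zero_left split: if_splits)
  qed
  fix v assume "\<forall>\<Gamma>. surrounds \<Gamma> D K \<longrightarrow>
    v = (1 / (2 * of_real pi * \<i>)) *\<^sub>C cycle_integral \<Gamma> (\<lambda>z. f z *\<^sub>C \<Phi> p z)"
  then show "v = (1 / (2 * of_real pi * \<i>)) *\<^sub>C cycle_integral \<Gamma> (\<lambda>z. f z *\<^sub>C \<Phi> p z)"
    using \<Gamma> by blast
qed

text \<open>This is f = 1 compared with the empty cycle. It supplies the values at time 0: those of
  the divided differences of positive order cancel, and single resolvents give the unit.\<close>

lemma cycle_integral_\<Phi>:
  assumes \<Gamma>: "surrounds \<Gamma> D K" and p: "p < m"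
  shows "cycle_integral \<Gamma> (\<Phi> p) = (if p = 0 then (2 * of_real pi * \<i>) *\<^sub>C P 1 else 0)"
proof -
  \<comment> \<open>In \<open>UNIV\<close> the condition on points outside the domain is
    void.\<close>
  have \<Gamma>': "surrounds \<Gamma> UNIV K" using \<Gamma> by (auto simp: surrounds_def)
  obtain N where N: "open N" "K \<subseteq> N" "N \<inter> cycle_image \<Gamma> = {}"
    "\<forall>z\<in>N. (\<Sum>\<gamma>\<leftarrow>\<Gamma>. winding_number \<gamma> z) = 1"
    using surrounds_nhd[OF \<Gamma> K] by blast
  have "cycle_integral \<Gamma> (\<lambda>w. 1 *\<^sub>C \<Phi> p w) - cycle_integral [] (\<lambda>w. 1 *\<^sub>C \<Phi> p w) =
      (if p = 0 then (2 * of_real pi * \<i>) *\<^sub>C P 1 else 0)"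
  proof (rule cycle_integral_chain[OF open_UNIV _ _ N(1,2) _ p, of "\<lambda>_. 1"])
    show "\<forall>\<gamma>\<in>set \<Gamma> \<union> set []. valid_path \<gamma> \<and> path_image \<gamma> \<subseteq> UNIV - K"
      using \<Gamma>' unfolding surrounds_def by auto
    fix z assume z: "z \<in> N"
    then have "z \<notin> cycle_image \<Gamma>" using N(3) by auto
    then show "cycle_integral \<Gamma> (\<lambda>w. (1 / (w - z)) *\<^sub>C 1 *\<^sub>C P 1) -
        cycle_integral [] (\<lambda>w. (1 / (w - z)) *\<^sub>C 1 *\<^sub>C P 1) = (2 * of_real pi * \<i>) *\<^sub>C P 1"
      using cycle_integral_cauchy_formula[OF cauchy_domain_UNIV \<Gamma>', of "\<lambda>_. 1" z "P 1"] N(4) z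
      by (auto simp: cycle_integral_def)
  qed auto
  then show ?thesis by (simp add: cycle_integral_def scaleC_one)
qed

end

section \<open>Exponentials and convolution\<close>

definition cycle_in :: "(real \<Rightarrow> complex) list \<Rightarrow> complex set \<Rightarrow> bool" where
  "cycle_in \<Gamma> S \<longleftrightarrow> (\<forall>\<gamma>\<in>set \<Gamma>. valid_path \<gamma> \<and> path_image \<gamma> \<subseteq> S)"

lemma cycle_in_mono: "cycle_in \<Gamma> S \<Longrightarrow> S \<subseteq> T \<Longrightarrow> cycle_in \<Gamma> T"
  by (auto simp: cycle_in_def)

lemma cycle_integral_Nil [simp]: "cycle_integral [] F = 0"
  by (simp add: cycle_integral_def)

lemma cycle_integral_append: "cycle_integral (\<Gamma> @ \<Gamma>') F = cycle_integral \<Gamma> F + cycle_integral \<Gamma>' F"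
  by (simp add: cycle_integral_def)

lemma cycle_integral_linear:
  fixes T :: "'b::complex_banach \<Rightarrow> 'b"
  assumes "open S" "cycle_in \<Gamma> S" "C1_holo F S" "bounded_linear T" "\<And>c x. T (c *\<^sub>C x) = c *\<^sub>C T x"
  shows "cycle_integral \<Gamma> (\<lambda>w. T (F w)) = T (cycle_integral \<Gamma> F)"
proof -
  obtain L where L: "segs_in L S" "\<And>F::complex \<Rightarrow> 'b. C1_holo F S \<Longrightarrow> cycle_integral \<Gamma> F = poly_int L F"
    using cycle_integral_eq_poly_int[OF assms(1)] assms(2) unfolding cycle_in_def by metis
  then show ?thesis
    using poly_int_linear[OF L(1) C1_holo_continuous_on[OF assms(3)] assms(4,5)]
      C1_holo_linear[OF assms(3-5)] assms(3) by simp
qed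

lemma cycle_integral_add:
  fixes F G :: "complex \<Rightarrow> 'b::complex_banach"
  assumes "open S" "cycle_in \<Gamma> S" "C1_holo F S" "C1_holo G S"
  shows "cycle_integral \<Gamma> (\<lambda>w. F w + G w) = cycle_integral \<Gamma> F + cycle_integral \<Gamma> G"
proof -
  obtain L where L: "segs_in L S" "\<And>F::complex \<Rightarrow> 'b. C1_holo F S \<Longrightarrow> cycle_integral \<Gamma> F = poly_int L F"
    using cycle_integral_eq_poly_int[OF assms(1)] assms(2) unfolding cycle_in_def by metis
  then show ?thesis
    using poly_int_add[OF L(1) C1_holo_continuous_on[OF assms(3)] C1_holo_continuous_on[OF assms(4)]]
      C1_holo_add[OF assms(3,4)] assms(3,4) by simp
qed

lemma cycle_integral_cong:
  assumes "cycle_in \<Gamma> S" "\<And>w. w \<in> S \<Longrightarrow> F w = G w"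
  shows "cycle_integral \<Gamma> F = cycle_integral \<Gamma> G"
  unfolding cycle_integral_def
proof (intro arg_cong[of _ _ sum_list] map_cong refl integral_cong)
  fix \<gamma> and s :: real assume "\<gamma> \<in> set \<Gamma>" "s \<in> {0..1}"
  then have "\<gamma> s \<in> S" using assms(1) by (force simp: cycle_in_def path_image_def)
  then show "vector_derivative \<gamma> (at s within {0..1}) *\<^sub>C F (\<gamma> s) =
      vector_derivative \<gamma> (at s within {0..1}) *\<^sub>C G (\<gamma> s)"
    by (simp add: assms(2))
qed

section \<open>Exponential integrals over cycles\<close>

lemma C1_holo_exp: "open S \<Longrightarrow> C1_holo F S \<Longrightarrow> C1_holo (\<lambda>w. exp (w * c) *\<^sub>C F w) S"
  by (intro C1_holo_scale holomorphic_intros)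

lemma cycle_integral_exp_deriv:
  fixes F :: "complex \<Rightarrow> 'b::complex_banach"
  assumes S: "open S" "cycle_in \<Gamma> S" "C1_holo F S"
  shows "((\<lambda>t. cycle_integral \<Gamma> (\<lambda>w. exp (w * of_real t) *\<^sub>C F w)) has_vector_derivative
    cycle_integral \<Gamma> (\<lambda>w. exp (w * of_real t) *\<^sub>C w *\<^sub>C F w)) (at t)"
proof -
  obtain L where L: "segs_in L S" "\<And>F::complex \<Rightarrow> 'b. C1_holo F S \<Longrightarrow> cycle_integral \<Gamma> F = poly_int L F"
    using cycle_integral_eq_poly_int[OF S(1)] S(2) unfolding cycle_in_def by metis
  have hol: "C1_holo (\<lambda>w. exp (w * c) *\<^sub>C F w) S" "C1_holo (\<lambda>w. exp (w * c) *\<^sub>C w *\<^sub>C F w) S" for c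
    by (intro C1_holo_exp C1_holo_scale S holomorphic_intros)+
  have kc: "continuous_on (UNIV \<times> S) (\<lambda>(z, w). w * exp (w * z))"
    unfolding split_beta by (intro continuous_intros)
  \<comment> \<open>The time is differentiated as a complex variable first; restricting to real t is
    the chain rule with \<open>of_real\<close>.\<close>
  have "((\<lambda>z. poly_int L (\<lambda>w. exp (w * z) *\<^sub>C F w)) has_derivative
      (\<lambda>h. h *\<^sub>C poly_int L (\<lambda>w. (w * exp (w * z)) *\<^sub>C F w))) (at z)" for z
  proof (rule poly_int_leibniz[where k = "\<lambda>z w. exp (w * z)",
        OF L(1) C1_holo_continuous_on[OF S(3)] _ kc _ open_UNIV UNIV_I])
    show "((\<lambda>z. exp (w * z)) has_field_derivative w * exp (w * z)) (at z)" for z w :: complex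
      by (auto intro!: derivative_eq_intros)
  qed (intro continuous_intros)
  from has_derivative_compose_scaleC[where g = of_real, OF this
      bounded_linear_imp_has_derivative[OF bounded_linear_of_real], of t UNIV]
  have "((\<lambda>t. poly_int L (\<lambda>w. exp (w * of_real t) *\<^sub>C F w)) has_vector_derivative
    poly_int L (\<lambda>w. (w * exp (w * of_real t)) *\<^sub>C F w)) (at t)"
    by (simp add: has_vector_derivative_def scaleR_scaleC)
  then show ?thesis
    unfolding L(2)[OF hol(1)] L(2)[OF hol(2)] by (simp add: scaleC_scaleC mult.commute)
qed

text \<open>The estimate is made on the polygon that replaces the cycle: it is compact and lies in
  an open half-plane, so the exponential decays uniformly on it. The factor \<open>\<sigma>\<close>,
  taken as 1 or -1, lets one statement serve both half-planes.\<close>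

lemma cycle_integral_exp_tendsto_0:
  fixes F :: "complex \<Rightarrow> 'b::complex_banach"
  assumes S: "open S" "cycle_in \<Gamma> S" "C1_holo F S" and \<sigma>: "\<And>w. w \<in> S \<Longrightarrow> \<sigma> * Re w < 0"
  shows "((\<lambda>t. cycle_integral \<Gamma> (\<lambda>w. exp (w * of_real (\<sigma> * t)) *\<^sub>C F w)) \<longlongrightarrow> 0) at_top"
proof -
  obtain L where L: "segs_in L S" "\<And>F::complex \<Rightarrow> 'b. C1_holo F S \<Longrightarrow> cycle_integral \<Gamma> F = poly_int L F"
    using cycle_integral_eq_poly_int[OF S(1)] S(2) unfolding cycle_in_def by metis
  define J where "J = (\<Union>(a, b)\<in>set L. closed_segment a b)"
  have J: "compact J" "segs_in L J" "J \<subseteq> S"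
    using L(1) unfolding J_def segs_in_def by (auto intro!: compact_UN)
  have Fc: "continuous_on J F"
    using continuous_on_subset[OF C1_holo_continuous_on[OF S(3)] J(3)] .
  obtain \<delta> M where \<delta>: "\<delta> > 0" "\<And>w. w \<in> J \<Longrightarrow> \<sigma> * Re w \<le> - \<delta>" and M: "\<And>w. w \<in> J \<Longrightarrow> norm (F w) \<le> M"
  proof (cases "J = {}")
    case True
    then show ?thesis by (intro that[of 1 0]) auto
  next
    case False
    have "continuous_on J (\<lambda>w. \<sigma> * Re w)" by (intro continuous_intros)
    then obtain u where u: "u \<in> J" "\<And>w. w \<in> J \<Longrightarrow> \<sigma> * Re w \<le> \<sigma> * Re u"
      using continuous_attains_sup[OF J(1) False, of "\<lambda>w. \<sigma> * Re w"] by blast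
    obtain v where v: "\<And>w. w \<in> J \<Longrightarrow> norm (F w) \<le> norm (F v)"
      using continuous_attains_sup[OF J(1) False continuous_on_norm[OF Fc]] by blast
    show ?thesis
      using u \<sigma>[of u] J(3) v by (intro that[of "- (\<sigma> * Re u)" "norm (F v)"]) auto
  qed
  let ?c = "\<Sum>(a, b)\<leftarrow>L. norm (b - a)"
  have le: "norm (cycle_integral \<Gamma> (\<lambda>w. exp (w * of_real (\<sigma> * t)) *\<^sub>C F w)) \<le> ?c * (exp (- \<delta> * t) * M)"
    if t: "t \<ge> 0" for t
    unfolding L(2)[OF C1_holo_exp[OF S(1,3)]]
  proof (rule norm_poly_int_le[OF J(2)])
    show "continuous_on J (\<lambda>w. exp (w * of_real (\<sigma> * t)) *\<^sub>C F w)"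
      by (intro continuous_intros Fc)
    fix w assume w: "w \<in> J"
    have "\<sigma> * Re w * t \<le> - \<delta> * t" by (intro mult_right_mono \<delta>(2) w t)
    then have "norm (exp (w * of_real (\<sigma> * t))) \<le> exp (- \<delta> * t)"
      by (simp add: mult_ac)
    then show "norm (exp (w * of_real (\<sigma> * t)) *\<^sub>C F w) \<le> exp (- \<delta> * t) * M"
      unfolding norm_scaleC by (intro mult_mono M w) auto
  qed
  have "((\<lambda>t. exp (- \<delta> * t)) \<longlongrightarrow> 0) at_top"
  proof (rule filterlim_compose[OF exp_at_bot])
    show "filterlim (\<lambda>t. - \<delta> * t) at_bot at_top"
      using \<delta>(1) filterlim_tendsto_pos_mult_at_top[OF tendsto_const \<delta>(1) filterlim_ident]
      by (simp add: filterlim_uminus_at_bot)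
  qed
  then have "((\<lambda>t. ?c * (exp (- \<delta> * t) * M)) \<longlongrightarrow> 0) at_top"
    using tendsto_mult_left[OF tendsto_mult_right[of _ 0 _ M], of _ _ ?c] by fastforce
  moreover have "\<forall>\<^sub>F t in at_top. norm (cycle_integral \<Gamma> (\<lambda>w. exp (w * of_real (\<sigma> * t)) *\<^sub>C F w))
      \<le> ?c * (exp (- \<delta> * t) * M)"
    using eventually_ge_at_top[of 0] by eventually_elim (rule le)
  ultimately show ?thesis by (rule Lim_null_comparison[rotated])
qed

lemma cycle_integral_exp_const:
  fixes P :: "'b::complex_banach"
  assumes "cycle_in \<Gamma> UNIV" "\<forall>\<gamma>\<in>set \<Gamma>. pathfinish \<gamma> = pathstart \<gamma>"
  shows "cycle_integral \<Gamma> (\<lambda>w. exp (w * c) *\<^sub>C P) = 0"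
proof -
  have "cycle_integral \<Gamma> (\<lambda>w. exp (w * c) *\<^sub>C P) = (\<Sum>\<gamma>\<leftarrow>\<Gamma>. 0) *\<^sub>C P"
  proof (rule cycle_integral_scalar)
    fix \<gamma> assume "\<gamma> \<in> set \<Gamma>"
    then show "((\<lambda>w. exp (w * c)) has_contour_integral 0) \<gamma>"
      using assms unfolding cycle_in_def
      by (intro Cauchy_theorem_convex_simple[of _ UNIV] holomorphic_intros) auto
  qed
  then show ?thesis by (simp add: scaleC_zero_left)
qed

lemma has_integral_UNIV_limit:
  fixes f :: "real \<Rightarrow> 'b::banach"
  assumes int: "\<And>a b. a \<le> b \<Longrightarrow> (f has_integral W b - W a) {a..b}"
    and top: "(W \<longlongrightarrow> v) at_top" and bot: "(W \<longlongrightarrow> 0) at_bot"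
  shows "(f has_integral v) UNIV"
proof -
  have nb: "\<not> (\<exists>a b. (UNIV :: real set) = cbox a b)"
  proof clarify
    fix a b :: real assume "UNIV = cbox a b"
    then have "b + 1 \<in> cbox a b" using UNIV_I[of "b + 1"] by (simp only:)
    then show False by simp
  qed
  show ?thesis
  proof (rule iffD2[OF has_integral_alt[of f v UNIV, unfolded if_not_P[OF nb]]], intro allI impI)
    fix e :: real assume e: "e > 0"
    obtain B1 where B1: "\<And>b. b \<ge> B1 \<Longrightarrow> dist (W b) v < e / 2"
      using tendstoD[OF top, of "e / 2"] e unfolding eventually_at_top_linorder by auto
    obtain B2 where B2: "\<And>a. a \<le> B2 \<Longrightarrow> dist (W a) 0 < e / 2"
      using tendstoD[OF bot, of "e / 2"] e unfolding eventually_at_bot_linorder by auto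
    \<comment> \<open>An interval containing the ball of radius \<open>B\<close> ends beyond
      \<open>B1\<close> and begins before \<open>B2\<close>; the 1 makes \<open>B\<close>
      positive.\<close>
    define B where "B = max 1 (max B1 (- B2))"
    show "\<exists>B>0. \<forall>a b. ball 0 B \<subseteq> cbox a b \<longrightarrow>
      (\<exists>z. ((\<lambda>x. if x \<in> UNIV then f x else 0) has_integral z) (cbox a b) \<and> norm (z - v) < e)"
    proof (intro exI[of _ B] conjI allI impI)
      show "B > 0" by (simp add: B_def)
      fix a b :: real assume "ball 0 B \<subseteq> cbox a b"
      then have "{-B<..<B} \<subseteq> {a..b}" by (auto simp: ball_eq_greaterThanLessThan)
      with \<open>B > 0\<close> have ab: "a \<le> - B" "B \<le> b"
        by (auto simp: greaterThanLessThan_subseteq_atLeastAtMost_iff)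
      then have "norm (W b - v) < e / 2" "norm (W a) < e / 2"
        using B1[of b] B2[of a] by (auto simp: B_def dist_norm)
      then have "norm (W b - W a - v) < e"
        using norm_triangle_ineq4[of "W b - v" "W a"] by (simp add: algebra_simps)
      then show "\<exists>z. ((\<lambda>x. if x \<in> UNIV then f x else 0) has_integral z) (cbox a b) \<and> norm (z - v) < e"
        using int[of a b] ab \<open>B > 0\<close> by (intro exI[of _ "W b - W a"]) auto
    qed
  qed
qed

text \<open>Lets the outer factors of an integrand be applied after the inner integrations.
  \<open>F'\<close> and \<open>T\<close> applied to \<open>F\<close> are compared at fixed outer
  coordinates, because these factors depend on the outer coordinates.\<close>

lemma has_iterated_integral_linear:
  assumes "bounded_linear T" "has_iterated_integral L F r s v"
    and "\<And>s'. (\<And>j. j > r \<Longrightarrow> s' j = s j) \<Longrightarrow> F' s' = T (F s')"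
  shows "has_iterated_integral L F' r s (T v)"
  using assms(2,3)
proof (induction r arbitrary: s v)
  case (Suc r)
  obtain G where G: "\<And>u. u \<in> L (Suc r) s \<Longrightarrow> has_iterated_integral L F r (s(Suc r := u)) (G u)"
    "(G has_integral v) (L (Suc r) s)"
    using Suc.prems(1) unfolding has_iterated_integral.simps by blast
  have "has_iterated_integral L F' r (s(Suc r := u)) (T (G u))" if "u \<in> L (Suc r) s" for u
    by (rule Suc.IH[OF G(1)[OF that]]) (auto intro: Suc.prems(2))
  moreover have "((\<lambda>u. T (G u)) has_integral T v) (L (Suc r) s)"
    using has_integral_linear[OF G(2) assms(1)] by (simp add: o_def)
  ultimately show ?case
    unfolding has_iterated_integral.simps by (intro exI[of _ "\<lambda>u. T (G u)"]) simp
qed auto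

section \<open>The convolution identity for a pair of cycles\<close>

lemma has_vector_derivative_scaleC:
  "(f has_vector_derivative f') F \<Longrightarrow>
    ((\<lambda>t. c *\<^sub>C f t) has_vector_derivative (c *\<^sub>C f' :: 'b::complex_banach)) F"
  by (rule bounded_linear.has_vector_derivative[OF scaleC.bounded_linear_right])

text \<open>The letters p and n stand for positive and negative real part, as in the formula for g;
  for the pure exponentials one list is empty. Surrounding is taken in \<open>UNIV\<close> because
  the integrands here are entire exponentials times resolvent products.\<close>

locale two_contours = resolvent_chain +
  fixes \<Gamma>p \<Gamma>n :: "(real \<Rightarrow> complex) list"
  assumes surr: "surrounds (\<Gamma>p @ \<Gamma>n) UNIV K"
begin

definition E :: "(real \<Rightarrow> complex) list \<Rightarrow> nat \<Rightarrow> real \<Rightarrow> 'a \<Rightarrow>\<^sub>L 'a" where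
  "E \<Gamma> p t = (1 / (2 * of_real pi * \<i>)) *\<^sub>C cycle_integral \<Gamma> (\<lambda>w. exp (w * of_real t) *\<^sub>C \<Phi> p w)"

definition H :: "(real \<Rightarrow> complex) list \<Rightarrow> nat \<Rightarrow> real \<Rightarrow> 'a \<Rightarrow>\<^sub>L 'a" where
  "H \<Gamma> k t = (1 / (2 * of_real pi * \<i>)) *\<^sub>C cycle_integral \<Gamma> (\<lambda>w. exp (w * of_real t) *\<^sub>C R k w)"

lemma E_Nil [simp]: "E [] p t = 0" and H_Nil [simp]: "H [] k t = 0"
  by (simp_all add: E_def H_def scaleC.zero_right)

lemma E_0: "E \<Gamma> 0 t = H \<Gamma> 1 t"
  by (simp add: E_def H_def \<Phi>_0)

lemma cycles:
  assumes "\<Gamma> \<in> {\<Gamma>p, \<Gamma>n}"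
  shows "cycle_in \<Gamma> (- K)" "\<forall>\<gamma>\<in>set \<Gamma>. pathfinish \<gamma> = pathstart \<gamma>"
  using surr assms unfolding surrounds_def cycle_in_def by auto

lemma E_P:
  assumes "\<Gamma> \<in> {\<Gamma>p, \<Gamma>n}" "p < m"
  shows "E \<Gamma> p t o\<^sub>L P (p + 1) = E \<Gamma> p t"
proof -
  have "cycle_integral \<Gamma> (\<lambda>w. exp (w * of_real t) *\<^sub>C \<Phi> p w) o\<^sub>L P (p + 1) =
      cycle_integral \<Gamma> (\<lambda>w. (exp (w * of_real t) *\<^sub>C \<Phi> p w) o\<^sub>L P (p + 1))"
    using C1_holo_exp[OF open_K C1_holo_\<Phi>[OF assms(2)]]
    by (intro cycle_integral_linear[OF open_K cycles(1)[OF assms(1)] _ bounded_linear_comp_left, symmetric])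
      auto
  also have "\<dots> = cycle_integral \<Gamma> (\<lambda>w. exp (w * of_real t) *\<^sub>C \<Phi> p w)"
    using \<Phi>_P[OF assms(2)] by (intro cycle_integral_cong[OF cycles(1)[OF assms(1)]]) simp
  finally show ?thesis by (simp add: E_def)
qed

lemma E_deriv:
  assumes \<Gamma>: "\<Gamma> \<in> {\<Gamma>p, \<Gamma>n}" and p: "Suc p < m"
  shows "(E \<Gamma> (Suc p) has_vector_derivative (E \<Gamma> p t o\<^sub>L A (\<iota> (p + 1)) (\<iota> (p + 2))) +
      (E \<Gamma> (Suc p) t o\<^sub>L A (\<iota> (p + 2)) (\<iota> (p + 2)))) (at t)"
proof -
  note cyc = cycles(1)[OF \<Gamma>]
  have k: "p + 2 \<in> {1..m}" and p': "p < m" using p by auto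
  let ?C = "A (\<iota> (p + 1)) (\<iota> (p + 2))" and ?B = "A (\<iota> (p + 2)) (\<iota> (p + 2))"
  have eq: "exp (w * of_real t) *\<^sub>C w *\<^sub>C \<Phi> (Suc p) w =
      ((exp (w * of_real t) *\<^sub>C \<Phi> p w) o\<^sub>L ?C) + ((exp (w * of_real t) *\<^sub>C \<Phi> (Suc p) w) o\<^sub>L ?B)"
    if "w \<in> - K" for w
  proof -
    have w: "w \<notin> K" using that by simp
    have cl: "clin (\<Phi> p w o\<^sub>L ?C)" using clin_\<Phi>[OF p' w] off(1)[OF p] clin_comp by blast
    have "w *\<^sub>C \<Phi> (Suc p) w = (\<Phi> p w o\<^sub>L ?C) o\<^sub>L (w *\<^sub>C R (p + 2) w)"
      by (simp only: \<Phi>_Suc scaleC_comp_right[OF cl])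
    also have "\<dots> = (\<Phi> p w o\<^sub>L (?C o\<^sub>L P (p + 2))) + (((\<Phi> p w o\<^sub>L ?C) o\<^sub>L R (p + 2) w) o\<^sub>L ?B)"
      by (simp only: R_props(5)[OF k w] blinfun_comp.add_right blinfun_comp_assoc)
    also have "\<dots> = (\<Phi> p w o\<^sub>L ?C) + (\<Phi> (Suc p) w o\<^sub>L ?B)"
      by (simp only: off(2)[OF p] \<Phi>_Suc)
    finally show ?thesis by (simp add: scaleC_add_right)
  qed
  have h: "C1_holo (\<lambda>w. exp (w * of_real t) *\<^sub>C \<Phi> q w) (- K)" if "q < m" for q
    by (rule C1_holo_exp[OF open_K C1_holo_\<Phi>[OF that]])
  have hc: "C1_holo (\<lambda>w. (exp (w * of_real t) *\<^sub>C \<Phi> q w) o\<^sub>L Y) (- K)" if "q < m" for q Y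
    by (rule C1_holo_linear[OF h[OF that] bounded_linear_comp_left]) simp
  have "cycle_integral \<Gamma> (\<lambda>w. exp (w * of_real t) *\<^sub>C w *\<^sub>C \<Phi> (Suc p) w) =
      cycle_integral \<Gamma> (\<lambda>w. ((exp (w * of_real t) *\<^sub>C \<Phi> p w) o\<^sub>L ?C) +
        ((exp (w * of_real t) *\<^sub>C \<Phi> (Suc p) w) o\<^sub>L ?B))"
    by (rule cycle_integral_cong[OF cyc eq])
  also have "\<dots> = cycle_integral \<Gamma> (\<lambda>w. (exp (w * of_real t) *\<^sub>C \<Phi> p w) o\<^sub>L ?C) +
      cycle_integral \<Gamma> (\<lambda>w. (exp (w * of_real t) *\<^sub>C \<Phi> (Suc p) w) o\<^sub>L ?B)"
    by (rule cycle_integral_add[OF open_K cyc hc[OF p'] hc[OF p]])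
  also have "cycle_integral \<Gamma> (\<lambda>w. (exp (w * of_real t) *\<^sub>C \<Phi> p w) o\<^sub>L ?C) =
      cycle_integral \<Gamma> (\<lambda>w. exp (w * of_real t) *\<^sub>C \<Phi> p w) o\<^sub>L ?C"
    by (rule cycle_integral_linear[OF open_K cyc h[OF p'] bounded_linear_comp_left]) simp
  also have "cycle_integral \<Gamma> (\<lambda>w. (exp (w * of_real t) *\<^sub>C \<Phi> (Suc p) w) o\<^sub>L ?B) =
      cycle_integral \<Gamma> (\<lambda>w. exp (w * of_real t) *\<^sub>C \<Phi> (Suc p) w) o\<^sub>L ?B"
    by (rule cycle_integral_linear[OF open_K cyc h[OF p] bounded_linear_comp_left]) simp
  finally have "cycle_integral \<Gamma> (\<lambda>w. exp (w * of_real t) *\<^sub>C w *\<^sub>C \<Phi> (Suc p) w) =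
      (cycle_integral \<Gamma> (\<lambda>w. exp (w * of_real t) *\<^sub>C \<Phi> p w) o\<^sub>L ?C) +
      (cycle_integral \<Gamma> (\<lambda>w. exp (w * of_real t) *\<^sub>C \<Phi> (Suc p) w) o\<^sub>L ?B)" .
  then show ?thesis
    using has_vector_derivative_scaleC[OF cycle_integral_exp_deriv[OF open_K cyc C1_holo_\<Phi>[OF p]],
        of "1 / (2 * of_real pi * \<i>)" t]
    by (simp add: E_def[abs_def] scaleC_add_right)
qed

text \<open>From z R = P + B R, with the block on the left to match the right factor in
  \<open>E_deriv\<close>. The term P contributes the integral of an entire function over closed
  curves, which is 0.\<close>

lemma H_deriv:
  assumes \<Gamma>: "\<Gamma> \<in> {\<Gamma>p, \<Gamma>n}" and k: "k \<in> {1..m}"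
  shows "(H \<Gamma> k has_vector_derivative A (\<iota> k) (\<iota> k) o\<^sub>L H \<Gamma> k t) (at t)"
proof -
  note cyc = cycles(1)[OF \<Gamma>]
  let ?B = "A (\<iota> k) (\<iota> k)"
  have cl: "clin ?B" by (rule clin_diag[OF k])
  have h: "C1_holo (\<lambda>w. exp (w * of_real t) *\<^sub>C R k w) (- K)"
    by (rule C1_holo_exp[OF open_K C1_holo_R[OF k]])
  have hB: "C1_holo (\<lambda>w. ?B o\<^sub>L (exp (w * of_real t) *\<^sub>C R k w)) (- K)"
    by (rule C1_holo_linear[OF h bounded_linear_comp_right scaleC_comp_right[OF cl]])
  have eq: "exp (w * of_real t) *\<^sub>C w *\<^sub>C R k w =
      (exp (w * of_real t) *\<^sub>C P k) + (?B o\<^sub>L (exp (w * of_real t) *\<^sub>C R k w))"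
    if "w \<in> - K" for w
    using that R_props(4)[OF k, of w] by (simp add: scaleC_add_right scaleC_comp_right[OF cl])
  have "cycle_integral \<Gamma> (\<lambda>w. exp (w * of_real t) *\<^sub>C w *\<^sub>C R k w) =
      cycle_integral \<Gamma> (\<lambda>w. (exp (w * of_real t) *\<^sub>C P k) + (?B o\<^sub>L (exp (w * of_real t) *\<^sub>C R k w)))"
    by (rule cycle_integral_cong[OF cyc eq])
  also have "\<dots> = cycle_integral \<Gamma> (\<lambda>w. exp (w * of_real t) *\<^sub>C P k) +
      cycle_integral \<Gamma> (\<lambda>w. ?B o\<^sub>L (exp (w * of_real t) *\<^sub>C R k w))"
    by (rule cycle_integral_add[OF open_K cyc C1_holo_exp[OF open_K C1_holo_const] hB])
  also have "cycle_integral \<Gamma> (\<lambda>w. exp (w * of_real t) *\<^sub>C P k) = 0"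
    by (rule cycle_integral_exp_const[OF cycle_in_mono[OF cyc] cycles(2)[OF \<Gamma>]]) simp
  also have "cycle_integral \<Gamma> (\<lambda>w. ?B o\<^sub>L (exp (w * of_real t) *\<^sub>C R k w)) =
      ?B o\<^sub>L cycle_integral \<Gamma> (\<lambda>w. exp (w * of_real t) *\<^sub>C R k w)"
    by (rule cycle_integral_linear[OF open_K cyc h bounded_linear_comp_right scaleC_comp_right[OF cl]])
  finally have "cycle_integral \<Gamma> (\<lambda>w. exp (w * of_real t) *\<^sub>C w *\<^sub>C R k w) =
      ?B o\<^sub>L cycle_integral \<Gamma> (\<lambda>w. exp (w * of_real t) *\<^sub>C R k w)" by simp
  then show ?thesis
    using has_vector_derivative_scaleC[OF cycle_integral_exp_deriv[OF open_K cyc C1_holo_R[OF k]],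
        of "1 / (2 * of_real pi * \<i>)" t]
    by (simp add: H_def[abs_def] scaleC_comp_right[OF cl])
qed

lemma E_sum: "Suc p < m \<Longrightarrow> E \<Gamma>p (Suc p) 0 + E \<Gamma>n (Suc p) 0 = 0"
  using cycle_integral_\<Phi>[OF surr, of "Suc p"]
  by (simp add: E_def scaleC_one cycle_integral_append flip: scaleC_add_right)
    (simp add: scaleC.zero_right)

text \<open>Block \<open>k\<close> alone is a chain of length one, so
  \<open>cycle_integral_\<Phi>\<close> applies with p = 0 and returns its unit.\<close>

lemma H_sum:
  assumes k: "k \<in> {1..m}"
  shows "H \<Gamma>p k 0 + H \<Gamma>n k 0 = P k"
proof -
  interpret k: resolvent_chain A "\<lambda>_. \<iota> k" 1 "\<lambda>_. V k" "\<lambda>_. P k" K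
    by (rule resolvent_chain.intro) (use corner[OF k] diag[OF k] spec[OF k] K in auto)
  have "k.\<Phi> 0 = R k"
    by (simp add: k.\<Phi>_0 k.R_def R_def)
  then have "cycle_integral (\<Gamma>p @ \<Gamma>n) (R k) = (2 * of_real pi * \<i>) *\<^sub>C P k"
    using k.cycle_integral_\<Phi>[OF surr, of 0] by simp
  then show ?thesis
    by (simp add: H_def scaleC_one cycle_integral_append scaleC_scaleC flip: scaleC_add_right)
qed

lemma E_continuous: "\<Gamma> \<in> {\<Gamma>p, \<Gamma>n} \<Longrightarrow> Suc p < m \<Longrightarrow> continuous_on S (E \<Gamma> (Suc p))"
  using E_deriv by (meson has_vector_derivative_continuous continuous_at_imp_continuous_on)

lemma H_continuous: "\<Gamma> \<in> {\<Gamma>p, \<Gamma>n} \<Longrightarrow> k \<in> {1..m} \<Longrightarrow> continuous_on S (H \<Gamma> k)"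
  using H_deriv by (meson has_vector_derivative_continuous continuous_at_imp_continuous_on)

text \<open>The divided difference of order \<open>p\<close>, completed at \<open>t = 0\<close> by its common one-sided limit if
  \<open>p > 0\<close> and by the dummy value \<open>0\<close> of \<open>fun_calc\<close> if \<open>p = 0\<close>.\<close>

definition Dd :: "nat \<Rightarrow> real \<Rightarrow> 'a \<Rightarrow>\<^sub>L 'a" where
  "Dd p t = (if p = 0 \<and> t = 0 then 0 else if t \<le> 0 then - E \<Gamma>p p t else E \<Gamma>n p t)"

text \<open>This is the functional calculus of block \<open>k\<close>, with the dummy value 0 at t =
  0 included; \<open>hf 1\<close> coincides with \<open>Dd 0\<close>.\<close>

definition hf :: "nat \<Rightarrow> real \<Rightarrow> 'a \<Rightarrow>\<^sub>L 'a" where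
  "hf k t = (if t < 0 then - H \<Gamma>p k t else if t > 0 then H \<Gamma>n k t else 0)"

text \<open>An antiderivative of \<open>s \<mapsto> Dd p s A hf (t - s)\<close>; the summand added for \<open>s > t\<close> compensates
  the jump of \<open>hf\<close> at \<open>0\<close>.\<close>

definition W :: "nat \<Rightarrow> real \<Rightarrow> real \<Rightarrow> 'a \<Rightarrow>\<^sub>L 'a" where
  "W p t s = (if s \<le> t then Dd (Suc p) s o\<^sub>L H \<Gamma>n (p + 2) (t - s)
     else Dd (Suc p) t - (Dd (Suc p) s o\<^sub>L H \<Gamma>p (p + 2) (t - s)))"

lemma Dd_P: "Suc p < m \<Longrightarrow> Dd (Suc p) t o\<^sub>L P (p + 2) = Dd (Suc p) t"
  using E_P[of _ "Suc p" t] by (auto simp: Dd_def blinfun_comp.minus_left)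

lemma Dd_continuous:
  assumes "Suc p < m"
  shows "continuous_on S (Dd (Suc p))"
proof -
  have "continuous_on UNIV (\<lambda>t. if t \<le> 0 then - E \<Gamma>p (Suc p) t else E \<Gamma>n (Suc p) t)"
    using E_sum[OF assms]
    by (intro continuous_on_cases_le continuous_intros E_continuous[OF _ assms])
      (auto simp: neg_eq_iff_add_eq_0)
  also have "(\<lambda>t. if t \<le> 0 then - E \<Gamma>p (Suc p) t else E \<Gamma>n (Suc p) t) = Dd (Suc p)"
    by (simp add: Dd_def fun_eq_iff)
  finally show ?thesis by (rule continuous_on_subset) simp
qed

text \<open>\<open>Dd 0\<close> has the jump \<open>P 1\<close> at 0, so \<open>Dd 1\<close> need
  not be differentiable there; 0 becomes an exceptional point of the antiderivative.\<close>

lemma Dd_deriv: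
  assumes p: "Suc p < m" and "t \<noteq> 0"
  shows "(Dd (Suc p) has_vector_derivative (Dd p t o\<^sub>L A (\<iota> (p + 1)) (\<iota> (p + 2))) +
      (Dd (Suc p) t o\<^sub>L A (\<iota> (p + 2)) (\<iota> (p + 2)))) (at t)"
proof (cases "t < 0")
  case True
  have "((\<lambda>t. - E \<Gamma>p (Suc p) t) has_vector_derivative (Dd p t o\<^sub>L A (\<iota> (p + 1)) (\<iota> (p + 2))) +
      (Dd (Suc p) t o\<^sub>L A (\<iota> (p + 2)) (\<iota> (p + 2)))) (at t)"
    using has_vector_derivative_minus[OF E_deriv[OF _ p, of \<Gamma>p t]] True
    by (simp add: Dd_def blinfun_comp.minus_left add.commute)
  then show ?thesis
    by (rule has_vector_derivative_transform_within_open[where S = "{..<0}"])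
      (use True in \<open>auto simp: Dd_def\<close>)
next
  case False
  have "(E \<Gamma>n (Suc p) has_vector_derivative (Dd p t o\<^sub>L A (\<iota> (p + 1)) (\<iota> (p + 2))) +
      (Dd (Suc p) t o\<^sub>L A (\<iota> (p + 2)) (\<iota> (p + 2)))) (at t)"
    using E_deriv[OF _ p, of \<Gamma>n t] False assms(2) by (simp add: Dd_def)
  then show ?thesis
    by (rule has_vector_derivative_transform_within_open[where S = "{0<..}"])
      (use False assms(2) in \<open>auto simp: Dd_def\<close>)
qed

lemma W_continuous:
  assumes p: "Suc p < m"
  shows "continuous_on S (W p t)"
proof -
  have k: "p + 2 \<in> {1..m}" using p by auto
  have Hc: "continuous_on S (\<lambda>s. H \<Gamma> (p + 2) (t - s))" if "\<Gamma> \<in> {\<Gamma>p, \<Gamma>n}" for \<Gamma> S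
    by (rule continuous_on_compose2[OF H_continuous[OF that k, of UNIV]])
      (intro continuous_on_diff continuous_on_const continuous_on_id subset_UNIV)+
  have "continuous_on UNIV (\<lambda>s. if s \<le> t then Dd (Suc p) s o\<^sub>L H \<Gamma>n (p + 2) (t - s)
     else Dd (Suc p) t - (Dd (Suc p) s o\<^sub>L H \<Gamma>p (p + 2) (t - s)))"
  proof (rule continuous_on_cases_le)
    fix s assume "s = t"
    \<comment> \<open>This is exactly the equality of the two branches at s = t: the values of
      \<open>H\<close> at 0 add up to the unit, which \<open>Dd\<close> absorbs.\<close>
    have "Dd (Suc p) t o\<^sub>L (H \<Gamma>p (p + 2) 0 + H \<Gamma>n (p + 2) 0) = Dd (Suc p) t"
      using Dd_P[OF p] H_sum[OF k] by simp
    then show "Dd (Suc p) s o\<^sub>L H \<Gamma>n (p + 2) (t - s) =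
        Dd (Suc p) t - (Dd (Suc p) s o\<^sub>L H \<Gamma>p (p + 2) (t - s))"
      using \<open>s = t\<close> by (simp add: blinfun_comp.add_right algebra_simps)
  qed (intro continuous_intros blinfun_comp.continuous_on Dd_continuous[OF p] Hc; simp)+
  then have "continuous_on UNIV (W p t)"
    by (simp add: W_def[abs_def])
  then show ?thesis by (rule continuous_on_subset) simp
qed

lemma W_deriv:
  assumes p: "Suc p < m" and s: "s \<noteq> 0" "s \<noteq> t"
  shows "(W p t has_vector_derivative
    (Dd p s o\<^sub>L A (\<iota> (p + 1)) (\<iota> (p + 2))) o\<^sub>L hf (p + 2) (t - s)) (at s)"
proof -
  have k: "p + 2 \<in> {1..m}" using p by auto
  let ?C = "A (\<iota> (p + 1)) (\<iota> (p + 2))" and ?B = "A (\<iota> (p + 2)) (\<iota> (p + 2))"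
  have der: "((\<lambda>s. Dd (Suc p) s o\<^sub>L H \<Gamma> (p + 2) (t - s)) has_vector_derivative
      (Dd p s o\<^sub>L ?C) o\<^sub>L H \<Gamma> (p + 2) (t - s)) (at s)" if \<Gamma>: "\<Gamma> \<in> {\<Gamma>p, \<Gamma>n}" for \<Gamma>
  proof -
    have "((\<lambda>s. H \<Gamma> (p + 2) (t - s)) has_vector_derivative
        (-1) *\<^sub>R (?B o\<^sub>L H \<Gamma> (p + 2) (t - s))) (at s)"
      by (rule vector_diff_chain_at[of "\<lambda>s. t - s", unfolded o_def, OF _ H_deriv[OF \<Gamma> k]])
        (auto intro!: derivative_eq_intros)
    \<comment> \<open>The diagonal block occurs twice, to the right of \<open>Dd\<close> and, with
      the sign from t - s, to the left of \<open>H\<close>; the two terms cancel.\<close>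
    from blinfun_comp.has_vector_derivative[OF Dd_deriv[OF p s(1)] this]
    show ?thesis
      by (rule has_vector_derivative_eq_rhs)
        (simp add: blinfun_comp.add_left blinfun_comp.minus_right blinfun_comp_assoc)
  qed
  show ?thesis
  proof (cases "s < t")
    case True
    have "((\<lambda>s. Dd (Suc p) s o\<^sub>L H \<Gamma>n (p + 2) (t - s)) has_vector_derivative
        (Dd p s o\<^sub>L ?C) o\<^sub>L hf (p + 2) (t - s)) (at s)"
      using der[of \<Gamma>n] True by (simp add: hf_def)
    then show ?thesis
      by (rule has_vector_derivative_transform_within_open[where S = "{..<t}"])
        (use True in \<open>auto simp: W_def\<close>)
  next
    case False
    have "((\<lambda>s. Dd (Suc p) t - (Dd (Suc p) s o\<^sub>L H \<Gamma>p (p + 2) (t - s))) has_vector_derivative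
        0 - ((Dd p s o\<^sub>L ?C) o\<^sub>L H \<Gamma>p (p + 2) (t - s))) (at s)"
      by (intro has_vector_derivative_diff has_vector_derivative_const der) simp
    then have "((\<lambda>s. Dd (Suc p) t - (Dd (Suc p) s o\<^sub>L H \<Gamma>p (p + 2) (t - s))) has_vector_derivative
        (Dd p s o\<^sub>L ?C) o\<^sub>L hf (p + 2) (t - s)) (at s)"
      using False s(2) by (simp add: hf_def blinfun_comp.minus_right)
    then show ?thesis
      by (rule has_vector_derivative_transform_within_open[where S = "{t<..}"])
        (use False s in \<open>auto simp: W_def\<close>)
  qed
qed

lemma W_integral:
  assumes "Suc p < m" "a \<le> b"
  shows "((\<lambda>s. (Dd p s o\<^sub>L A (\<iota> (p + 1)) (\<iota> (p + 2))) o\<^sub>L hf (p + 2) (t - s)) has_integral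
    W p t b - W p t a) {a..b}"
  \<comment> \<open>The integrand may jump at 0 and at t, but \<open>W\<close> is continuous there,
    so the two points are admissible exceptions.\<close>
  by (rule fundamental_theorem_of_calculus_interior_strong[of "{0, t}"])
    (use W_deriv W_continuous assms in auto)

text \<open>The outermost variable u is integrated last: the inner integrals give
  \<open>Dd p u\<close> times factors determined by u and t, and \<open>conv\<close> performs the
  remaining integration. At order p the coordinate p + 1 plays the role of t. \<open>T\<close> must
  contain the ranges of its own members, so that the induction can continue with u.\<close>

lemma iterated_convolution:
  assumes conv: "\<And>p t. Suc p < m \<Longrightarrow> t \<in> T \<Longrightarrow>
      ((\<lambda>s. (Dd p s o\<^sub>L A (\<iota> (p + 1)) (\<iota> (p + 2))) o\<^sub>L hf (p + 2) (t - s)) has_integral Dd (Suc p) t) (L t)"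
    and L: "\<And>t. t \<in> T \<Longrightarrow> L t \<subseteq> T"
    and "p < m" "s 0 = 0" "s (p + 1) \<in> T"
  shows "has_iterated_integral (\<lambda>k s. L (s (k + 1)))
    (\<lambda>s. alt_prod A \<iota> (\<lambda>k. hf k (s k - s (k - 1))) p) p s (Dd p (s (p + 1)))"
  using assms(3-)
proof (induction p arbitrary: s)
  case 0
  then show ?case by (auto simp: Dd_def hf_def E_0)
next
  case (Suc p)
  let ?t = "s (p + 2)"
  let ?G = "\<lambda>u. (Dd p u o\<^sub>L A (\<iota> (p + 1)) (\<iota> (p + 2))) o\<^sub>L hf (p + 2) (?t - u)"
  have t: "?t \<in> T" using Suc.prems by simp
  have "has_iterated_integral (\<lambda>k s. L (s (k + 1)))
      (\<lambda>s. alt_prod A \<iota> (\<lambda>k. hf k (s k - s (k - 1))) (Suc p)) p (s(Suc p := u)) (?G u)"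
    if u: "u \<in> L ?t" for u
  proof (rule has_iterated_integral_linear[where v = "Dd p u" and
        T = "\<lambda>X. (X o\<^sub>L A (\<iota> (p + 1)) (\<iota> (p + 2))) o\<^sub>L hf (p + 2) (?t - u)"])
    show "bounded_linear (\<lambda>X. (X o\<^sub>L A (\<iota> (p + 1)) (\<iota> (p + 2))) o\<^sub>L hf (p + 2) (?t - u))"
      by (intro bounded_linear_compose[OF bounded_linear_comp_left] bounded_linear_comp_left)
    show "has_iterated_integral (\<lambda>k s. L (s (k + 1)))
        (\<lambda>s. alt_prod A \<iota> (\<lambda>k. hf k (s k - s (k - 1))) p) p (s(Suc p := u)) (Dd p u)"
    proof -
      have "u \<in> T" using L[OF t] u by auto
      then show ?thesis
        using Suc.IH[of "s(Suc p := u)"] Suc.prems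
        by (simp del: fun_upd_apply add: fun_upd_same fun_upd_other)
    qed
    show "alt_prod A \<iota> (\<lambda>k. hf k (s' k - s' (k - 1))) (Suc p) =
        (alt_prod A \<iota> (\<lambda>k. hf k (s' k - s' (k - 1))) p o\<^sub>L A (\<iota> (p + 1)) (\<iota> (p + 2))) o\<^sub>L
          hf (p + 2) (?t - u)" if "\<And>j. j > p \<Longrightarrow> s' j = (s(Suc p := u)) j" for s'
      using that[of "p + 2"] that[of "p + 1"] by simp
  qed
  moreover have "(?G has_integral Dd (Suc p) ?t) (L ?t)"
    using conv[OF Suc.prems(1) t] .
  ultimately show ?case
    unfolding has_iterated_integral.simps by (intro exI[of _ ?G]) simp
qed

end

section \<open>Block operators\<close>

lemma Baire_UNIV_interior:
  fixes C :: "nat \<Rightarrow> 'a::complete_space set"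
  assumes "\<And>k. closed (C k)" "(\<Union>k. C k) = UNIV"
  shows "\<exists>k. interior (C k) \<noteq> {}"
proof (rule ccontr)
  assume "\<not> ?thesis"
  then have "Met_TC.mtopology interior_of \<Union>(range C) = {}"
    using assms(1)
    by (intro Met_TC.metric_Baire_category_alt) (auto simp: complete_UNIV)
  then show False using assms(2) by simp
qed

section \<open>Coordinates in a direct sum and boundedness of the projections\<close>

locale decomposition =
  fixes n :: nat and X :: "nat \<Rightarrow> 'a::complex_banach set"
  assumes decomp: "direct_sum_decomp n X"
begin

definition coord :: "'a \<Rightarrow> nat \<Rightarrow> 'a" where
  "coord x = (THE c. c \<in> Pi\<^sub>E {1..n} X \<and> x = (\<Sum>i=1..n. c i))"

lemma coord: "coord x \<in> Pi\<^sub>E {1..n} X" "(\<Sum>i=1..n. coord x i) = x"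
proof -
  have "\<exists>!c. c \<in> Pi\<^sub>E {1..n} X \<and> x = (\<Sum>i=1..n. c i)"
    using decomp unfolding direct_sum_decomp_def by blast
  from theI'[OF this] show "coord x \<in> Pi\<^sub>E {1..n} X" "(\<Sum>i=1..n. coord x i) = x"
    unfolding coord_def by auto
qed

lemma coord_unique:
  assumes "\<And>i. i \<in> {1..n} \<Longrightarrow> c i \<in> X i" "(\<Sum>i=1..n. c i) = x" "i \<in> {1..n}"
  shows "coord x i = c i"
proof -
  have ex1: "\<exists>!c. c \<in> Pi\<^sub>E {1..n} X \<and> x = (\<Sum>i=1..n. c i)"
    using decomp unfolding direct_sum_decomp_def by blast
  let ?c = "restrict c {1..n}"
  have "?c \<in> Pi\<^sub>E {1..n} X" using assms(1) by auto
  moreover have "x = (\<Sum>i=1..n. ?c i)" using assms(2) by simp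
  ultimately have "coord x = ?c" using ex1 coord[of x] by metis
  then show ?thesis using assms(3) by simp
qed

lemma X:
  assumes "i \<in> {1..n}"
  shows "0 \<in> X i" "x \<in> X i \<Longrightarrow> y \<in> X i \<Longrightarrow> x + y \<in> X i" "x \<in> X i \<Longrightarrow> z *\<^sub>C x \<in> X i" "closed (X i)"
  using decomp assms unfolding direct_sum_decomp_def csubspace_def by auto

lemma X_sum:
  assumes "i \<in> {1..n}" "\<And>k. k \<in> F \<Longrightarrow> f k \<in> X i"
  shows "(\<Sum>k\<in>F. f k) \<in> X i"
  using assms(2) by (induction F rule: infinite_finite_induct) (auto intro: X[OF assms(1)])

lemma coord_in: "i \<in> {1..n} \<Longrightarrow> coord x i \<in> X i"
  using coord(1)[of x] by auto

lemma coord_add: "i \<in> {1..n} \<Longrightarrow> coord (x + y) i = coord x i + coord y i"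
  by (rule coord_unique) (auto simp: sum.distrib coord X coord_in simp del: One_nat_def)

lemma coord_scaleC: "i \<in> {1..n} \<Longrightarrow> coord (z *\<^sub>C x) i = z *\<^sub>C coord x i"
  by (rule coord_unique)
    (auto simp: coord X coord_in simp del: One_nat_def simp flip: scaleC.sum_right)

lemma coord_scaleR: "i \<in> {1..n} \<Longrightarrow> coord (r *\<^sub>R x) i = r *\<^sub>R coord x i"
  by (simp add: scaleR_scaleC coord_scaleC)

lemma coord_diff: "i \<in> {1..n} \<Longrightarrow> coord (x - y) i = coord x i - coord y i"
  using coord_add[of i x "- y"] coord_scaleR[of i "-1" y] by simp

text \<open>The sum norm of the coordinates, transported to the whole space. That it is bounded by a
  multiple of the given norm is the open mapping theorem for the addition map, proved below by its
  usual two steps, Baire category and successive approximation.\<close>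

definition N :: "'a \<Rightarrow> real" where
  "N x = (\<Sum>i=1..n. norm (coord x i))"

lemma N_diff: "N (x - y) \<le> N x + N y"
  unfolding N_def sum.distrib[symmetric]
  by (intro sum_mono) (auto simp: coord_diff norm_triangle_ineq4)

lemma N_scaleR: "N (r *\<^sub>R x) = \<bar>r\<bar> * N x"
  by (simp add: N_def coord_scaleR sum_distrib_left)

lemma norm_coord_le: "i \<in> {1..n} \<Longrightarrow> norm (coord x i) \<le> N x"
  unfolding N_def by (rule member_le_sum) auto

text \<open>By Baire, the closure of some \<open>N\<close>-ball has an interior point, so every vector is approximated
  by vectors of controlled \<open>N\<close>-norm.\<close>

lemma N_approx:
  "\<exists>C\<ge>0. \<forall>y. \<forall>e>0. \<exists>u. N u \<le> C * norm y \<and> norm (y - u) < e"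
proof -
  define B where "B k = closure {x. N x \<le> real k}" for k :: nat
  have "(\<Union>k. B k) = UNIV"
  proof -
    have "x \<in> B (nat \<lceil>N x\<rceil>)" for x
      unfolding B_def by (intro subsetD[OF closure_subset]) (simp add: real_nat_ceiling_ge)
    then show ?thesis by blast
  qed
  then obtain k where "interior (B k) \<noteq> {}"
    using Baire_UNIV_interior[of B] by (auto simp: B_def)
  then obtain x0 where "x0 \<in> interior (B k)" by blast
  then obtain r where r: "r > 0" "ball x0 r \<subseteq> B k"
    by (meson mem_interior)
  \<comment> \<open>Subtracting an approximation of x0 from one of x0 + y moves the ball to the
    origin and doubles the bound.\<close>
  have small: "\<exists>u. N u \<le> 2 * real k \<and> norm (y - u) < e" if y: "norm y < r" and e: "e > 0" for y e
  proof -
    have "x0 + y \<in> B k" "x0 \<in> B k" using r y by (auto simp: dist_norm)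
    then obtain u v where uv: "N u \<le> real k" "dist u (x0 + y) < e / 2" "N v \<le> real k" "dist v x0 < e / 2"
      using e unfolding B_def closure_approachable by (metis half_gt_zero mem_Collect_eq)
    have "norm (y - (u - v)) \<le> norm (v - x0) + norm (u - (x0 + y))"
      using norm_triangle_ineq4[of "v - x0" "u - (x0 + y)"] by (simp add: algebra_simps)
    then have "norm (y - (u - v)) < e" using uv by (simp add: dist_norm)
    moreover have "N (u - v) \<le> 2 * real k" using N_diff[of u v] uv by simp
    ultimately show ?thesis by blast
  qed
  show ?thesis
  proof (intro exI[of _ "4 * real k / r"] conjI allI impI)
    fix y and e :: real assume e: "e > 0"
    show "\<exists>u. N u \<le> 4 * real k / r * norm y \<and> norm (y - u) < e"
    proof (cases "y = 0")
      case True
      then show ?thesis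
        using e N_scaleR[of 0 0] by (intro exI[of _ 0]) auto
    next
      case False
      \<comment> \<open>This scales y to norm r / 2, inside the ball of radius r; dividing the bound
        2 k by a gives the constant 4 k / r.\<close>
      define a where "a = r / (2 * norm y)"
      have a: "a > 0" using False r(1) by (simp add: a_def)
      have "norm (a *\<^sub>R y) < r" using False r(1) by (simp add: a_def)
      from small[OF this, of "a * e"] a e obtain u
        where u: "N u \<le> 2 * real k" "norm (a *\<^sub>R y - u) < a * e" by auto
      have "norm (y - u /\<^sub>R a) < e"
      proof -
        have "a *\<^sub>R y - u = a *\<^sub>R (y - u /\<^sub>R a)" using a by (simp add: scaleR_diff_right)
        then have "a * norm (y - u /\<^sub>R a) < a * e" using u(2) a by simp
        then show ?thesis using a by simp
      qed
      moreover have "N (u /\<^sub>R a) \<le> 4 * real k / r * norm y"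
      proof -
        have "N (u /\<^sub>R a) = N u / a" using a by (simp add: N_scaleR divide_inverse mult.commute)
        also have "\<dots> \<le> 2 * real k / a" using u(1) a by (simp add: divide_right_mono)
        finally show ?thesis by (simp add: a_def)
      qed
      ultimately show ?thesis by blast
    qed
  qed (use r in auto)
qed

text \<open>Approximating repeatedly and halving the remainder each time writes x as a series of
  vectors whose \<open>N\<close>-values are dominated by C norm x / 2^k, with sum 2 C norm x. The
  coordinates of the terms form convergent series, their sums lie in the closed subspaces, and
  uniqueness identifies them as the coordinates of x.\<close>

lemma N_bounded: "\<exists>C. \<forall>x. N x \<le> C * norm x"
proof -
  obtain C where C: "C \<ge> 0" "\<And>y e. e > 0 \<Longrightarrow> \<exists>u. N u \<le> C * norm y \<and> norm (y - u) < e"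
    using N_approx by blast
  have "\<exists>u. N u \<le> C * norm y \<and> norm (y - u) \<le> norm y / 2" for y
  proof (cases "y = 0")
    case True
    then show ?thesis using N_scaleR[of 0 0] by (intro exI[of _ 0]) auto
  next
    case False
    then show ?thesis using C(2)[of "norm y / 2" y] by force
  qed
  then obtain u where u: "\<And>y. N (u y) \<le> C * norm y" "\<And>y. norm (y - u y) \<le> norm y / 2"
    by metis
  have "N x \<le> 2 * C * norm x" for x
  proof -
    define y where "y = rec_nat x (\<lambda>_ z. z - u z)"
    have y: "y 0 = x" "\<And>k. y (Suc k) = y k - u (y k)" by (simp_all add: y_def)
    have ny: "norm (y k) \<le> norm x * (1 / 2) ^ k" for k
    proof (induction k)
      case (Suc k)
      then show ?case using u(2)[of "y k"] by (simp add: y)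
    qed (simp add: y)
    have gs: "(\<lambda>k. C * norm x * (1 / 2) ^ k) sums (2 * C * norm x)"
      using sums_mult[OF geometric_sums[of "1 / 2 :: real"], of "C * norm x"] by (simp add: mult_ac)
    have Nu: "N (u (y k)) \<le> C * norm x * (1 / 2) ^ k" for k
      using order_trans[OF u(1) mult_left_mono[OF ny C(1)]] by (simp add: mult.assoc)
    have sN: "summable (\<lambda>k. N (u (y k)))"
      by (rule summable_comparison_test'[OF sums_summable[OF gs]])
        (use Nu in \<open>auto simp: N_def sum_nonneg\<close>)
    have sn: "summable (\<lambda>k. norm (coord (u (y k)) i))" if "i \<in> {1..n}" for i
      by (rule summable_comparison_test'[OF sN]) (use norm_coord_le[OF that] in auto)
    have sc: "summable (\<lambda>k. coord (u (y k)) i)" if "i \<in> {1..n}" for i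
      by (rule summable_norm_cancel[OF sn[OF that]])
    define c where "c i = (\<Sum>k. coord (u (y k)) i)" for i
    have cX: "c i \<in> X i" if i: "i \<in> {1..n}" for i
    proof -
      have "(\<lambda>m. \<Sum>k<m. coord (u (y k)) i) \<longlonglongrightarrow> c i"
        unfolding c_def by (rule summable_LIMSEQ[OF sc[OF i]])
      then show ?thesis
        by (rule closed_sequentially[OF X(4)[OF i], rotated]) (rule X_sum[OF i coord_in[OF i]])
    qed
    have "(\<lambda>k. norm x * (1 / 2) ^ k) \<longlonglongrightarrow> 0"
      by (intro tendsto_mult_right_zero LIMSEQ_power_zero) simp
    then have y0: "y \<longlonglongrightarrow> 0"
      by (rule Lim_null_comparison[rotated]) (use ny in auto)
    have "(\<lambda>k. y k - y (Suc k)) sums (y 0 - 0)"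
      by (rule telescope_sums'[OF y0])
    then have "(\<lambda>k. u (y k)) sums x" by (simp add: y)
    then have "(\<Sum>i=1..n. c i) = x"
      unfolding c_def using suminf_sum[of "{1..n}" "\<lambda>i k. coord (u (y k)) i", OF sc]
      by (simp add: coord(2) sums_iff del: One_nat_def)
    then have "coord x i = c i" if "i \<in> {1..n}" for i
      using coord_unique cX that by blast
    then have "N x = (\<Sum>i=1..n. norm (c i))" by (simp add: N_def)
    also have "\<dots> \<le> (\<Sum>i=1..n. \<Sum>k. norm (coord (u (y k)) i))"
      unfolding c_def by (intro sum_mono summable_norm sn) auto
    also have "\<dots> = (\<Sum>k. N (u (y k)))"
      unfolding N_def using sn by (intro suminf_sum[symmetric]) auto
    also have "\<dots> \<le> 2 * C * norm x"
      using suminf_le[OF Nu sN sums_summable[OF gs]] sums_unique[OF gs] by simp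
    finally show ?thesis .
  qed
  then show ?thesis by blast
qed

section \<open>Projections and block operators\<close>

definition Pr :: "nat \<Rightarrow> 'a \<Rightarrow>\<^sub>L 'a" where
  "Pr i = Blinfun (\<lambda>x. coord x i)"

lemma Pr_apply:
  assumes i: "i \<in> {1..n}"
  shows "Pr i x = coord x i"
proof -
  obtain C where C: "\<And>x. N x \<le> C * norm x" using N_bounded by blast
  have "bounded_linear (\<lambda>x. coord x i)"
    using C norm_coord_le[OF i]
    by (intro bounded_linear_intro[where K = C])
      (auto simp: coord_add[OF i] coord_scaleR[OF i] mult.commute intro: order_trans)
  then show ?thesis by (simp add: Pr_def bounded_linear_Blinfun_apply)
qed

lemma Pr_in: "i \<in> {1..n} \<Longrightarrow> Pr i x \<in> X i"
  by (simp add: Pr_apply coord_in del: atLeastAtMost_iff)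

lemma clin_Pr: "i \<in> {1..n} \<Longrightarrow> clin (Pr i)"
  by (simp add: clin_def Pr_apply coord_scaleC del: atLeastAtMost_iff)

lemma Pr_X:
  assumes "i \<in> {1..n}" "k \<in> {1..n}" "x \<in> X k"
  shows "Pr i x = (if i = k then x else 0)"
  unfolding Pr_apply[OF assms(1)]
  using assms X(1) by (intro coord_unique[where c = "\<lambda>i. if i = k then x else 0"]) auto

lemma Pr_sum: "(\<Sum>i=1..n. Pr i x) = x"
  using coord(2)[of x] by (simp add: Pr_apply)

lemma Pr_comp: "i \<in> {1..n} \<Longrightarrow> j \<in> {1..n} \<Longrightarrow> Pr i o\<^sub>L Pr j = (if i = j then Pr i else 0)"
  by (rule blinfun_eqI) (auto simp: Pr_X[OF _ _ Pr_in] simp del: atLeastAtMost_iff)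

lemma comp_sum_Pr: "(\<Sum>k=1..n. S o\<^sub>L (Pr k o\<^sub>L T)) = S o\<^sub>L T"
proof -
  have "(\<Sum>k=1..n. Pr k o\<^sub>L T) = T"
    by (rule blinfun_eqI) (simp add: blinfun.sum_left Pr_sum del: One_nat_def)
  then show ?thesis by (simp flip: blinfun_comp.sum_right)
qed

text \<open>Replaces the conditions on range and kernel by identities with projections, for which
  closedness and stability under products are computations.\<close>

lemma block_ops_iff:
  assumes i: "i \<in> {1..n}" and j: "j \<in> {1..n}"
  shows "T \<in> block_ops n X i j \<longleftrightarrow> clin T \<and> Pr i o\<^sub>L T = T \<and> T o\<^sub>L Pr j = T"
proof
  assume T: "T \<in> block_ops n X i j"
  have TX: "T x \<in> X i" for x using T by (auto simp: block_ops_def)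
  have T0: "T x = 0" if "k \<in> {1..n}" "k \<noteq> j" "x \<in> X k" for k x
    using T that unfolding block_ops_def by blast
  have "Pr i o\<^sub>L T = T"
    by (rule blinfun_eqI) (simp add: Pr_X[OF i i TX])
  moreover have "T o\<^sub>L Pr j = T"
  proof (rule blinfun_eqI)
    fix x
    have "T x = T (\<Sum>k=1..n. Pr k x)" by (simp only: Pr_sum)
    also have "\<dots> = (\<Sum>k=1..n. if k = j then T (Pr j x) else 0)"
      unfolding blinfun.sum_right by (intro sum.cong) (auto intro!: T0 Pr_in simp del: atLeastAtMost_iff)
    also have "\<dots> = T (Pr j x)" using j by simp
    finally show "(T o\<^sub>L Pr j) x = T x" by simp
  qed
  ultimately show "clin T \<and> Pr i o\<^sub>L T = T \<and> T o\<^sub>L Pr j = T"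
    using T by (auto simp: block_ops_def clin_def)
next
  assume T: "clin T \<and> Pr i o\<^sub>L T = T \<and> T o\<^sub>L Pr j = T"
  have "T x = Pr i (T x)" for x using T by (metis blinfun_apply_blinfun_compose)
  then have "range T \<subseteq> X i" using Pr_in[OF i] by (metis image_subsetI)
  moreover have "T x = 0" if "k \<in> {1..n} - {j}" "x \<in> X k" for k x
  proof -
    have "T x = T (Pr j x)" using T by (metis blinfun_apply_blinfun_compose)
    then show ?thesis using Pr_X[OF j _ that(2)] that(1) by auto
  qed
  ultimately show "T \<in> block_ops n X i j"
    using T unfolding block_ops_def clin_def by blast
qed

lemma block_id:
  assumes i: "i \<in> {1..n}"
  shows "block_id n X i = Pr i"
  unfolding block_id_def
proof (rule the_equality)
  show "Pr i \<in> block_ops n X i i \<and> (\<forall>x\<in>X i. Pr i x = x)"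
    using Pr_X[OF i i] by (simp add: block_ops_iff[OF i i] clin_Pr[OF i] Pr_comp[OF i i])
  fix Q assume Q: "Q \<in> block_ops n X i i \<and> (\<forall>x\<in>X i. Q x = x)"
  then have "Q o\<^sub>L Pr i = Q" by (simp add: block_ops_iff[OF i i])
  then have "Q x = Q (Pr i x)" for x by (metis blinfun_apply_blinfun_compose)
  then show "Q = Pr i" using Q Pr_in[OF i] by (intro blinfun_eqI) simp
qed

lemma corner_block:
  assumes i: "i \<in> {1..n}"
  shows "corner_algebra (block_ops n X i i) (Pr i)"
proof
  have eq: "block_ops n X i i = {T. clin T} \<inter> {T. Pr i o\<^sub>L T = T} \<inter> {T. T o\<^sub>L Pr i = T}"
    using block_ops_iff[OF i i] by blast
  show "closed (block_ops n X i i)"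
    unfolding eq
    by (intro closed_Int closed_clin closed_Collect_eq continuous_on_id blinfun_comp.continuous_on
        continuous_on_const)
qed (auto simp: block_ops_iff[OF i i] clin_Pr[OF i] Pr_comp[OF i i] clin_add clin_scaleC clin_comp
    blinfun_comp.add_left blinfun_comp.add_right scaleC_comp_right[OF clin_Pr[OF i]] blinfun_comp_assoc
    simp flip: blinfun_comp_assoc[of "Pr i"])

lemma spectrum_op_block:
  assumes i: "i \<in> {1..n}" and B: "B \<in> block_ops n X i i"
  shows "spectrum_op (block_alg n X i) B = corner_algebra.spec (block_ops n X i i) (Pr i) B"
proof -
  interpret corner_algebra "block_ops n X i i" "Pr i" by (rule corner_block[OF i])
  show ?thesis
    using diff[OF scale[OF P] B]
    by (auto simp: spectrum_op_def spec_def Units_def block_alg_def block_id[OF i] is_inv_def)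
qed

lemma resolvent_block:
  assumes i: "i \<in> {1..n}"
  shows "resolvent (block_alg n X i) B = corner_algebra.res (block_ops n X i i) (Pr i) B"
proof -
  interpret corner_algebra "block_ops n X i i" "Pr i" by (rule corner_block[OF i])
  show ?thesis
    by (simp add: fun_eq_iff resolvent_def m_inv_def res_def is_inv_def block_alg_def block_id[OF i])
qed

end

section \<open>Matrices as operators, and their spectra\<close>

context decomposition
begin

text \<open>\<open>ent\<close> and \<open>op_of\<close> are mutually inverse between the
  complex-linear operators and the matrices of \<open>matrix_alg\<close>, and \<open>ent\<close> is
  multiplicative. Invertible matrices thus become invertible operators, and both spectra of a
  triangular matrix become spectra in corner algebras.\<close>

definition ent :: "('a \<Rightarrow>\<^sub>L 'a) \<Rightarrow> nat \<Rightarrow> nat \<Rightarrow> 'a \<Rightarrow>\<^sub>L 'a" where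
  "ent S i j = (if i \<in> {1..n} \<and> j \<in> {1..n} then Pr i o\<^sub>L (S o\<^sub>L Pr j) else 0)"

definition op_of :: "'a op_matrix \<Rightarrow> 'a \<Rightarrow>\<^sub>L 'a" where
  "op_of T = (\<Sum>i=1..n. \<Sum>j=1..n. T i j)"

lemma ent_eqI:
  assumes "\<And>i j. i \<in> {1..n} \<Longrightarrow> j \<in> {1..n} \<Longrightarrow> ent S i j = ent T i j"
  shows "S = T"
proof -
  have "S = (\<Sum>i=1..n. \<Sum>j=1..n. ent S i j)" for S
  proof -
    have "(\<Sum>i=1..n. \<Sum>j=1..n. ent S i j) = (\<Sum>i=1..n. \<Sum>j=1..n. Pr i o\<^sub>L (S o\<^sub>L Pr j))"
      by (intro sum.cong) (auto simp: ent_def)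
    also have "\<dots> = S"
      by (rule blinfun_eqI)
        (simp add: blinfun.sum_left Pr_sum del: One_nat_def flip: blinfun.sum_right)
    finally show ?thesis ..
  qed
  from this[of S] this[of T] show ?thesis using assms by simp
qed

lemma ent_comp: "ent (S o\<^sub>L T) i j = (\<Sum>k=1..n. ent S i k o\<^sub>L ent T k j)"
proof (cases "i \<in> {1..n} \<and> j \<in> {1..n}")
  case True
  have "ent S i k o\<^sub>L ent T k j = (Pr i o\<^sub>L S) o\<^sub>L (Pr k o\<^sub>L (T o\<^sub>L Pr j))" if k: "k \<in> {1..n}" for k
  proof -
    have "ent S i k o\<^sub>L ent T k j = (Pr i o\<^sub>L S) o\<^sub>L ((Pr k o\<^sub>L Pr k) o\<^sub>L (T o\<^sub>L Pr j))"
      using True k by (simp add: ent_def blinfun_comp_assoc)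
    then show ?thesis by (simp only: Pr_comp[OF k k] simp_thms if_True)
  qed
  then have "(\<Sum>k=1..n. ent S i k o\<^sub>L ent T k j) = (Pr i o\<^sub>L S) o\<^sub>L (T o\<^sub>L Pr j)"
    using comp_sum_Pr[of "Pr i o\<^sub>L S" "T o\<^sub>L Pr j"] by (simp del: One_nat_def)
  also have "\<dots> = ent (S o\<^sub>L T) i j"
    using True by (simp add: ent_def blinfun_comp_assoc)
  finally show ?thesis ..
next
  case False
  then have "ent S i k o\<^sub>L ent T k j = 0" for k by (auto simp: ent_def)
  then show ?thesis using False by (auto simp: ent_def)
qed

lemma ent_id: "ent id_blinfun i j = (if i = j \<and> i \<in> {1..n} then block_id n X i else 0)"
proof -
  have "id_blinfun o\<^sub>L Pr j = Pr j" by (rule blinfun_eqI) simp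
  then show ?thesis using Pr_comp[of i j] block_id[of i] by (auto simp: ent_def simp del: atLeastAtMost_iff)
qed

lemma ent_diff_scaleC: "ent (z *\<^sub>C S - T) i j = z *\<^sub>C ent S i j - ent T i j"
  by (simp add: ent_def blinfun_comp.diff_left blinfun_comp.diff_right scaleC_comp_right[OF clin_Pr]
      scaleC.zero_right del: atLeastAtMost_iff)

lemma ent_op_of:
  assumes "T \<in> carrier (matrix_alg n X)"
  shows "ent (op_of T) i j = T i j"
proof (cases "i \<in> {1..n} \<and> j \<in> {1..n}")
  case True
  have blk: "T k l \<in> block_ops n X k l" if "k \<in> {1..n}" "l \<in> {1..n}" for k l
    using assms that by (auto simp: matrix_alg_def)
  have sel: "Pr i o\<^sub>L (T k l o\<^sub>L Pr j) = (if l = j then if k = i then T i j else 0 else 0)"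
    if k: "k \<in> {1..n}" "l \<in> {1..n}" for k l
  proof -
    have eq: "T k l = Pr k o\<^sub>L (T k l o\<^sub>L Pr l)"
      using blk[OF k] by (simp add: block_ops_iff[OF k])
    have "Pr i o\<^sub>L (T k l o\<^sub>L Pr j) = (Pr i o\<^sub>L Pr k) o\<^sub>L (T k l o\<^sub>L (Pr l o\<^sub>L Pr j))"
      by (subst eq) (simp only: blinfun_comp_assoc)
    also have "\<dots> = (if i = k then Pr i else 0) o\<^sub>L (T k l o\<^sub>L (if l = j then Pr l else 0))"
      using True k by (simp only: Pr_comp)
    also have "\<dots> = (if l = j then if k = i then T i j else 0 else 0)"
      using eq[symmetric] by (cases "k = i"; cases "l = j") simp_all
    finally show ?thesis .
  qed
  have "ent (op_of T) i j = (\<Sum>k=1..n. \<Sum>l=1..n. Pr i o\<^sub>L (T k l o\<^sub>L Pr j))"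
    using True by (simp add: ent_def op_of_def blinfun_comp.sum_left blinfun_comp.sum_right)
  also have "\<dots> = (\<Sum>k=1..n. \<Sum>l=1..n. if l = j then if k = i then T i j else 0 else 0)"
    by (intro sum.cong refl sel)
  also have "\<dots> = T i j"
    using True by simp
  finally show ?thesis .
next
  case False
  then have "T i j = 0" using assms by (auto simp: matrix_alg_def)
  then show ?thesis using False by (auto simp: ent_def)
qed

lemma ent_in_carrier:
  assumes "clin S"
  shows "ent S \<in> carrier (matrix_alg n X)"
proof -
  have "ent S i j \<in> block_ops n X i j" if "i \<in> {1..n}" "j \<in> {1..n}" for i j
    using that assms
    by (simp add: block_ops_iff[OF that] ent_def clin_comp clin_Pr Pr_comp blinfun_comp_assoc
        del: atLeastAtMost_iff)
      (simp add: Pr_comp[OF that(1) that(1)] del: atLeastAtMost_iff flip: blinfun_comp_assoc[of "Pr i"])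
  then show ?thesis by (auto simp: matrix_alg_def ent_def)
qed

lemma clin_op_of:
  assumes "T \<in> carrier (matrix_alg n X)"
  shows "clin (op_of T)"
proof -
  have "clin (T i j)" if ij: "i \<in> {1..n}" "j \<in> {1..n}" for i j
  proof -
    have "T i j \<in> block_ops n X i j" using assms ij by (auto simp: matrix_alg_def)
    then show ?thesis by (simp add: block_ops_iff[OF ij])
  qed
  moreover have clin_sum: "clin (\<Sum>i\<in>I. f i)" if "\<And>i. i \<in> I \<Longrightarrow> clin (f i)" for I :: "nat set"
    and f :: "nat \<Rightarrow> 'a \<Rightarrow>\<^sub>L 'a"
    using that by (induction I rule: infinite_finite_induct) (auto intro: clin_0 clin_add)
  ultimately show ?thesis unfolding op_of_def by (intro clin_sum)
qed

definition low_ops :: "('a \<Rightarrow>\<^sub>L 'a) set" where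
  "low_ops = {T. clin T \<and> (\<forall>i j. i < j \<longrightarrow> ent T i j = 0)}"

lemma clin_id: "clin id_blinfun"
  by (simp add: clin_def)

lemma id_comp: "id_blinfun o\<^sub>L T = T" "T o\<^sub>L id_blinfun = T"
  by (rule blinfun_eqI, simp)+

lemma corner_full: "corner_algebra {T. clin T} (id_blinfun :: 'a \<Rightarrow>\<^sub>L 'a)"
  by unfold_locales (auto simp: closed_clin clin_id clin_add clin_scaleC clin_comp id_comp)

lemma corner_low: "corner_algebra low_ops id_blinfun"
proof
  have "low_ops = {T. clin T} \<inter> (\<Inter>(i, j)\<in>{(i, j). i < j}. {T. ent T i j = 0})"
    by (auto simp: low_ops_def)
  moreover have "continuous_on UNIV (\<lambda>T. ent T i j)" for i j
    unfolding ent_def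
    by (cases "i \<in> {1..n} \<and> j \<in> {1..n}")
      (auto intro!: blinfun_comp.continuous_on continuous_intros)
  ultimately show "closed low_ops"
    by (auto intro!: closed_Int closed_clin closed_INT closed_Collect_eq continuous_intros)
  show "S o\<^sub>L T \<in> low_ops" if S: "S \<in> low_ops" and T: "T \<in> low_ops" for S T
  proof -
    \<comment> \<open>For i < j every k satisfies i < k or k < j, so one of the two entries
      vanishes.\<close>
    have "ent S i k o\<^sub>L ent T k j = 0" if "i < j" for i j k
      using S T that by (cases "i < k") (auto simp: low_ops_def)
    then show ?thesis using S T by (auto simp: low_ops_def clin_comp ent_comp)
  qed
  show "S + T \<in> low_ops" if "S \<in> low_ops" "T \<in> low_ops" for S T
  proof -
    have "ent (S + T) i j = ent S i j + ent T i j" for i j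
      by (simp add: ent_def blinfun_comp.add_left blinfun_comp.add_right)
    then show ?thesis using that by (auto simp: low_ops_def clin_add)
  qed
  show "z *\<^sub>C T \<in> low_ops" if "T \<in> low_ops" for T z
  proof -
    have "ent 0 i j = 0" for i j by (simp add: ent_def)
    then have "ent (z *\<^sub>C T) i j = z *\<^sub>C ent T i j" for i j
      using ent_diff_scaleC[of z T 0 i j] by simp
    then show ?thesis using that by (auto simp: low_ops_def clin_scaleC scaleC.zero_right)
  qed
qed (auto simp: low_ops_def id_comp clin_id ent_id)

abbreviation shift :: "'a op_matrix \<Rightarrow> complex \<Rightarrow> 'a op_matrix" where
  "shift A z \<equiv> \<lambda>i j. z *\<^sub>C \<one>\<^bsub>matrix_alg n X\<^esub> i j - A i j"

context
  fixes A assumes A: "A \<in> carrier (lower_matrix_alg n X)"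
begin

lemma A_carrier: "A \<in> carrier (matrix_alg n X)"
  and A_low: "i < j \<Longrightarrow> A i j = 0"
  using A by (auto simp: lower_matrix_alg_def)

lemma op_of_low: "op_of A \<in> low_ops"
  using A_low by (auto simp: low_ops_def clin_op_of[OF A_carrier] ent_op_of[OF A_carrier])

lemma ent_shift: "ent (z *\<^sub>C id_blinfun - op_of A) i j =
    z *\<^sub>C \<one>\<^bsub>matrix_alg n X\<^esub> i j - A i j"
  by (simp add: ent_diff_scaleC ent_id ent_op_of[OF A_carrier] matrix_alg_def)

lemma clin_shift: "clin (z *\<^sub>C id_blinfun - op_of A)"
  by (intro clin_diff clin_scaleC clin_id clin_op_of A_carrier)

lemma matrix_inverse_iff:
  assumes T: "T \<in> carrier (matrix_alg n X)"
  shows "shift A z \<otimes>\<^bsub>matrix_alg n X\<^esub> T = \<one>\<^bsub>matrix_alg n X\<^esub> \<longleftrightarrow>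
      (z *\<^sub>C id_blinfun - op_of A) o\<^sub>L op_of T = id_blinfun"
    and "T \<otimes>\<^bsub>matrix_alg n X\<^esub> shift A z = \<one>\<^bsub>matrix_alg n X\<^esub> \<longleftrightarrow>
      op_of T o\<^sub>L (z *\<^sub>C id_blinfun - op_of A) = id_blinfun"
proof -
  have eq: "S = id_blinfun \<longleftrightarrow> ent S = \<one>\<^bsub>matrix_alg n X\<^esub>" for S
    using ent_eqI[of S id_blinfun] ent_id by (auto simp: matrix_alg_def fun_eq_iff)
  have mult: "ent (S o\<^sub>L T) = ent S \<otimes>\<^bsub>matrix_alg n X\<^esub> ent T" for S T
    by (simp add: fun_eq_iff ent_comp matrix_alg_def)
  have sh: "shift A z = ent (z *\<^sub>C id_blinfun - op_of A)"
    by (simp add: fun_eq_iff ent_shift)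
  have T': "ent (op_of T) = T" by (simp add: fun_eq_iff ent_op_of[OF T])
  show "shift A z \<otimes>\<^bsub>matrix_alg n X\<^esub> T = \<one>\<^bsub>matrix_alg n X\<^esub> \<longleftrightarrow>
      (z *\<^sub>C id_blinfun - op_of A) o\<^sub>L op_of T = id_blinfun"
    "T \<otimes>\<^bsub>matrix_alg n X\<^esub> shift A z = \<one>\<^bsub>matrix_alg n X\<^esub> \<longleftrightarrow>
      op_of T o\<^sub>L (z *\<^sub>C id_blinfun - op_of A) = id_blinfun"
    unfolding eq mult sh T' by simp_all
qed

lemma op_of_ent: "clin S \<Longrightarrow> op_of (ent S) = S"
  by (rule ent_eqI) (simp add: ent_op_of[OF ent_in_carrier])

lemma shift_carrier:
  "shift A z \<in> carrier (lower_matrix_alg n X)"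
proof -
  have "shift A z = ent (z *\<^sub>C id_blinfun - op_of A)"
    by (simp add: fun_eq_iff ent_shift)
  moreover have "ent (z *\<^sub>C id_blinfun - op_of A) i j = 0" if "i < j" for i j
    using that A_low by (simp add: ent_shift matrix_alg_def scaleC.zero_right)
  ultimately show ?thesis
    using ent_in_carrier[OF clin_shift] unfolding lower_matrix_alg_def by simp
qed

lemma spectrum_eq_spec: "spectrum n X A = corner_algebra.spec {T. clin T} id_blinfun (op_of A)"
proof -
  interpret corner_algebra "{T. clin T}" "id_blinfun :: 'a \<Rightarrow>\<^sub>L 'a" by (rule corner_full)
  have "shift A z \<in> Units (matrix_alg n X) \<longleftrightarrow>
      (\<exists>R. is_inv (z *\<^sub>C id_blinfun - op_of A) R)" for z
  proof
    assume "shift A z \<in> Units (matrix_alg n X)"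
    then obtain T where T: "T \<in> carrier (matrix_alg n X)"
      "T \<otimes>\<^bsub>matrix_alg n X\<^esub> shift A z = \<one>\<^bsub>matrix_alg n X\<^esub>"
      "shift A z \<otimes>\<^bsub>matrix_alg n X\<^esub> T = \<one>\<^bsub>matrix_alg n X\<^esub>"
      unfolding Units_def by blast
    then show "\<exists>R. is_inv (z *\<^sub>C id_blinfun - op_of A) R"
      unfolding matrix_inverse_iff[OF T(1)] is_inv_def using clin_op_of[OF T(1)] by blast
  next
    assume "\<exists>R. is_inv (z *\<^sub>C id_blinfun - op_of A) R"
    then obtain R where R: "is_inv (z *\<^sub>C id_blinfun - op_of A) R" by blast
    have cR: "clin R" using R by (simp add: is_inv_def)
    have "shift A z \<in> carrier (matrix_alg n X)"
      using shift_carrier[of z] by (simp add: lower_matrix_alg_def)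
    then show "shift A z \<in> Units (matrix_alg n X)"
      unfolding Units_def using ent_in_carrier[OF cR] matrix_inverse_iff[OF ent_in_carrier[OF cR], of z] R
      by (auto simp: is_inv_def op_of_ent[OF cR])
  qed
  then show ?thesis by (simp add: spectrum_mat_def spec_def)
qed

lemma causal_spectrum_eq_spec:
  "causal_spectrum n X A = corner_algebra.spec low_ops id_blinfun (op_of A)"
proof -
  interpret corner_algebra low_ops id_blinfun by (rule corner_low)
  have one: "\<one>\<^bsub>lower_matrix_alg n X\<^esub> = \<one>\<^bsub>matrix_alg n X\<^esub>"
    and mult: "S \<otimes>\<^bsub>lower_matrix_alg n X\<^esub> T = S \<otimes>\<^bsub>matrix_alg n X\<^esub> T" for S T
    by (simp_all add: lower_matrix_alg_def)
  have "shift A z \<in> Units (lower_matrix_alg n X) \<longleftrightarrow>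
      (\<exists>R. is_inv (z *\<^sub>C id_blinfun - op_of A) R)" for z
  proof
    assume "shift A z \<in> Units (lower_matrix_alg n X)"
    then obtain T where T: "T \<in> carrier (matrix_alg n X)" "\<And>i j. i < j \<Longrightarrow> T i j = 0"
      "T \<otimes>\<^bsub>matrix_alg n X\<^esub> shift A z = \<one>\<^bsub>matrix_alg n X\<^esub>"
      "shift A z \<otimes>\<^bsub>matrix_alg n X\<^esub> T = \<one>\<^bsub>matrix_alg n X\<^esub>"
      unfolding Units_def one mult by (auto simp: lower_matrix_alg_def)
    have "op_of T \<in> low_ops"
      using T(2) by (auto simp: low_ops_def clin_op_of[OF T(1)] ent_op_of[OF T(1)])
    then show "\<exists>R. is_inv (z *\<^sub>C id_blinfun - op_of A) R"
      using T(3,4) unfolding matrix_inverse_iff[OF T(1)] is_inv_def by blast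
  next
    assume "\<exists>R. is_inv (z *\<^sub>C id_blinfun - op_of A) R"
    then obtain R where R: "is_inv (z *\<^sub>C id_blinfun - op_of A) R" by blast
    then have "R \<in> low_ops" by (simp add: is_inv_def)
    then have cR: "clin R" and "ent R \<in> carrier (lower_matrix_alg n X)"
      using ent_in_carrier[of R] by (auto simp: low_ops_def lower_matrix_alg_def)
    then show "shift A z \<in> Units (lower_matrix_alg n X)"
      unfolding Units_def one mult
      using shift_carrier[of z] matrix_inverse_iff[OF ent_in_carrier[OF cR], of z] R
      by (auto simp: is_inv_def op_of_ent[OF cR])
  qed
  then show ?thesis by (simp add: spectrum_mat_def spec_def one)
qed

lemma A_block:
  assumes "i \<in> {1..n}" "j \<in> {1..n}"
  shows "A i j \<in> block_ops n X i j"
  using A_carrier assms by (auto simp: matrix_alg_def)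

lemma compact_causal_spectrum: "compact (causal_spectrum n X A)"
  unfolding causal_spectrum_eq_spec
  by (rule corner_algebra.compact_spec[OF corner_low op_of_low])

text \<open>On triangular operators taking the i-th diagonal entry is multiplicative, since in the
  product sum k > i kills the left entry and k < i the right one. Hence the diagonal entry of a
  triangular inverse inverts the diagonal block.\<close>

lemma diag_spec_subset:
  assumes i: "i \<in> {1..n}"
  shows "corner_algebra.spec (block_ops n X i i) (Pr i) (A i i) \<subseteq> causal_spectrum n X A"
proof
  interpret L: corner_algebra low_ops id_blinfun by (rule corner_low)
  interpret B: corner_algebra "block_ops n X i i" "Pr i" by (rule corner_block[OF i])
  fix z assume z: "z \<in> B.spec (A i i)"
  show "z \<in> causal_spectrum n X A"
  proof (rule ccontr)
    assume "z \<notin> causal_spectrum n X A"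
    then obtain S where "L.is_inv (z *\<^sub>C id_blinfun - op_of A) S"
      unfolding causal_spectrum_eq_spec L.spec_def by blast
    then have S: "S \<in> low_ops" "(z *\<^sub>C id_blinfun - op_of A) o\<^sub>L S = id_blinfun"
      "S o\<^sub>L (z *\<^sub>C id_blinfun - op_of A) = id_blinfun" unfolding L.is_inv_def by auto
    have M: "z *\<^sub>C id_blinfun - op_of A \<in> low_ops" by (intro L.diff L.scale L.P op_of_low)
    have diag: "ent (S o\<^sub>L T) i i = ent S i i o\<^sub>L ent T i i" if "S \<in> low_ops" "T \<in> low_ops" for S T
    proof -
      have "ent S i k o\<^sub>L ent T k i = (if k = i then ent S i i o\<^sub>L ent T i i else 0)" for k
        using that by (cases "i < k"; cases "k < i") (auto simp: low_ops_def)
      then have "(\<Sum>k=1..n. ent S i k o\<^sub>L ent T k i) =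
          (\<Sum>k=1..n. if k = i then ent S i i o\<^sub>L ent T i i else 0)"
        by (intro sum.cong refl)
      also have "\<dots> = ent S i i o\<^sub>L ent T i i" using i by simp
      finally show ?thesis by (simp only: ent_comp)
    qed
    have Mi: "ent (z *\<^sub>C id_blinfun - op_of A) i i = z *\<^sub>C Pr i - A i i"
      using i block_id[OF i] by (simp add: ent_shift matrix_alg_def)
    have Ii: "ent id_blinfun i i = Pr i" using i block_id[OF i] by (simp add: ent_id)
    have "ent S i i \<in> block_ops n X i i"
      using S(1) ent_in_carrier[of S] i by (auto simp: low_ops_def matrix_alg_def)
    moreover have "(z *\<^sub>C Pr i - A i i) o\<^sub>L ent S i i = Pr i"
      using diag[OF M S(1)] S(2) Mi Ii by simp
    moreover have "ent S i i o\<^sub>L (z *\<^sub>C Pr i - A i i) = Pr i"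
      using diag[OF S(1) M] S(3) Mi Ii by simp
    ultimately have "B.is_inv (z *\<^sub>C Pr i - A i i) (ent S i i)" by (simp add: B.is_inv_def)
    then show False using z by (auto simp: B.spec_def)
  qed
qed

text \<open>The imaginary axis is connected and reaches infinity, and along it the resolvent in the full
  algebra stays in the closed subalgebra of lower triangular operators.\<close>

lemma causal_spectrum_imaginary:
  assumes "\<forall>z\<in>spectrum n X A. Re z \<noteq> 0"
  shows "\<forall>z\<in>causal_spectrum n X A. Re z \<noteq> 0"
proof -
  interpret L: corner_algebra low_ops id_blinfun by (rule corner_low)
  interpret F: corner_algebra "{T. clin T}" "id_blinfun :: 'a \<Rightarrow>\<^sub>L 'a" by (rule corner_full)
  have oF: "op_of A \<in> {T. clin T}" using op_of_low by (simp add: low_ops_def)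
  let ?c = "\<lambda>y::real. \<i> * complex_of_real y"
  have cc: "continuous_on UNIV ?c" by (intro continuous_intros)
  have nF: "?c y \<notin> F.spec (op_of A)" for y
    using assms unfolding spectrum_eq_spec by force
  have LF: "L.is_inv T R \<Longrightarrow> F.is_inv T R" for T R
    unfolding L.is_inv_def F.is_inv_def by (simp add: low_ops_def)
  \<comment> \<open>Uniqueness of inverses in the full algebra gives two descriptions of the same
    set of y: the left one makes it open, the right one closed.\<close>
  have iff: "?c y \<notin> L.spec (op_of A) \<longleftrightarrow> F.res (op_of A) (?c y) \<in> low_ops" for y
  proof
    assume "?c y \<notin> L.spec (op_of A)"
    then have "L.is_inv (?c y *\<^sub>C id_blinfun - op_of A) (L.res (op_of A) (?c y))"
      by (rule L.is_inv_res)
    then show "F.res (op_of A) (?c y) \<in> low_ops"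
      using F.res_eqI[OF LF] by (simp add: L.is_inv_def)
  next
    assume "F.res (op_of A) (?c y) \<in> low_ops"
    then have "L.is_inv (?c y *\<^sub>C id_blinfun - op_of A) (F.res (op_of A) (?c y))"
      using F.is_inv_res[OF nF] by (simp add: L.is_inv_def F.is_inv_def)
    then show "?c y \<notin> L.spec (op_of A)" by (auto simp: L.spec_def)
  qed
  define Y where "Y = {y. ?c y \<notin> L.spec (op_of A)}"
  have "open Y"
    using open_vimage[OF L.open_resolvent_set[OF op_of_low] cc] by (simp add: Y_def vimage_def)
  moreover have "closed Y"
  proof -
    have "continuous_on UNIV (\<lambda>y. F.res (op_of A) (?c y))"
      using nF by (intro continuous_on_compose2[OF F.continuous_on_res[OF oF] cc]) auto
    from closed_vimage[OF L.closed this] show ?thesis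
      by (simp add: Y_def iff vimage_def)
  qed
  moreover have "norm (op_of A) + 1 \<in> Y"
    unfolding Y_def using L.res_large(1)[OF op_of_low, of "?c (norm (op_of A) + 1)"]
    by (simp add: norm_mult del: of_real_add)
  ultimately have "Y = UNIV" using clopen[of Y] by auto
  then have "?c y \<notin> causal_spectrum n X A" for y
    unfolding causal_spectrum_eq_spec Y_def by auto
  moreover have "z = ?c (Im z)" if "Re z = 0" for z
    using that by (simp add: complex_eq_iff)
  ultimately show ?thesis by metis
qed

end

end

section \<open>Contours\<close>

lemma alt_prod_cong:
  "(\<And>k. k \<in> {1..p + 1} \<Longrightarrow> B k = B' k) \<Longrightarrow> alt_prod A \<iota> B p = alt_prod A \<iota> B' p"
  by (induction p) auto

lemma winding_number_circlepath_outside: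
  assumes "0 < r" "r < norm (z - c)"
  shows "winding_number (circlepath c r) z = 0"
  by (rule winding_number_zero_outside[of _ "cball c r"])
    (use assms in \<open>auto simp: dist_norm norm_minus_commute\<close>)

lemma surrounds_circle:
  assumes "compact K"
  shows "\<exists>r. surrounds [circlepath 0 r] UNIV K"
proof -
  obtain r where r: "r > 0" "\<And>z. z \<in> K \<Longrightarrow> norm z < r"
    using compact_imp_bounded[OF assms] unfolding bounded_pos_less by blast
  have "winding_number (circlepath 0 r) z = 1" if "z \<in> K" for z
    using r(2)[OF that] by (intro winding_number_circlepath) simp
  then show ?thesis
    using r by (intro exI[of _ r]) (force simp: surrounds_def)
qed

text \<open>A compact subset of the open right half-plane lies in a disc with a large real centre whose
  closure is contained in that half-plane.\<close>

lemma surrounds_two_circles: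
  assumes K: "compact K" "K \<subseteq> g_dom"
  shows "\<exists>c r. surrounds ([circlepath c r] @ [circlepath (- c) r]) g_dom K \<and>
    path_image (circlepath c r) \<subseteq> {z. Re z > 0} \<and> path_image (circlepath (- c) r) \<subseteq> {z. Re z < 0}"
proof -
  obtain \<delta> where \<delta>: "\<delta> > 0" "\<And>z. z \<in> K \<Longrightarrow> \<delta> \<le> \<bar>Re z\<bar>"
  proof (cases "K = {}")
    case False
    have "continuous_on K (\<lambda>z. \<bar>Re z\<bar>)" by (intro continuous_intros)
    then obtain u where "u \<in> K" "\<And>z. z \<in> K \<Longrightarrow> \<bar>Re u\<bar> \<le> \<bar>Re z\<bar>"
      using continuous_attains_inf[OF K(1) False] by blast
    then show ?thesis using K(2) by (intro that[of "\<bar>Re u\<bar>"]) (auto simp: g_dom_def)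
  qed (auto intro: that[of 1])
  obtain M where M: "M > 0" "\<And>z. z \<in> K \<Longrightarrow> norm z < M"
    using compact_imp_bounded[OF K(1)] unfolding bounded_pos_less by blast
  \<comment> \<open>Chosen so that a > \<delta> and a \<delta> > M^2. For z in K on the side of the
    centre, |z|^2 - 2 a |Re z| + a^2 is then below a^2 - a \<delta>, hence below (a - \<delta> /
    2)^2; and a - \<delta> / 2 < a keeps the disc off the imaginary axis.\<close>
  define a where "a = M\<^sup>2 / \<delta> + \<delta> + 1"
  define r where "r = a - \<delta> / 2"
  define c where "c = complex_of_real a"
  have a: "a > \<delta>" using \<delta>(1) by (simp add: a_def add_nonneg_pos)
  have ad: "a * \<delta> > M\<^sup>2" using \<delta>(1) by (simp add: a_def field_simps add_pos_pos)
  have r: "r > 0" "r < a" using \<delta>(1) a by (auto simp: r_def)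
  have sq: "(norm (z - of_real b))\<^sup>2 = (norm z)\<^sup>2 - 2 * b * Re z + b\<^sup>2" for z b
    unfolding cmod_power2 by (simp add: power2_eq_square algebra_simps)
  \<comment> \<open>Both discs are treated together: b is the centre on the side of z, so b Re z = a
    |Re z|.\<close>
  have ins: "norm (z - of_real b) < r" if "z \<in> K" "b = a \<and> Re z > 0 \<or> b = - a \<and> Re z < 0" for z b
  proof -
    have "b * Re z = a * \<bar>Re z\<bar>" using that(2) by auto
    then have "a * \<delta> \<le> b * Re z"
      using mult_left_mono[OF \<delta>(2)[OF that(1)], of a] a \<delta>(1) by simp
    moreover have "(norm z)\<^sup>2 < M\<^sup>2" using M that by (intro power_strict_mono) auto
    moreover have "b\<^sup>2 = a\<^sup>2" using that(2) by auto
    moreover have "r\<^sup>2 = a\<^sup>2 - a * \<delta> + (\<delta> / 2)\<^sup>2"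
      by (simp add: r_def power2_eq_square algebra_simps)
    ultimately have "(norm (z - of_real b))\<^sup>2 < r\<^sup>2"
      using ad zero_le_power2[of "\<delta> / 2"] unfolding sq by linarith
    then show ?thesis using r(1) by (simp add: power_less_imp_less_base)
  qed
  have out: "r < norm (z - of_real b)" if "b = a \<and> Re z \<le> 0 \<or> b = - a \<and> Re z \<ge> 0" for z b
    using abs_Re_le_cmod[of "z - of_real b"] that r a \<delta>(1) by auto
  have sph: "path_image (circlepath c r) \<subseteq> {z. Re z > 0}" "path_image (circlepath (- c) r) \<subseteq> {z. Re z < 0}"
    using out[of a] out[of "- a"] r
    by (force simp: c_def dist_norm norm_minus_commute not_less[symmetric])+
  have w: "(\<Sum>\<gamma>\<leftarrow>[circlepath c r] @ [circlepath (- c) r]. winding_number \<gamma> z) = 1" if "z \<in> K" for z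
  proof (cases "Re z > 0")
    case True
    then show ?thesis
      using winding_number_circlepath[of z c r] ins[OF that, of a] out[of "- a" z]
        winding_number_circlepath_outside[of r z "- c"] r(1)
      by (simp add: c_def)
  next
    case False
    then have "Re z < 0" using K(2) that by (auto simp: g_dom_def)
    then show ?thesis
      using winding_number_circlepath[of z "- c" r] ins[OF that, of "- a"] out[of a z]
        winding_number_circlepath_outside[of r z c] r(1)
      by (simp add: c_def)
  qed
  have w0: "(\<Sum>\<gamma>\<leftarrow>[circlepath c r] @ [circlepath (- c) r]. winding_number \<gamma> z) = 0" if "z \<notin> g_dom" for z
    using that out[of a z] out[of "- a" z] winding_number_circlepath_outside[of r z "- c"]
      winding_number_circlepath_outside[of r z c] r(1)
    by (simp add: c_def g_dom_def)
  have "z \<notin> path_image (circlepath c r) \<and> z \<notin> path_image (circlepath (- c) r)" if "z \<in> K" for z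
  proof (cases "Re z > 0")
    case True
    then show ?thesis
      using ins[OF that, of a] out[of "- a" z] r by (auto simp: c_def dist_norm norm_minus_commute)
  next
    case False
    then have "Re z < 0" using K(2) that by (auto simp: g_dom_def)
    then show ?thesis
      using ins[OF that, of "- a"] out[of a z] r by (auto simp: c_def dist_norm norm_minus_commute)
  qed
  then have "surrounds ([circlepath c r] @ [circlepath (- c) r]) g_dom K"
    using w w0 sph unfolding surrounds_def by (auto simp: g_dom_def)
  with sph show ?thesis by blast
qed

section \<open>The three families of functions on a pair of cycles\<close>

context two_contours
begin

text \<open>For each t at most one of the two cycles contributes, and the sign of t decides which.
  The function h enters through its values on the curves.\<close>

lemma cycle_integral_h:
  assumes F: "C1_holo F (- K)"
    and hp: "\<And>w. w \<in> cycle_image \<Gamma>p \<Longrightarrow> h t w = (if t < 0 then - exp (w * of_real t) else 0)"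
    and hn: "\<And>w. w \<in> cycle_image \<Gamma>n \<Longrightarrow> h t w = (if t > 0 then exp (w * of_real t) else 0)"
  shows "cycle_integral (\<Gamma>p @ \<Gamma>n) (\<lambda>w. h t w *\<^sub>C F w) =
    (if t < 0 then - cycle_integral \<Gamma>p (\<lambda>w. exp (w * of_real t) *\<^sub>C F w)
     else if t > 0 then cycle_integral \<Gamma>n (\<lambda>w. exp (w * of_real t) *\<^sub>C F w) else 0)"
proof -
  have im: "cycle_in \<Gamma> (cycle_image \<Gamma>)" if "\<Gamma> \<in> {\<Gamma>p, \<Gamma>n}" for \<Gamma>
    using cycles(1)[OF that] by (auto simp: cycle_in_def cycle_image_def)
  have z: "cycle_integral \<Gamma> (\<lambda>w. 0) = 0" for \<Gamma>
    by (simp add: cycle_integral_def scaleC.zero_right)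
  have neg: "cycle_integral \<Gamma>p (\<lambda>w. - (exp (w * of_real t) *\<^sub>C F w)) =
      - cycle_integral \<Gamma>p (\<lambda>w. exp (w * of_real t) *\<^sub>C F w)"
    by (rule cycle_integral_linear[OF open_K cycles(1) C1_holo_exp[OF open_K F]
          bounded_linear_minus[OF bounded_linear_ident]])
      (simp_all add: scaleC.minus_right)
  have "cycle_integral \<Gamma>p (\<lambda>w. h t w *\<^sub>C F w) =
      cycle_integral \<Gamma>p (\<lambda>w. (if t < 0 then - exp (w * of_real t) else 0) *\<^sub>C F w)"
    by (rule cycle_integral_cong[OF im]) (auto simp: hp)
  also have "\<dots> = (if t < 0 then - cycle_integral \<Gamma>p (\<lambda>w. exp (w * of_real t) *\<^sub>C F w) else 0)"
    using neg by (simp add: scaleC.minus_left scaleC_zero_left z)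
  finally have p: "cycle_integral \<Gamma>p (\<lambda>w. h t w *\<^sub>C F w) =
      (if t < 0 then - cycle_integral \<Gamma>p (\<lambda>w. exp (w * of_real t) *\<^sub>C F w) else 0)" .
  have "cycle_integral \<Gamma>n (\<lambda>w. h t w *\<^sub>C F w) =
      cycle_integral \<Gamma>n (\<lambda>w. (if t > 0 then exp (w * of_real t) else 0) *\<^sub>C F w)"
    by (rule cycle_integral_cong[OF im]) (auto simp: hn)
  also have "\<dots> = (if t > 0 then cycle_integral \<Gamma>n (\<lambda>w. exp (w * of_real t) *\<^sub>C F w) else 0)"
    by (simp add: scaleC_zero_left z)
  finally show ?thesis using p by (simp add: cycle_integral_append)
qed

context
  fixes D and h :: "real \<Rightarrow> complex \<Rightarrow> complex"
  assumes D: "cauchy_domain D" "K \<subseteq> D" "surrounds (\<Gamma>p @ \<Gamma>n) D K"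
    and hol: "\<And>t. h t holomorphic_on D"
    and hp: "\<And>t w. w \<in> cycle_image \<Gamma>p \<Longrightarrow> h t w = (if t < 0 then - exp (w * of_real t) else 0)"
    and hn: "\<And>t w. w \<in> cycle_image \<Gamma>n \<Longrightarrow> h t w = (if t > 0 then exp (w * of_real t) else 0)"
begin

text \<open>At t = 0 the left side is 0, while for p > 0 \<open>Dd p\<close> holds the one-sided
  limit of the divided difference; hence t \<noteq> 0.\<close>

lemma cauchy_value_Dd:
  assumes "p < m" "t \<noteq> 0"
  shows "cauchy_value D K (\<lambda>z. h t z *\<^sub>C \<Phi> p z) = Dd p t"
  using cauchy_value_chain[OF D(1) hol[of t] D(3,2) assms(1)] assms(2)
    cycle_integral_h[where h = h and t = t, OF C1_holo_\<Phi>[OF assms(1)] hp hn]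
  by (auto simp: Dd_def E_def scaleC.minus_right)

text \<open>A cycle surrounding \<open>K\<close> also surrounds the spectrum of each block, which is
  part of \<open>K\<close>. The calculus of one block, as a chain of length one, can therefore be
  evaluated on the common pair of cycles. The time t = 0 is included: both sides are then 0.\<close>

lemma cauchy_value_hf:
  assumes k: "k \<in> {1..m}"
  shows "cauchy_value D (corner_algebra.spec (V k) (P k) (A (\<iota> k) (\<iota> k))) (\<lambda>z. h t z *\<^sub>C R k z) = hf k t"
proof -
  let ?S = "corner_algebra.spec (V k) (P k) (A (\<iota> k) (\<iota> k))"
  interpret k: resolvent_chain A "\<lambda>_. \<iota> k" 1 "\<lambda>_. V k" "\<lambda>_. P k" ?S
    by (rule resolvent_chain.intro)
      (use corner[OF k] diag[OF k] corner_algebra.compact_spec[OF corner[OF k] diag[OF k]] in auto)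
  have R: "k.\<Phi> 0 = R k"
    by (simp add: k.\<Phi>_0 k.R_def R_def)
  have "surrounds (\<Gamma>p @ \<Gamma>n) D ?S" "?S \<subseteq> D"
    using D(2,3) spec[OF k] unfolding surrounds_def by blast+
  from k.cauchy_value_chain[OF D(1) hol[of t] this, of 0]
  show ?thesis
    using cycle_integral_h[where h = h and t = t, OF C1_holo_R[OF k] hp hn]
    by (auto simp: R hf_def H_def scaleC.minus_right scaleC.zero_right)
qed

end

text \<open>With \<open>\<Gamma>p\<close> empty, the antiderivative vanishes at s = 0 because
  \<open>Dd (Suc p) 0\<close> is 0, and at s = t the value of \<open>H \<Gamma>n\<close> at 0 is the
  whole unit.\<close>

lemma convolution_plus:
  assumes "\<Gamma>p = []" "Suc p < m" "t \<ge> 0"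
  shows "((\<lambda>s. (Dd p s o\<^sub>L A (\<iota> (p + 1)) (\<iota> (p + 2))) o\<^sub>L hf (p + 2) (t - s)) has_integral
    Dd (Suc p) t) {0..t}"
proof -
  have E: "E \<Gamma>p q s = 0" and H: "H \<Gamma>p k s = 0" for q k s using assms(1) by simp_all
  have "H \<Gamma>n (p + 2) 0 = P (p + 2)"
    using H_sum[of "p + 2"] assms(2) by (simp add: H)
  moreover have "Dd (Suc p) 0 = 0" by (simp add: Dd_def E)
  ultimately have "W p t t - W p t 0 = Dd (Suc p) t"
    using assms(3) Dd_P[OF assms(2)] by (simp add: W_def blinfun_comp.zero_left)
  then show ?thesis using W_integral[OF assms(2,3), of t] by simp
qed

text \<open>With \<open>\<Gamma>n\<close> empty, the branch of \<open>W\<close> for s \<le> t is 0;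
  at s = 0 the other branch leaves \<open>Dd (Suc p) t\<close>, because \<open>Dd (Suc p) 0\<close>
  is 0.\<close>

lemma convolution_minus:
  assumes "\<Gamma>n = []" "Suc p < m" "t \<le> 0"
  shows "((\<lambda>s. (Dd p s o\<^sub>L A (\<iota> (p + 1)) (\<iota> (p + 2))) o\<^sub>L hf (p + 2) (t - s)) has_integral
    Dd (Suc p) t) {t..0}"
proof -
  have E: "E \<Gamma>n q s = 0" and H: "H \<Gamma>n k s = 0" for q k s using assms(1) by simp_all
  have "Dd (Suc p) 0 = 0"
    using E_sum[OF assms(2)] by (simp add: Dd_def E)
  then have "W p t 0 - W p t t = Dd (Suc p) t"
    using assms(3) by (auto simp: W_def H blinfun_comp.zero_left blinfun_comp.zero_right)
  then show ?thesis using W_integral[OF assms(2,3), of t] by simp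
qed

context
  assumes Re_p: "cycle_image \<Gamma>p \<subseteq> {z. Re z > 0}" and Re_n: "cycle_image \<Gamma>n \<subseteq> {z. Re z < 0}"
begin

lemma exp_decay:
  assumes F: "C1_holo F (- K)"
  shows "((\<lambda>t. cycle_integral \<Gamma>p (\<lambda>w. exp (w * of_real t) *\<^sub>C F w)) \<longlongrightarrow> 0) at_bot"
    and "((\<lambda>t. cycle_integral \<Gamma>n (\<lambda>w. exp (w * of_real t) *\<^sub>C F w)) \<longlongrightarrow> 0) at_top"
proof -
  have "cycle_in \<Gamma>p (- K \<inter> {z. Re z > 0})"
    using cycles(1)[of \<Gamma>p] Re_p by (auto simp: cycle_in_def cycle_image_def)
  from cycle_integral_exp_tendsto_0[OF _ this C1_holo_subset[OF F], where \<sigma> = "-1"]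
  show "((\<lambda>t. cycle_integral \<Gamma>p (\<lambda>w. exp (w * of_real t) *\<^sub>C F w)) \<longlongrightarrow> 0) at_bot"
    using open_Int[OF open_K open_halfspace_Re_gt[of 0]] by (simp add: filterlim_at_bot_mirror)
  have "cycle_in \<Gamma>n (- K \<inter> {z. Re z < 0})"
    using cycles(1)[of \<Gamma>n] Re_n by (auto simp: cycle_in_def cycle_image_def)
  from cycle_integral_exp_tendsto_0[OF _ this C1_holo_subset[OF F], where \<sigma> = 1]
  show "((\<lambda>t. cycle_integral \<Gamma>n (\<lambda>w. exp (w * of_real t) *\<^sub>C F w)) \<longlongrightarrow> 0) at_top"
    using open_Int[OF open_K open_halfspace_Re_lt[of 0]] by simp
qed

lemma E_decay:
  assumes "p < m"
  shows "(E \<Gamma>p p \<longlongrightarrow> 0) at_bot" "(E \<Gamma>n p \<longlongrightarrow> 0) at_top"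
  unfolding E_def[abs_def]
  using exp_decay[OF C1_holo_\<Phi>[OF assms]]
  by (auto intro!: bounded_linear.tendsto_zero[OF scaleC.bounded_linear_right])

lemma H_decay:
  assumes "k \<in> {1..m}"
  shows "(H \<Gamma>p k \<longlongrightarrow> 0) at_bot" "(H \<Gamma>n k \<longlongrightarrow> 0) at_top"
  unfolding H_def[abs_def]
  using exp_decay[OF C1_holo_R[OF assms]]
  by (auto intro!: bounded_linear.tendsto_zero[OF scaleC.bounded_linear_right])

text \<open>As s tends to minus infinity both factors of \<open>W\<close> decay. As s tends to
  infinity the product in the second branch decays and leaves the compensating summand
  \<open>Dd (Suc p) t\<close>.\<close>

lemma convolution_g:
  assumes p: "Suc p < m"
  shows "((\<lambda>s. (Dd p s o\<^sub>L A (\<iota> (p + 1)) (\<iota> (p + 2))) o\<^sub>L hf (p + 2) (t - s)) has_integral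
    Dd (Suc p) t) UNIV"
proof (rule has_integral_UNIV_limit[of _ "W p t"])
  have k: "p + 2 \<in> {1..m}" using p by auto
  have t1: "filterlim (\<lambda>s. t - s) at_top at_bot" and t2: "filterlim (\<lambda>s. t - s) at_bot at_top"
    by real_asymp+
  show "((\<lambda>s. (Dd p s o\<^sub>L A (\<iota> (p + 1)) (\<iota> (p + 2))) o\<^sub>L hf (p + 2) (t - s)) has_integral
      W p t b - W p t a) {a..b}" if "a \<le> b" for a b
    by (rule W_integral[OF p that])
  have "((\<lambda>s. - E \<Gamma>p (Suc p) s o\<^sub>L H \<Gamma>n (p + 2) (t - s)) \<longlongrightarrow> - 0 o\<^sub>L (0 :: 'a \<Rightarrow>\<^sub>L 'a)) at_bot"
    by (intro blinfun_comp.tendsto tendsto_minus E_decay[OF p] filterlim_compose[OF H_decay(2)[OF k] t1])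
  \<comment> \<open>To the left of both 0 and t each definition by cases has settled on one
    branch.\<close>
  moreover have "\<forall>\<^sub>F s in at_bot. W p t s = - E \<Gamma>p (Suc p) s o\<^sub>L H \<Gamma>n (p + 2) (t - s)"
    using eventually_le_at_bot[of "min t 0"] by eventually_elim (simp add: W_def Dd_def)
  ultimately show "(W p t \<longlongrightarrow> 0) at_bot"
    by (simp add: tendsto_cong blinfun_comp.zero_left)
  have "((\<lambda>s. Dd (Suc p) t - (E \<Gamma>n (Suc p) s o\<^sub>L H \<Gamma>p (p + 2) (t - s))) \<longlongrightarrow> Dd (Suc p) t - (0 o\<^sub>L (0 :: 'a \<Rightarrow>\<^sub>L 'a))) at_top"
    by (intro blinfun_comp.tendsto tendsto_diff tendsto_const E_decay[OF p]
        filterlim_compose[OF H_decay(1)[OF k] t2])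
  moreover have "\<forall>\<^sub>F s in at_top. W p t s = Dd (Suc p) t - (E \<Gamma>n (Suc p) s o\<^sub>L H \<Gamma>p (p + 2) (t - s))"
    using eventually_gt_at_top[of "max t 0"]
    by eventually_elim (simp add: W_def Dd_def[of _ s for s] Dd_def)
  ultimately show "(W p t \<longlongrightarrow> Dd (Suc p) t) at_top"
    by (simp add: tendsto_cong blinfun_comp.zero_left)
qed

end

end

section \<open>Holomorphy of the three families, and assembly of the formulas\<close>

lemma exp_plus_holomorphic: "exp_plus t holomorphic_on S"
  unfolding exp_plus_def[abs_def] by (cases "t > 0") (auto intro!: holomorphic_intros)

lemma exp_minus_holomorphic: "exp_minus t holomorphic_on S"
  unfolding exp_minus_def[abs_def] by (cases "t < 0") (auto intro!: holomorphic_intros)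

lemma g_fun_holomorphic: "g_fun t holomorphic_on g_dom"
proof -
  have "g_fun t holomorphic_on {z. Re z > 0}"
    by (rule holomorphic_transform[OF exp_minus_holomorphic]) (simp add: g_fun_def)
  moreover have "g_fun t holomorphic_on {z. Re z < 0}"
    by (rule holomorphic_transform[OF exp_plus_holomorphic]) (simp add: g_fun_def)
  ultimately have "g_fun t holomorphic_on {z. Re z > 0} \<union> {z. Re z < 0}"
    using open_halfspace_Re_gt[of 0] open_halfspace_Re_lt[of 0] by (intro holomorphic_on_Un) auto
  moreover have "{z. Re z > 0} \<union> {z. Re z < 0} = g_dom" by (auto simp: g_dom_def)
  ultimately show ?thesis by simp
qed

theorem theorem23:
  fixes n m :: nat
    and X :: "nat \<Rightarrow> 'a::complex_banach set"
    and A :: "'a op_matrix"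
    and \<iota> :: "nat \<Rightarrow> nat"
  assumes "direct_sum_decomp n X"
    and "A \<in> carrier (lower_matrix_alg n X)"
    and "m \<ge> 2"
    and "\<iota> 1 \<le> n"
    and "\<forall>k\<in>{1..<m}. \<iota> (k + 1) < \<iota> k"
    and "1 \<le> \<iota> m"
  shows "(\<forall>t>0. has_iterated_integral (\<lambda>k s. {0..s (k + 1)})
            (integrand n X UNIV exp_plus (m - 1) A \<iota>) (m - 1) (simplex_point (m - 1) t)
            (div_diff n X UNIV (exp_plus t) (m - 1) A \<iota>)) \<and>
         (\<forall>t<0. has_iterated_integral (\<lambda>k s. {s (k + 1)..0})
            (integrand n X UNIV exp_minus (m - 1) A \<iota>) (m - 1) (simplex_point (m - 1) t)
            (div_diff n X UNIV (exp_minus t) (m - 1) A \<iota>)) \<and>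
         ((\<forall>z\<in>spectrum n X A. Re z \<noteq> 0) \<longrightarrow>
            (\<forall>t. t \<noteq> 0 \<longrightarrow> has_iterated_integral (\<lambda>k s. UNIV)
               (integrand n X g_dom g_fun (m - 1) A \<iota>) (m - 1) (simplex_point (m - 1) t)
               (div_diff n X g_dom (g_fun t) (m - 1) A \<iota>)))"
proof -
  interpret decomposition n X by unfold_locales fact
  note A = assms(2)
  define K where "K = causal_spectrum n X A"
  have \<iota>: "\<iota> k \<in> {1..n}" if "k \<in> {1..m}" for k
  proof -
    have "k \<ge> 1" "k \<le> m" using that by auto
    have "\<iota> k \<le> \<iota> 1" using \<open>k \<ge> 1\<close> \<open>k \<le> m\<close>
    proof (induction k rule: dec_induct)
      case (step j)
      then show ?case using assms(5)[rule_format, of j] by simp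
    qed simp
    moreover have "\<iota> m \<le> \<iota> k" using \<open>k \<le> m\<close> \<open>k \<ge> 1\<close>
    proof (induction k rule: inc_induct)
      case (step j)
      then show ?case using assms(5)[rule_format, of j] by simp
    qed simp
    ultimately show ?thesis using assms(4,6) by auto
  qed
  define V where "V k = block_ops n X (\<iota> k) (\<iota> k)" for k
  define P where "P k = Pr (\<iota> k)" for k
  interpret resolvent_chain A \<iota> m V P K
  proof (rule resolvent_chain.intro)
    fix k assume k: "k \<in> {1..m}"
    show "corner_algebra (V k) (P k)" unfolding V_def P_def by (rule corner_block[OF \<iota>[OF k]])
    show "A (\<iota> k) (\<iota> k) \<in> V k" unfolding V_def by (rule A_block[OF A \<iota>[OF k] \<iota>[OF k]])
    show "corner_algebra.spec (V k) (P k) (A (\<iota> k) (\<iota> k)) \<subseteq> K"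
      unfolding V_def P_def K_def by (rule diag_spec_subset[OF A \<iota>[OF k]])
  next
    fix k assume "k \<in> {1..<m}"
    then have k: "\<iota> k \<in> {1..n}" "\<iota> (k + 1) \<in> {1..n}" using \<iota>[of k] \<iota>[of "k + 1"] by auto
    show "clin (A (\<iota> k) (\<iota> (k + 1)))" "A (\<iota> k) (\<iota> (k + 1)) o\<^sub>L P (k + 1) = A (\<iota> k) (\<iota> (k + 1))"
      using A_block[OF A k] unfolding P_def block_ops_iff[OF k] by blast+
  next
    show "compact K" unfolding K_def by (rule compact_causal_spectrum[OF A])
    show "1 \<le> m" using assms(3) by simp
  qed
  have R: "R k = resolvent (block_alg n X (\<iota> k)) (A (\<iota> k) (\<iota> k))" if "k \<in> {1..m}" for k
    unfolding R_def V_def P_def by (rule resolvent_block[OF \<iota>[OF that], symmetric])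
  have dd: "div_diff n X D f p A \<iota> = cauchy_value D K (\<lambda>z. f z *\<^sub>C \<Phi> p z)" if "p < m" for D f p
  proof -
    have "alt_prod A \<iota> (\<lambda>k. resolvent (block_alg n X (\<iota> k)) (A (\<iota> k) (\<iota> k)) z) p = \<Phi> p z" for z
      unfolding \<Phi>_def using that by (intro alt_prod_cong) (simp add: R)
    then show ?thesis by (simp add: div_diff_def K_def)
  qed
  have fc: "fun_calc D f (block_alg n X (\<iota> k)) (A (\<iota> k) (\<iota> k)) =
      cauchy_value D (corner_algebra.spec (V k) (P k) (A (\<iota> k) (\<iota> k))) (\<lambda>z. f z *\<^sub>C R k z)"
    if k: "k \<in> {1..m}" for D f k
    unfolding fun_calc_def R[OF k] V_def P_def
    by (simp only: spectrum_op_block[OF \<iota>[OF k] A_block[OF A \<iota>[OF k] \<iota>[OF k]]])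
  \<comment> \<open>\<open>T\<close> holds all times that occur in the inner integrals, possibly 0,
    where \<open>Dd\<close> is a limit value. Nonzero is required of the outermost t, at which the
    divided difference itself is identified.\<close>
  have main: "has_iterated_integral (\<lambda>k s. L (s (k + 1)))
      (integrand n X D h (m - 1) A \<iota>) (m - 1) (simplex_point (m - 1) t)
      (div_diff n X D (h t) (m - 1) A \<iota>)"
    if C: "two_contours A \<iota> m V P K \<Gamma>p \<Gamma>n"
      and D: "cauchy_domain D" "K \<subseteq> D" "surrounds (\<Gamma>p @ \<Gamma>n) D K"
      and hol: "\<And>t. h t holomorphic_on D"
      and hp: "\<And>t w. w \<in> cycle_image \<Gamma>p \<Longrightarrow> h t w = (if t < 0 then - exp (w * of_real t) else 0)"
      and hn: "\<And>t w. w \<in> cycle_image \<Gamma>n \<Longrightarrow> h t w = (if t > 0 then exp (w * of_real t) else 0)"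
      and conv: "\<And>p t. Suc p < m \<Longrightarrow> t \<in> T \<Longrightarrow>
        ((\<lambda>s. (two_contours.Dd A \<iota> V P \<Gamma>p \<Gamma>n p s o\<^sub>L A (\<iota> (p + 1)) (\<iota> (p + 2))) o\<^sub>L
          two_contours.hf A \<iota> V P \<Gamma>p \<Gamma>n (p + 2) (t - s))
        has_integral two_contours.Dd A \<iota> V P \<Gamma>p \<Gamma>n (Suc p) t) (L t)"
      and L: "\<And>t. t \<in> T \<Longrightarrow> L t \<subseteq> T" and t: "t \<in> T" "t \<noteq> 0"
    for \<Gamma>p \<Gamma>n D h L T t
  proof -
    interpret two_contours A \<iota> m V P K \<Gamma>p \<Gamma>n by (rule C)
    have "integrand n X D h (m - 1) A \<iota> =
        (\<lambda>s. alt_prod A \<iota> (\<lambda>k. hf k (s k - s (k - 1))) (m - 1))"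
      unfolding integrand_def
      using cauchy_value_hf[OF D hol hp hn] assms(3)
      by (intro ext alt_prod_cong) (simp add: fc)
    moreover have "div_diff n X D (h t) (m - 1) A \<iota> = Dd (m - 1) t"
      using cauchy_value_Dd[OF D hol hp hn _ t(2)] assms(3) by (simp add: dd)
    moreover have "simplex_point (m - 1) t 0 = 0" "simplex_point (m - 1) t (m - 1 + 1) = t"
      by (simp_all add: simplex_point_def)
    ultimately show ?thesis
      using iterated_convolution[where T = T and L = L and p = "m - 1" and s = "simplex_point (m - 1) t",
          OF conv L] t(1) assms(3)
      by simp
  qed
  obtain r where r: "surrounds [circlepath 0 r] UNIV K"
    using surrounds_circle[OF K] by blast
  \<comment> \<open>One circle around \<open>K\<close> serves both exponentials: as
    \<open>\<Gamma>n\<close> for \<open>exp_plus\<close> and as \<open>\<Gamma>p\<close> for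
    \<open>exp_minus\<close>.\<close>
  have c1: "two_contours A \<iota> m V P K [] [circlepath 0 r]"
    and c2: "two_contours A \<iota> m V P K [circlepath 0 r] []"
    by (unfold_locales; use r in simp)+
  have "has_iterated_integral (\<lambda>k s. {0..s (k + 1)})
      (integrand n X UNIV exp_plus (m - 1) A \<iota>) (m - 1) (simplex_point (m - 1) t)
      (div_diff n X UNIV (exp_plus t) (m - 1) A \<iota>)" if "t > 0" for t
    by (rule main[OF c1, where T = "{0..}" and L = "\<lambda>t. {0..t}"])
      (use that r two_contours.convolution_plus[OF c1] in
        \<open>auto simp: cauchy_domain_UNIV exp_plus_holomorphic cycle_image_def exp_plus_def\<close>)
  moreover have "has_iterated_integral (\<lambda>k s. {s (k + 1)..0})
      (integrand n X UNIV exp_minus (m - 1) A \<iota>) (m - 1) (simplex_point (m - 1) t)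
      (div_diff n X UNIV (exp_minus t) (m - 1) A \<iota>)" if "t < 0" for t
    by (rule main[OF c2, where T = "{..0}" and L = "\<lambda>t. {t..0}"])
      (use that r two_contours.convolution_minus[OF c2] in
        \<open>auto simp: cauchy_domain_UNIV exp_minus_holomorphic cycle_image_def exp_minus_def\<close>)
  moreover have "has_iterated_integral (\<lambda>k s. UNIV)
      (integrand n X g_dom g_fun (m - 1) A \<iota>) (m - 1) (simplex_point (m - 1) t)
      (div_diff n X g_dom (g_fun t) (m - 1) A \<iota>)"
    if "\<forall>z\<in>spectrum n X A. Re z \<noteq> 0" "t \<noteq> 0" for t
  proof -
    have Kg: "K \<subseteq> g_dom"
      using causal_spectrum_imaginary[OF A that(1)] by (auto simp: K_def g_dom_def)
    obtain c r where cr: "surrounds ([circlepath c r] @ [circlepath (- c) r]) g_dom K"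
      "path_image (circlepath c r) \<subseteq> {z. Re z > 0}" "path_image (circlepath (- c) r) \<subseteq> {z. Re z < 0}"
      using surrounds_two_circles[OF K Kg] by blast
    have c3: "two_contours A \<iota> m V P K [circlepath c r] [circlepath (- c) r]"
      by unfold_locales (use cr(1) in \<open>auto simp: surrounds_def\<close>)
    have im: "cycle_image [circlepath c r] \<subseteq> {z. Re z > 0}"
      "cycle_image [circlepath (- c) r] \<subseteq> {z. Re z < 0}"
      unfolding cycle_image_def using cr by auto
    show ?thesis
    proof (rule main[OF c3 cauchy_domain_g_dom Kg cr(1) g_fun_holomorphic,
          where T = UNIV and L = "\<lambda>_. UNIV"])
      show "g_fun t w = (if t < 0 then - exp (w * of_real t) else 0)"
        if "w \<in> cycle_image [circlepath c r]" for t w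
        using subsetD[OF im(1) that] by (simp add: g_fun_def exp_minus_def)
      show "g_fun t w = (if t > 0 then exp (w * of_real t) else 0)"
        if "w \<in> cycle_image [circlepath (- c) r]" for t w
        using subsetD[OF im(2) that] by (simp add: g_fun_def exp_plus_def)
    qed (use two_contours.convolution_g[OF c3 im] that(2) in auto)
  qed
  ultimately show ?thesis by blast
qed

end
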